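(* Let $d\ge 1$, $T>0$, and let $\beta:\mathbb{R}\to\mathbb{R}$, $b:\mathbb{R}\to\mathbb{R}$, $D:\mathbb{R}^d\to\mathbb{R}^d$ satisfy Hypotheses (j)--(jv) listed in the context. Let $y_1,y_2\in L^\infty((0,T)\times\mathbb{R}^d)$ be two distributional solutions on $(0,T)\times\mathbb{R}^d$ to $$\rho_t-\Delta\beta(\rho)+\mathrm{div}(D\,b(\rho)\rho)=0,\qquad \rho(0,\cdot)=\rho_0,$$ such that $y_1-y_2\in L^\infty(0,T;H^{-1}(\mathbb{R}^d))$ and $$\lim_{t\to0}\ \operatorname*{ess\,sup}_{s\in(0,t)}\left|\int_{\mathbb{R}^d}(y_1(s,x)-y_2(s,x))\varphi(x)\,dx\right|=0\quad\text{for all }\varphi\in C_0^\infty(\mathbb{R}^d).$$ Then $y_1\equiv y_2$ (a.e. on $(0,T)\times\mathbb{R}^d$).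
   Context: Hypotheses: (j) $\beta\in C^1(\mathbb{R})$, $\beta'(r)\ge0$ for all $r\in\mathbb{R}$, $\beta(0)=0$. (jj) $D\in L^\infty(\mathbb{R}^d;\mathbb{R}^d)$. (jjj) $b\in C^1(\mathbb{R})$. (jv) For each compact $K\subset\mathbb{R}$ there exists $\alpha_K\in(0,\infty)$ such that $|b'(r)r+b(r)|\le\alpha_K|\beta'(r)|$ for all $r\in K$ (or, equivalently, $|b(r)r-b(\bar r)\bar r|\le\alpha_K|\beta(r)-\beta(\bar r)|$ for all $r,\bar r\in K$). Distributional solution on $(0,T)\times\mathbb{R}^d$, with initial datum $\rho_0$ a signed Radon measure of bounded variation on $\mathbb{R}^d$: a function $\rho$ with $\beta(\rho)\in L^1_{\rm loc}((0,T)\times\mathbb{R}^d)$ and $$\int_0^T\!\!\int_{\mathbb{R}^d}\big(\rho\varphi_t+\beta(\rho)\Delta\varphi+b(\rho)\rho\,(D\cdot\nabla\varphi)\big)\,dx\,dt+\int_{\mathbb{R}^d}\varphi(0,x)\,\rho_0(dx)=0$$ for all $\varphi\in C_0^\infty([0,T)\times\mathbb{R}^d)$ (smooth with compact support in $[0,T)\times\mathbb{R}^d$). $H^{-1}(\mathbb{R}^d)$ is the dual of $H^1(\mathbb{R}^d)$. *)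

theory Defs
  imports "HOL-Analysis.Analysis" "HOL-Probability.Essential_Supremum"
begin

definition dir_deriv :: "'a::euclidean_space \<Rightarrow> ('a \<Rightarrow> real) \<Rightarrow> 'a \<Rightarrow> real" where
  "dir_deriv v f x = frechet_derivative f (at x) v"

definition grad :: "('a::euclidean_space \<Rightarrow> real) \<Rightarrow> 'a \<Rightarrow> 'a" where
  "grad f x = (\<Sum>i\<in>Basis. dir_deriv i f x *\<^sub>R i)"

definition laplacian :: "('a::euclidean_space \<Rightarrow> real) \<Rightarrow> 'a \<Rightarrow> real" where
  "laplacian f x = (\<Sum>i\<in>Basis. dir_deriv i (dir_deriv i f) x)"

primrec Ck :: "nat \<Rightarrow> ('a::euclidean_space \<Rightarrow> real) \<Rightarrow> bool" where
  "Ck 0 f \<longleftrightarrow> continuous_on UNIV f"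
| "Ck (Suc k) f \<longleftrightarrow> (\<forall>x. f differentiable (at x)) \<and> (\<forall>i\<in>Basis. Ck k (dir_deriv i f))"

definition test_functions_on :: "'a::euclidean_space set \<Rightarrow> ('a \<Rightarrow> real) set" where
  "test_functions_on S =
     {\<phi>. (\<forall>k. Ck k \<phi>) \<and> (\<exists>K. compact K \<and> K \<subseteq> S \<and> (\<forall>x. x \<notin> K \<longrightarrow> \<phi> x = 0))}"

abbreviation test_functions :: "('a::euclidean_space \<Rightarrow> real) set" where
  "test_functions \<equiv> test_functions_on UNIV"

text \<open>Elements of Lebesgue spaces are represented by functions on the whole space; only their
  values on the set \<open>S\<close> matter, and equality is equality almost everywhere.\<close>

definition Linfty_on :: "'a::euclidean_space set \<Rightarrow> ('a \<Rightarrow> 'b::euclidean_space) set" where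
  "Linfty_on S = {f. f \<in> borel_measurable (lebesgue_on S) \<and>
     (\<exists>C. AE x in lebesgue_on S. norm (f x) \<le> C)}"

definition L1_loc_on :: "'a::euclidean_space set \<Rightarrow> ('a \<Rightarrow> real) set" where
  "L1_loc_on S = {f. \<forall>K. compact K \<longrightarrow> K \<subseteq> S \<longrightarrow> set_integrable lebesgue K f}"

definition L2 :: "('a::euclidean_space \<Rightarrow> 'b::euclidean_space) set" where
  "L2 = {f. f \<in> borel_measurable lebesgue \<and> integrable lebesgue (\<lambda>x. (norm (f x))\<^sup>2)}"

definition weak_grad :: "('a::euclidean_space \<Rightarrow> real) \<Rightarrow> ('a \<Rightarrow> 'a) \<Rightarrow> bool" where
  "weak_grad u g \<longleftrightarrow> (\<forall>\<phi>\<in>test_functions. \<forall>i\<in>Basis.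
     (\<integral>x. u x * dir_deriv i \<phi> x \<partial>lebesgue) = - (\<integral>x. (g x \<bullet> i) * \<phi> x \<partial>lebesgue))"

definition H1 :: "('a::euclidean_space \<Rightarrow> real) set" where
  "H1 = {u \<in> L2. \<exists>g\<in>L2. weak_grad u g}"

text \<open>The choice below is immaterial: weak gradients are unique almost everywhere.\<close>

definition h1_norm :: "('a::euclidean_space \<Rightarrow> real) \<Rightarrow> real" where
  "h1_norm u = (let g = (SOME g. g \<in> L2 \<and> weak_grad u g) in
     sqrt ((\<integral>x. (u x)\<^sup>2 \<partial>lebesgue) + (\<integral>x. (norm (g x))\<^sup>2 \<partial>lebesgue)))"

text \<open>Only the values of a functional on \<open>H1\<close> matter. Boundedness makes it respect
  equality almost everywhere, since the difference then has \<open>h1_norm\<close> zero.\<close>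

definition Hm1 :: "(('a::euclidean_space \<Rightarrow> real) \<Rightarrow> real) set" where
  "Hm1 = {L. (\<forall>u\<in>H1. \<forall>v\<in>H1. \<forall>a b. L (\<lambda>x. a * u x + b * v x) = a * L u + b * L v) \<and>
     (\<exists>C. \<forall>u\<in>H1. \<bar>L u\<bar> \<le> C * h1_norm u)}"

definition hm1_norm :: "(('a::euclidean_space \<Rightarrow> real) \<Rightarrow> real) \<Rightarrow> real" where
  "hm1_norm L = Sup {\<bar>L u\<bar> |u. u \<in> H1 \<and> h1_norm u \<le> 1}"

definition Hm1_simple_on :: "real set \<Rightarrow> (real \<Rightarrow> ('a::euclidean_space \<Rightarrow> real) \<Rightarrow> real) set" where
  "Hm1_simple_on I = {s. finite (s ` I) \<and> s ` I \<subseteq> Hm1 \<and>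
     (\<forall>L. {t \<in> I. s t = L} \<in> sets lebesgue)}"

text \<open>The Bochner space $L^\infty(I; H^{-1})$: strongly measurable, essentially bounded.\<close>

definition Linfty_Hm1_on :: "real set \<Rightarrow> (real \<Rightarrow> ('a::euclidean_space \<Rightarrow> real) \<Rightarrow> real) set" where
  "Linfty_Hm1_on I = {Z. (AE t in lebesgue_on I. Z t \<in> Hm1) \<and>
     (\<exists>s. (\<forall>n::nat. s n \<in> Hm1_simple_on I) \<and>
        (AE t in lebesgue_on I. (\<lambda>n. hm1_norm (\<lambda>u. s n t u - Z t u)) \<longlonglongrightarrow> 0)) \<and>
     (\<exists>C. AE t in lebesgue_on I. hm1_norm (Z t) \<le> C)}"

text \<open>A function \<open>z\<close> of time and space belongs to $L^\infty(I; H^{-1})$ if, for almost every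
  time, the distribution given by the slice \<open>z (t, \<cdot>)\<close> is the restriction to test
  functions of the element \<open>Z t\<close> of $H^{-1}$, for some \<open>Z\<close> in the Bochner space.\<close>

definition in_Linfty_Hm1_on :: "real set \<Rightarrow> (real \<times> 'a::euclidean_space \<Rightarrow> real) \<Rightarrow> bool" where
  "in_Linfty_Hm1_on I z \<longleftrightarrow> (\<exists>Z \<in> Linfty_Hm1_on I.
     AE t in lebesgue_on I. \<forall>\<phi>\<in>test_functions.
       integrable lebesgue (\<lambda>x. z (t, x) * \<phi> x) \<and> Z t \<phi> = (\<integral>x. z (t, x) * \<phi> x \<partial>lebesgue))"

text \<open>A real-valued countably additive function on the Borel sets of a Euclidean space has
  finite total variation and is regular, so these are exactly the signed Radon measures of
  bounded variation. Countable additivity forces \<open>\<nu> {} = 0\<close>.\<close>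

definition signed_radon_measure :: "('a::euclidean_space set \<Rightarrow> real) \<Rightarrow> bool" where
  "signed_radon_measure \<nu> \<longleftrightarrow> (\<forall>A :: nat \<Rightarrow> 'a set.
     range A \<subseteq> sets borel \<longrightarrow> disjoint_family A \<longrightarrow> (\<lambda>i. \<nu> (A i)) sums \<nu> (\<Union>i. A i))"

text \<open>The positive part in the Jordan decomposition; \<open>ennreal\<close> truncates negative values
  to 0. The negative part is the positive part of \<open>\<lambda>A. - \<nu> A\<close>.\<close>

definition pos_part_measure :: "('a::euclidean_space set \<Rightarrow> real) \<Rightarrow> 'a measure" where
  "pos_part_measure \<nu> =
     measure_of UNIV (sets borel) (\<lambda>A. SUP B\<in>{B \<in> sets borel. B \<subseteq> A}. ennreal (\<nu> B))"

definition signed_integral :: "('a::euclidean_space set \<Rightarrow> real) \<Rightarrow> ('a \<Rightarrow> real) \<Rightarrow> real" where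
  "signed_integral \<nu> f =
     (\<integral>x. f x \<partial>pos_part_measure \<nu>) - (\<integral>x. f x \<partial>pos_part_measure (\<lambda>A. - \<nu> A))"

text \<open>A function is smooth with compact support in $[0,T) \times \mathbb{R}^d$ if and only if it
  is the restriction of a smooth function on the whole space-time with compact support in
  $(-\infty,T) \times \mathbb{R}^d$; the test functions are represented by such extensions. The
  integrability requirement says that the integral in the weak formulation makes sense; it is
  automatic for essentially bounded \<open>\<rho>\<close>, continuous \<open>\<beta>\<close>, \<open>b\<close> and essentially bounded \<open>D\<close>.\<close>

definition distributional_solution ::
    "real \<Rightarrow> (real \<Rightarrow> real) \<Rightarrow> (real \<Rightarrow> real) \<Rightarrow> ('a::euclidean_space \<Rightarrow> 'a) \<Rightarrow>
     ('a set \<Rightarrow> real) \<Rightarrow> (real \<times> 'a \<Rightarrow> real) \<Rightarrow> bool" where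
  "distributional_solution T \<beta> b D \<rho>0 \<rho> \<longleftrightarrow>
     (\<lambda>p. \<beta> (\<rho> p)) \<in> L1_loc_on ({0<..<T} \<times> UNIV) \<and>
     (\<forall>\<phi> \<in> test_functions_on ({..<T} \<times> UNIV).
        let F = (\<lambda>(t, x). \<rho> (t, x) * deriv (\<lambda>s. \<phi> (s, x)) t
                  + \<beta> (\<rho> (t, x)) * laplacian (\<lambda>y. \<phi> (t, y)) x
                  + b (\<rho> (t, x)) * \<rho> (t, x) * (D x \<bullet> grad (\<lambda>y. \<phi> (t, y)) x))
        in set_integrable lebesgue ({0<..<T} \<times> UNIV) F \<and>
           (LINT p:{0<..<T} \<times> UNIV|lebesgue. F p) + signed_integral \<rho>0 (\<lambda>x. \<phi> (0, x)) = 0)"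

end

theory Submission
  imports Defs "HOL-Probability.Probability"
begin

text \<open>The difference \<open>z = y1 - y2\<close> solves the linear equation $z_t = \Delta w - \mathrm{div}\, V$ with
  \<open>w = \<beta> y1 - \<beta> y2\<close> and \<open>V = (b y1 * y1 - b y2 * y2) D\<close>, where $w^2 \le C w z$ because \<open>\<beta>\<close> is monotone and
  locally Lipschitz, and $|V| \le C |w|$ by (jv). Its initial value is zero because the two weak formulations
  have the same initial term.

  Multiply by the integrable weight $\rho(x) = (1 + |x|^2)^{-d}$, whose gradient and Laplacian are bounded by
  multiples of $\rho$. At each time \<open>\<rho> z\<close>, \<open>\<rho> w\<close>, \<open>\<rho> V\<close> are then bounded and integrable, and testing with
  $\rho(x) e^{i \xi x}$ shows that each Fourier mode of \<open>\<rho> z\<close> is Lipschitz in time and starts from zero. The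
  squared $H^{-1}$ norm $E(t) = \int |\widehat{\rho z}|^2 / (1 + |\xi|^2)\, d\xi$ has a derivative consisting of
  $-2 (2 \pi)^d \int \rho^2 w z\, dx$ and of lower order terms, which by Young's inequality and Plancherel are at
  most $\delta \int \rho^2 w^2\, dx + C_\delta E$. As $w^2 \le C w z$, the first of these is absorbed for small
  $\delta$, and a Gronwall argument, in the form of an exponential weight in time, gives \<open>E = 0\<close>.\<close>


section \<open>Integration over Euclidean space\<close>

text \<open>A merely bounded \<open>z\<close> has no Fourier transform as a function; the weight
  repairs this. Its decay is algebraic because differentiating a power of \<open>1 + |x|^2\<close>
  produces nothing worse than a multiple of that power, whereas a Gaussian would lose factors of
  \<open>|x|\<close>. The price is commutator terms, at most linear in \<open>\<xi>\<close>. They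
  are bounded by \<open>w\<close> and not by \<open>z\<close>, so the dissipation absorbs them even
  where \<open>\<beta>\<close> is degenerate.

  Two orders of integration compete. The energy identity holds in time for one fixed frequency,
  since it is the single mode that agrees almost everywhere with a primitive. The dissipation has a
  sign only after integration over all frequencies at one fixed time, where Plancherel leads back to
  the pointwise inequality between \<open>w\<close> and \<open>z\<close>. The energy inequality is
  therefore derived in integrated form, mode by mode, and Fubini exchanges the two orders before the
  sign is used.

  Transforms are kept real, as cosine and sine parts, and Plancherel is needed only for bounded
  integrable functions, where a Gaussian regularisation proves it directly.\<close>

lemma lborel_integral_affine:
  fixes f :: "'a::euclidean_space \<Rightarrow> real"
  assumes [measurable]: "f \<in> borel_measurable borel" and c: "c \<noteq> 0"
  shows "(LBINT x. f x) = \<bar>c\<bar> ^ DIM('a) * (LBINT x. f (t + c *\<^sub>R x))"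
  by (subst lborel_affine[OF c, of t]) (simp add: integral_density integral_distr)

lemma lborel_integral_translate:
  fixes f :: "'a::euclidean_space \<Rightarrow> real"
  assumes [measurable]: "f \<in> borel_measurable borel"
  shows "(LBINT x. f (x + t)) = (LBINT x. f x)"
  using lborel_integral_affine[OF assms, of 1 t] by (simp add: add.commute)

lemma lborel_integrable_translate:
  fixes f :: "'a::euclidean_space \<Rightarrow> real"
  assumes "integrable lborel f"
  shows "integrable lborel (\<lambda>x. f (x + t))"
proof -
  have "integrable (distr lborel borel (\<lambda>x. t + x)) f"
    using assms by (simp add: lborel_distr_plus)
  then have "integrable lborel (f \<circ> (\<lambda>x. t + x))"
    using borel_measurable_integrable[OF assms] by (subst (asm) integrable_distr_eq) (auto simp: comp_def)
  then show ?thesis by (simp add: comp_def add.commute)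
qed

text \<open>\<open>lborel\<close> on a Euclidean space is the image of a product of one copy of the
  real line per basis vector, so the product form of Fubini's theorem carries over.\<close>

lemma
  fixes f :: "'a::euclidean_space \<Rightarrow> real \<Rightarrow> 'b::{real_normed_field,banach,second_countable_topology}"
  assumes int: "\<And>b. b \<in> Basis \<Longrightarrow> integrable lborel (f b)"
  shows integrable_lborel_prod: "integrable lborel (\<lambda>x. \<Prod>b\<in>Basis. f b (x \<bullet> b))"
    and integral_lborel_prod: "(LBINT x. (\<Prod>b\<in>Basis. f b (x \<bullet> b))) = (\<Prod>b\<in>Basis. LBINT x. f b x)"
proof -
  interpret product_sigma_finite "\<lambda>_::'a. lborel :: real measure" by standard
  have [measurable]: "\<And>b. b \<in> Basis \<Longrightarrow> f b \<in> borel_measurable borel"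
    using borel_measurable_integrable[OF int] by simp
  have eq: "(\<Prod>b\<in>Basis. f b ((\<Sum>b\<in>Basis. x b *\<^sub>R b) \<bullet> b)) = (\<Prod>b\<in>Basis. f b (x b))" for x :: "'a \<Rightarrow> real"
    by (intro prod.cong) simp_all
  show "integrable lborel (\<lambda>x. \<Prod>b\<in>Basis. f b (x \<bullet> b))"
    by (subst lborel_eq, subst integrable_distr_eq)
       (auto simp: eq intro!: product_integrable_prod int)
  show "(LBINT x. (\<Prod>b\<in>Basis. f b (x \<bullet> b))) = (\<Prod>b\<in>Basis. LBINT x. f b x)"
    by (subst lborel_eq, subst integral_distr)
       (auto simp: eq intro!: product_integral_prod int)
qed

section \<open>The Fourier transform of the Gaussian\<close>

lemma
  fixes u :: real
  shows integrable_gaussian_iexp: "integrable lborel (\<lambda>x. complex_of_real (exp (- x\<^sup>2 / 2)) * iexp (x * u))"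
    and integral_gaussian_iexp: "(LBINT x. complex_of_real (exp (- x\<^sup>2 / 2)) * iexp (x * u))
      = sqrt (2 * pi) * exp (- u\<^sup>2 / 2)"
proof -
  have *: "complex_of_real (exp (- x\<^sup>2 / 2)) * iexp (x * u)
    = sqrt (2 * pi) * (std_normal_density x *\<^sub>R iexp (u * x))" for x
    by (simp add: std_normal_density_def scaleR_conv_of_real mult.commute)
  have "integrable lborel (\<lambda>x::real. sqrt (2 * pi) * std_normal_density x)" by simp
  then have "integrable lborel (\<lambda>x::real. exp (- x\<^sup>2 / 2))" by (simp add: std_normal_density_def)
  then show "integrable lborel (\<lambda>x. complex_of_real (exp (- x\<^sup>2 / 2)) * iexp (x * u))"
    by (rule Bochner_Integration.integrable_bound) (simp_all add: norm_mult)
  have "char std_normal_distribution u = (LBINT x. std_normal_density x *\<^sub>R iexp (u * x))"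
    unfolding char_def by (subst integral_density) auto
  then show "(LBINT x. complex_of_real (exp (- x\<^sup>2 / 2)) * iexp (x * u)) = sqrt (2 * pi) * exp (- u\<^sup>2 / 2)"
    unfolding * integral_mult_right_zero by (simp add: char_std_normal_distribution)
qed

lemma gauss_prod: "(\<Prod>b\<in>Basis. exp (- (x \<bullet> b)\<^sup>2 / 2)) = exp (- (x \<bullet> x) / 2)"
  for x :: "'a::euclidean_space"
  by (subst (2) euclidean_inner)
    (simp add: exp_sum[symmetric] power2_eq_square sum_negf sum_divide_distrib)

lemma Re_complex_of_real_mult: "Re (complex_of_real a * b) = a * Re b"
  by simp

lemma Re_iexp: "Re (iexp x) = cos x"
  by (simp add: Re_exp)

text \<open>The exponential of \<open>x \<bullet> u\<close> factors over the coordinates just as the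
  Gaussian does, so the one-dimensional formula, which is the characteristic function of the normal
  law, is multiplied up; the cosine is the real part.\<close>

lemma
  fixes u :: "'a::euclidean_space"
  shows integrable_exp_norm_sq: "integrable lborel (\<lambda>x::'a. exp (- (x \<bullet> x) / 2))"
    and integral_gaussian_cos:
      "(LBINT x. exp (- (x \<bullet> x) / 2) * cos (x \<bullet> u)) = sqrt (2 * pi) ^ DIM('a) * exp (- (u \<bullet> u) / 2)"
proof -
  let ?f = "\<lambda>u x. complex_of_real (exp (- x\<^sup>2 / 2)) * iexp (x * u)"
  have eq: "(\<Prod>b\<in>Basis. ?f (u \<bullet> b) (x \<bullet> b)) = complex_of_real (exp (- (x \<bullet> x) / 2)) * iexp (x \<bullet> u)" for x u :: 'a
  proof -
    have "(\<Prod>b\<in>Basis. ?f (u \<bullet> b) (x \<bullet> b))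
        = complex_of_real (\<Prod>b\<in>Basis. exp (- (x \<bullet> b)\<^sup>2 / 2)) * (\<Prod>b\<in>Basis. iexp ((x \<bullet> b) * (u \<bullet> b)))"
      by (simp add: prod.distrib)
    also have "(\<Prod>b\<in>Basis. iexp ((x \<bullet> b) * (u \<bullet> b))) = iexp (x \<bullet> u)"
      by (subst (3) euclidean_inner) (simp add: exp_sum sum_distrib_left)
    also have "(\<Prod>b\<in>Basis. exp (- (x \<bullet> b)\<^sup>2 / 2)) = exp (- (x \<bullet> x) / 2)"
      by (rule gauss_prod)
    finally show ?thesis .
  qed
  have int: "integrable lborel (\<lambda>x. complex_of_real (exp (- (x \<bullet> x) / 2)) * iexp (x \<bullet> u))" for u :: 'a
    using integrable_lborel_prod[of "\<lambda>b. ?f (u \<bullet> b)", OF integrable_gaussian_iexp] unfolding eq .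
  show "integrable lborel (\<lambda>x::'a. exp (- (x \<bullet> x) / 2))"
    using integrable_Re[OF int[of 0]] by simp
  have "(LBINT x. exp (- (x \<bullet> x) / 2) * cos (x \<bullet> u))
    = (LBINT x. Re (complex_of_real (exp (- (x \<bullet> x) / 2)) * iexp (x \<bullet> u)))"
    unfolding Re_complex_of_real_mult Re_iexp ..
  also have "\<dots> = Re (LBINT x. complex_of_real (exp (- (x \<bullet> x) / 2)) * iexp (x \<bullet> u))"
    using int by (rule integral_Re)
  also have "(LBINT x. complex_of_real (exp (- (x \<bullet> x) / 2)) * iexp (x \<bullet> u))
    = (\<Prod>b\<in>Basis. complex_of_real (sqrt (2 * pi) * exp (- (u \<bullet> b)\<^sup>2 / 2)))"
    using integral_lborel_prod[of "\<lambda>b. ?f (u \<bullet> b)", OF integrable_gaussian_iexp]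
    unfolding eq integral_gaussian_iexp .
  also have "\<dots> = sqrt (2 * pi) ^ DIM('a) * exp (- (u \<bullet> u) / 2)"
    by (simp only: of_real_prod[symmetric] prod.distrib gauss_prod) simp
  finally show "(LBINT x. exp (- (x \<bullet> x) / 2) * cos (x \<bullet> u)) = sqrt (2 * pi) ^ DIM('a) * exp (- (u \<bullet> u) / 2)"
    by simp
qed


text \<open>Stated for two arbitrary factors because it is later applied with a product space as the
  second one, for a triple integral over a frequency and two points.\<close>

lemma (in pair_sigma_finite) integrable_product_mult:
  fixes f :: "'a \<Rightarrow> real" and g :: "'b \<Rightarrow> real"
  assumes f: "integrable M1 f" and g: "integrable M2 g"
  shows "integrable (M1 \<Otimes>\<^sub>M M2) (\<lambda>(x, y). f x * g y)"
proof (rule Fubini_integrable)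
  have [measurable]: "f \<in> borel_measurable M1" "g \<in> borel_measurable M2" using f g by auto
  show "(\<lambda>(x, y). f x * g y) \<in> borel_measurable (M1 \<Otimes>\<^sub>M M2)" by measurable
  have "integrable M1 (\<lambda>x. \<bar>f x\<bar> * (\<integral>y. \<bar>g y\<bar> \<partial>M2))"
    using f by simp
  then show "integrable M1 (\<lambda>x. \<integral>y. norm (case (x, y) of (x, y) \<Rightarrow> f x * g y) \<partial>M2)"
    by (simp add: abs_mult)
  show "AE x in M1. integrable M2 (\<lambda>y. case (x, y) of (x, y) \<Rightarrow> f x * g y)"
    using g by simp
qed

section \<open>Continuity of translations in the mean\<close>

text \<open>Shifts run along a sequence, as dominated convergence is a statement about sequences; in
  the application \<open>v n\<close> is \<open>u / (n + 1)\<close>.\<close>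

definition L1_translation_continuous :: "(nat \<Rightarrow> 'a) \<Rightarrow> ('a::euclidean_space \<Rightarrow> real) \<Rightarrow> bool" where
  "L1_translation_continuous v f \<longleftrightarrow> (\<lambda>n. LBINT x. \<bar>f (x + v n) - f x\<bar>) \<longlonglongrightarrow> 0"

text \<open>Translations preserve the \<open>L1\<close> norm, so the property survives
  \<open>L1\<close> limits: the distance to the approximant counts twice, the translation error of
  the approximant once.\<close>

lemma L1_translation_continuous_approx:
  fixes f :: "'a::euclidean_space \<Rightarrow> real"
  assumes f: "integrable lborel f"
    and approx: "\<And>e. e > 0 \<Longrightarrow> \<exists>g. integrable lborel g \<and> L1_translation_continuous v g \<and> (LBINT x. \<bar>f x - g x\<bar>) < e"
  shows "L1_translation_continuous v f"
  unfolding L1_translation_continuous_def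
proof (rule LIMSEQ_I)
  fix e :: real assume "e > 0"
  then obtain g where g: "integrable lborel g" "L1_translation_continuous v g" "(LBINT x. \<bar>f x - g x\<bar>) < e / 4"
    using approx[of "e/4"] by auto
  then obtain N where N: "\<And>n. n \<ge> N \<Longrightarrow> (LBINT x. \<bar>g (x + v n) - g x\<bar>) < e / 4"
    using \<open>e > 0\<close> order_tendstoD(2)[OF g(2)[unfolded L1_translation_continuous_def], of "e / 4"]
    by (auto simp: eventually_sequentially)
  have "norm ((LBINT x. \<bar>f (x + v n) - f x\<bar>) - 0) < e" if "n \<ge> N" for n
  proof -
    note [simp] = lborel_integrable_translate[OF f] lborel_integrable_translate[OF g(1)] f g(1)
    have d: "integrable lborel (\<lambda>x. \<bar>f x - g x\<bar>)" by simp
    have "(LBINT x. \<bar>f (x + v n) - f x\<bar>)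
        \<le> (LBINT x. \<bar>f (x + v n) - g (x + v n)\<bar> + \<bar>g (x + v n) - g x\<bar> + \<bar>f x - g x\<bar>)"
      by (rule integral_mono) auto
    also have "\<dots> = (LBINT x. \<bar>f (x + v n) - g (x + v n)\<bar>) + (LBINT x. \<bar>g (x + v n) - g x\<bar>)
      + (LBINT x. \<bar>f x - g x\<bar>)"
      by simp
    also have "(LBINT x. \<bar>f (x + v n) - g (x + v n)\<bar>) = (LBINT x. \<bar>f x - g x\<bar>)"
      using borel_measurable_integrable[OF d] by (intro lborel_integral_translate[of "\<lambda>x. \<bar>f x - g x\<bar>"]) simp
    finally have "(LBINT x. \<bar>f (x + v n) - f x\<bar>) < e"
      using N[OF that] g(3) \<open>e > 0\<close> by linarith
    moreover have "(LBINT x. \<bar>f (x + v n) - f x\<bar>) \<ge> 0" by (intro integral_nonneg_AE) auto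
    ultimately show ?thesis by simp
  qed
  then show "\<exists>N. \<forall>n\<ge>N. norm ((LBINT x. \<bar>f (x + v n) - f x\<bar>) - 0) < e" by blast
qed

text \<open>For open \<open>U\<close> the part of \<open>U\<close> that is missed by its translates tends to zero by dominated
  convergence, and the part gained has the same measure because translations preserve volume.\<close>

lemma L1_translation_continuous_indicator_open:
  fixes U :: "'a::euclidean_space set"
  assumes U: "open U" "emeasure lborel U < \<infinity>" and v: "v \<longlonglongrightarrow> 0"
  shows "L1_translation_continuous v (indicator U)"
proof -
  let ?i = "indicator U :: 'a \<Rightarrow> real"
  have [measurable]: "U \<in> sets borel" using U by simp
  have i: "integrable lborel ?i" using U by simp
  note [simp] = i lborel_integrable_translate[OF i]
  have "(\<lambda>n. LBINT x. max 0 (?i x - ?i (x + v n))) \<longlonglongrightarrow> (\<integral>x. 0 \<partial>(lborel :: 'a measure))"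
  proof (rule integral_dominated_convergence[where w = ?i])
    show "AE x in lborel. (\<lambda>n. max 0 (?i x - ?i (x + v n))) \<longlonglongrightarrow> 0"
    proof (intro AE_I2 tendsto_eventually)
      fix x :: 'a
      show "\<forall>\<^sub>F n in sequentially. max 0 (?i x - ?i (x + v n)) = 0"
      proof (cases "x \<in> U")
        case True
        have "(\<lambda>n. x + v n) \<longlonglongrightarrow> x + 0" by (intro tendsto_intros v)
        then have "\<forall>\<^sub>F n in sequentially. x + v n \<in> U"
          using topological_tendstoD[OF _ U(1), of _ x] True by simp
        then show ?thesis by eventually_elim (simp add: True)
      qed (simp add: indicator_def)
    qed
  qed (auto simp: indicator_def)
  moreover have "(LBINT x. \<bar>?i (x + v n) - ?i x\<bar>) = 2 * (LBINT x. max 0 (?i x - ?i (x + v n)))" for n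
  proof -
    have "(LBINT x. \<bar>?i (x + v n) - ?i x\<bar>) = (LBINT x. 2 * max 0 (?i x - ?i (x + v n)) + (?i (x + v n) - ?i x))"
      by (intro Bochner_Integration.integral_cong) (auto simp: max_def)
    also have "\<dots> = (LBINT x. 2 * max 0 (?i x - ?i (x + v n))) + ((LBINT x. ?i (x + v n)) - (LBINT x. ?i x))"
      by (subst Bochner_Integration.integral_add) (auto intro!: integrable_max Bochner_Integration.integral_diff simp del: integral_indicator)
    also have "(LBINT x. ?i (x + v n)) = (LBINT x. ?i x)"
      by (rule lborel_integral_translate) simp
    finally show ?thesis by simp
  qed
  ultimately show ?thesis
    using tendsto_mult_right_zero[of _ sequentially 2] unfolding L1_translation_continuous_def by simp
qed

text \<open>Induction over the integrable functions: indicators of Borel sets are reached from open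
  sets by outer regularity, simple functions by additivity and the rest by \<open>L1\<close>
  limits.\<close>

lemma integrable_imp_L1_translation_continuous:
  fixes f :: "'a::euclidean_space \<Rightarrow> real"
  assumes f: "integrable lborel f" and v: "v \<longlonglongrightarrow> 0"
  shows "L1_translation_continuous v f"
  using f
proof (induction rule: integrable_induct)
  case (base A c)
  have [measurable]: "A \<in> sets borel" using base by simp
  have fin: "emeasure lborel A < \<infinity>" using base by simp
  have iA: "integrable lborel (\<lambda>x. indicator A x *\<^sub>R c)" using base by simp
  show ?case
  proof (rule L1_translation_continuous_approx[OF iA])
    fix e :: real assume e: "e > 0"
    \<comment> \<open>The \<open>+ 1\<close> covers the case \<open>c = 0\<close>.\<close>
    define e' where "e' = e / (\<bar>c\<bar> + 1)"
    have e': "e' > 0" using e by (simp add: e'_def)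
    obtain U where U: "open U" "A \<subseteq> U" "emeasure lborel (U - A) < e'"
      using outer_regular_lborel[of A e'] e' by auto
    have [measurable]: "U \<in> sets borel" using U by simp
    have "emeasure lborel U = emeasure lborel A + emeasure lborel (U - A)"
      using U by (subst plus_emeasure) (auto simp: Un_absorb1)
    also have "\<dots> < \<infinity>" using fin U(3) by (auto simp: ennreal_add_less_top order_less_trans)
    finally have U_fin: "emeasure lborel U < \<infinity>" .
    have iU: "integrable lborel (\<lambda>x. c * indicator U x)" using U_fin by simp
    have "L1_translation_continuous v (\<lambda>x. c * indicator U x)"
      using tendsto_mult_right_zero[OF L1_translation_continuous_indicator_open[OF U(1) U_fin v, unfolded L1_translation_continuous_def], of "\<bar>c\<bar>"]
      by (simp add: L1_translation_continuous_def abs_mult flip: right_diff_distrib)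
    moreover have "(LBINT x. \<bar>indicator A x *\<^sub>R c - c * indicator U x\<bar>) < e"
    proof -
      have "(LBINT x. \<bar>indicator A x *\<^sub>R c - c * indicator U x\<bar>) = (LBINT x. \<bar>c\<bar> * indicator (U - A) x)"
        using U(2) by (intro Bochner_Integration.integral_cong) (auto simp: indicator_def)
      also have "\<dots> = \<bar>c\<bar> * measure lborel (U - A)" by simp
      also have "measure lborel (U - A) \<le> e'"
        using U(3) e' by (simp add: measure_def enn2real_leI order_less_imp_le)
      also have "\<bar>c\<bar> * e' < e" using e by (simp add: e'_def field_simps)
      finally show ?thesis by (simp add: mult_left_mono)
    qed
    ultimately show "\<exists>g. integrable lborel g \<and> L1_translation_continuous v g \<and> (LBINT x. \<bar>indicator A x *\<^sub>R c - g x\<bar>) < e"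
      using iU by blast
  qed
next
  case (add f g)
  note [simp] = add(1,2) lborel_integrable_translate[OF add(1)] lborel_integrable_translate[OF add(2)]
  have lim: "(\<lambda>n. (LBINT x. \<bar>f (x + v n) - f x\<bar>) + (LBINT x. \<bar>g (x + v n) - g x\<bar>)) \<longlonglongrightarrow> 0"
    using tendsto_add[OF add(3,4)[unfolded L1_translation_continuous_def]] by simp
  show ?case
  proof -
    have "(LBINT x. \<bar>f (x + v n) + g (x + v n) - (f x + g x)\<bar>)
        \<le> (LBINT x. \<bar>f (x + v n) - f x\<bar> + \<bar>g (x + v n) - g x\<bar>)" for n
      by (rule integral_mono) auto
    then have *: "(LBINT x. \<bar>f (x + v n) + g (x + v n) - (f x + g x)\<bar>)
        \<le> (LBINT x. \<bar>f (x + v n) - f x\<bar>) + (LBINT x. \<bar>g (x + v n) - g x\<bar>)" for n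
      by simp
    have "(\<lambda>n. LBINT x. \<bar>f (x + v n) + g (x + v n) - (f x + g x)\<bar>) \<longlonglongrightarrow> 0"
      by (rule tendsto_sandwich[OF _ _ tendsto_const lim])
        (auto intro!: always_eventually * integral_nonneg_AE)
    then show ?thesis unfolding L1_translation_continuous_def .
  qed
next
  case (lim f s)
  show ?case
  proof (rule L1_translation_continuous_approx[OF lim(4)])
    fix e :: real assume e: "e > 0"
    have [measurable]: "f \<in> borel_measurable lborel" "\<And>i. s i \<in> borel_measurable lborel" using lim by auto
    \<comment> \<open>The approximants satisfy \<open>|s i x| <= 2 * |f x|\<close>, hence the
      dominating function \<open>3 * |f x|\<close>.\<close>
    have "(\<lambda>i. LBINT x. \<bar>f x - s i x\<bar>) \<longlonglongrightarrow> (\<integral>x. 0 \<partial>(lborel :: 'a measure))"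
    proof (rule integral_dominated_convergence[where w = "\<lambda>x. 3 * \<bar>f x\<bar>"])
      show "AE x in lborel. (\<lambda>i. \<bar>f x - s i x\<bar>) \<longlonglongrightarrow> 0"
      proof (intro AE_I2)
        fix x :: 'a
        have "(\<lambda>i. \<bar>f x - s i x\<bar>) \<longlonglongrightarrow> \<bar>f x - f x\<bar>"
          using lim(2)[of x] by (intro tendsto_intros) simp
        then show "(\<lambda>i. \<bar>f x - s i x\<bar>) \<longlonglongrightarrow> 0" by simp
      qed
      show "AE x in lborel. norm \<bar>f x - s i x\<bar> \<le> 3 * \<bar>f x\<bar>" for i
        using lim(3)[of _ i] by (intro AE_I2) (smt (verit) real_norm_def space_lborel UNIV_I)
    qed (use lim(4) in auto)
    then obtain i where "(LBINT x. \<bar>f x - s i x\<bar>) < e"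
      using order_tendstoD(2)[of _ 0 sequentially e] e by (auto simp: eventually_sequentially)
    then show "\<exists>g. integrable lborel g \<and> L1_translation_continuous v g \<and> (LBINT x. \<bar>f x - g x\<bar>) < e"
      using lim(1,5) by blast
  qed
qed

section \<open>Plancherel's identity\<close>

text \<open>\<open>cos_transform\<close> is the real part of the unnormalised Fourier transform and
  \<open>sin_transform\<close> is minus its imaginary part. Hence the sum of the products of the
  cosine and of the sine transforms of \<open>f\<close> and \<open>h\<close> is the real part of the
  Hermitian product of their Fourier transforms.\<close>

definition cos_transform :: "('a::euclidean_space \<Rightarrow> real) \<Rightarrow> 'a \<Rightarrow> real" where
  "cos_transform f \<xi> = (LBINT x. f x * cos (\<xi> \<bullet> x))"

definition sin_transform :: "('a::euclidean_space \<Rightarrow> real) \<Rightarrow> 'a \<Rightarrow> real" where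
  "sin_transform f \<xi> = (LBINT x. f x * sin (\<xi> \<bullet> x))"

definition gaussian :: "'a::euclidean_space \<Rightarrow> real" where
  "gaussian x = exp (- (x \<bullet> x) / 2)"

lemma gaussian_measurable [measurable]: "gaussian \<in> borel_measurable borel"
  unfolding gaussian_def by measurable

lemma gaussian_pos: "gaussian x > 0" and gaussian_le_1: "gaussian x \<le> 1"
  by (auto simp: gaussian_def)

lemma abs_gaussian [simp]: "\<bar>gaussian x\<bar> = gaussian x"
  using gaussian_pos[of x] by simp

lemma integrable_gaussian: "integrable lborel (gaussian :: 'a::euclidean_space \<Rightarrow> real)"
  using integrable_exp_norm_sq by (simp add: gaussian_def[abs_def])

lemma integral_gaussian: "(LBINT x. gaussian (x::'a::euclidean_space)) = sqrt (2 * pi) ^ DIM('a)"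
  using integral_gaussian_cos[of "0::'a"] by (simp add: gaussian_def)

lemma cos_transform_measurable [measurable (raw)]:
  assumes [measurable]: "f \<in> borel_measurable borel"
  shows "cos_transform f \<in> borel_measurable borel"
  unfolding cos_transform_def[abs_def] by measurable

lemma sin_transform_measurable [measurable (raw)]:
  assumes [measurable]: "f \<in> borel_measurable borel"
  shows "sin_transform f \<in> borel_measurable borel"
  unfolding sin_transform_def[abs_def] by measurable

lemma integrable_mult_bounded:
  fixes f g :: "'a \<Rightarrow> real"
  assumes "integrable M f" "g \<in> borel_measurable M" "\<And>x. \<bar>g x\<bar> \<le> B"
  shows "integrable M (\<lambda>x. f x * g x)"
proof (rule Bochner_Integration.integrable_bound)
  show "integrable M (\<lambda>x. B * f x)" using assms(1) by simp
  have "B \<ge> 0" using assms(3)[of undefined] by linarith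
  then show "AE x in M. norm (f x * g x) \<le> norm (B * f x)"
    using assms(3) by (intro AE_I2) (simp add: abs_mult mult.commute[of B] mult_left_mono)
qed (use assms in auto)

lemma abs_integral_mult_bounded_le:
  fixes f g :: "'a \<Rightarrow> real"
  assumes "integrable M f" "g \<in> borel_measurable M" "\<And>x. \<bar>g x\<bar> \<le> B"
  shows "\<bar>\<integral>x. f x * g x \<partial>M\<bar> \<le> B * (\<integral>x. \<bar>f x\<bar> \<partial>M)"
proof -
  have i: "integrable M (\<lambda>x. f x * g x)" by (rule integrable_mult_bounded[OF assms])
  have "norm (\<integral>x. f x * g x \<partial>M) \<le> (\<integral>x. norm (f x * g x) \<partial>M)"
    by (rule integral_norm_bound)
  also have "\<dots> \<le> (\<integral>x. B * \<bar>f x\<bar> \<partial>M)"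
    using assms(1,3) integrable_norm[OF i]
    by (intro integral_mono) (auto simp: abs_mult mult.commute[of B] intro!: mult_left_mono)
  finally show ?thesis by simp
qed

lemma integrable_gaussian_scaled:
  assumes s: "s > 0"
  shows "integrable lborel (\<lambda>\<xi>::'a::euclidean_space. gaussian (s *\<^sub>R \<xi>))"
proof -
  have "integrable (density (distr lborel borel (\<lambda>x::'a. 0
    + s *\<^sub>R x)) (\<lambda>_. ennreal (\<bar>s\<bar> ^ DIM('a)))) (gaussian :: 'a \<Rightarrow> real)"
    using s integrable_gaussian lborel_affine[of s "0::'a"] by (simp add: ennreal_power)
  then have "integrable (distr lborel borel (\<lambda>x::'a. 0 + s *\<^sub>R x)) (\<lambda>x::'a. \<bar>s\<bar> ^ DIM('a) *\<^sub>R gaussian x)"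
    by (subst (asm) integrable_density) auto
  then show ?thesis
    using s by (subst (asm) integrable_distr_eq) auto
qed

lemma gaussian_scaled_tendsto: "(\<lambda>n. gaussian (inverse (real (Suc n)) *\<^sub>R \<xi>)) \<longlonglongrightarrow> 1"
proof -
  have "(\<lambda>n. gaussian (inverse (real (Suc n)) *\<^sub>R \<xi>)) \<longlonglongrightarrow> exp (- ((0 *\<^sub>R \<xi>) \<bullet> (0 *\<^sub>R \<xi>)) / 2)"
    unfolding gaussian_def by (intro tendsto_intros LIMSEQ_inverse_real_of_nat) auto
  then show ?thesis by simp
qed

lemma integral_gaussian_scaled_cos:
  fixes v :: "'a::euclidean_space"
  assumes s: "s > 0"
  shows "(LBINT \<xi>. gaussian (s *\<^sub>R \<xi>) * cos (\<xi> \<bullet> v))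
    = sqrt (2 * pi) ^ DIM('a) / s ^ DIM('a) * gaussian ((1 / s) *\<^sub>R v)"
proof -
  have "sqrt (2 * pi) ^ DIM('a) * gaussian ((1 / s) *\<^sub>R v) = (LBINT x. gaussian x * cos (x \<bullet> ((1 / s) *\<^sub>R v)))"
    using integral_gaussian_cos[of "(1/s) *\<^sub>R v"] by (simp add: gaussian_def)
  also have "\<dots> = s ^ DIM('a) * (LBINT \<xi>. gaussian (s *\<^sub>R \<xi>) * cos (\<xi> \<bullet> v))"
    using s by (subst lborel_integral_affine[of _ s 0]) auto
  finally show ?thesis using s by (simp add: field_simps)
qed

lemma
  fixes f :: "'a::euclidean_space \<Rightarrow> real" and g :: "'b::euclidean_space \<Rightarrow> real"
  assumes f: "integrable lborel f" and g: "integrable lborel g"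
  shows integral_product_mult: "(\<integral>p. f (fst p) * g (snd p) \<partial>(lborel \<Otimes>\<^sub>M lborel)) = (LBINT x. f x) * (LBINT x. g x)"
    and integrable_product_mult: "integrable (lborel \<Otimes>\<^sub>M lborel) (\<lambda>p. f (fst p) * g (snd p))"
proof -
  show i: "integrable (lborel \<Otimes>\<^sub>M lborel) (\<lambda>p. f (fst p) * g (snd p))"
    using lborel_pair.integrable_product_mult[OF f g] by (simp add: case_prod_unfold)
  show "(\<integral>p. f (fst p) * g (snd p) \<partial>(lborel \<Otimes>\<^sub>M lborel)) = (LBINT x. f x) * (LBINT x. g x)"
    using lborel_pair.integral_fst'[OF i] by simp
qed

text \<open>The Gaussian makes the integral over \<open>\<xi>\<close> and two points absolutely
  convergent, so \<open>\<xi>\<close> can be integrated first. This leaves a Gaussian kernel of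
  width \<open>s\<close> in the difference of the points, and the substitution
  \<open>y = x + s u\<close> turns it into an average of translates of \<open>h\<close>.\<close>

lemma smoothed_plancherel:
  fixes f h :: "'a::euclidean_space \<Rightarrow> real"
  assumes f: "integrable lborel f" and h: "integrable lborel h" "\<And>x. \<bar>h x\<bar> \<le> B" and s: "s > 0"
  shows "(LBINT \<xi>. gaussian (s *\<^sub>R \<xi>) * (cos_transform f \<xi> * cos_transform h \<xi>
    + sin_transform f \<xi> * sin_transform h \<xi>))
    = sqrt (2 * pi) ^ DIM('a) * (LBINT u. gaussian u * (LBINT x. f x * h (x + s *\<^sub>R u)))"
proof -
  let ?K = "sqrt (2 * pi) ^ DIM('a)"
  let ?P = "lborel \<Otimes>\<^sub>M lborel :: ('a \<times> 'a) measure"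
  interpret P: pair_sigma_finite "lborel :: 'a measure" ?P
    by (simp add: lborel_prod pair_sigma_finite_def lborel.sigma_finite_measure_axioms)
  have [measurable]: "f \<in> borel_measurable borel" "h \<in> borel_measurable borel" using f h by auto
  have ic: "integrable lborel (\<lambda>x. f x * cos (\<xi> \<bullet> x))" "integrable lborel (\<lambda>x. f x * sin (\<xi> \<bullet> x))"
     "integrable lborel (\<lambda>x. h x * cos (\<xi> \<bullet> x))" "integrable lborel (\<lambda>x. h x * sin (\<xi> \<bullet> x))" for \<xi>
    by (auto intro!: integrable_mult_bounded[where B=1] f h)
  have prod: "cos_transform f \<xi> * cos_transform h \<xi> + sin_transform f \<xi> * sin_transform h \<xi>
      = (\<integral>p. f (fst p) * h (snd p) * cos (\<xi> \<bullet> (fst p - snd p)) \<partial>?P)" for \<xi>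
  proof -
    have "cos_transform f \<xi> * cos_transform h \<xi> + sin_transform f \<xi> * sin_transform h \<xi>
      = (\<integral>p. (f (fst p) * cos (\<xi> \<bullet> fst p)) * (h (snd p) * cos (\<xi> \<bullet> snd p))
           + (f (fst p) * sin (\<xi> \<bullet> fst p)) * (h (snd p) * sin (\<xi> \<bullet> snd p)) \<partial>?P)"
      unfolding cos_transform_def sin_transform_def
      using integrable_product_mult[OF ic(1)[of \<xi>] ic(3)[of \<xi>]] integrable_product_mult[OF ic(2)[of \<xi>] ic(4)[of \<xi>]]
      by (simp add: integral_product_mult[OF ic(1)[of \<xi>] ic(3)[of \<xi>], symmetric]
           integral_product_mult[OF ic(2)[of \<xi>] ic(4)[of \<xi>], symmetric])
    also have "\<dots> = (\<integral>p. f (fst p) * h (snd p) * cos (\<xi> \<bullet> (fst p - snd p)) \<partial>?P)"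
      by (intro Bochner_Integration.integral_cong) (simp_all add: inner_diff_right cos_diff algebra_simps)
    finally show ?thesis .
  qed
  note ig = integrable_gaussian_scaled[OF s]
  have int1: "integrable (lborel \<Otimes>\<^sub>M ?P) (\<lambda>(\<xi>, p). gaussian (s *\<^sub>R \<xi>) * (f (fst p) * h (snd p)) * cos (\<xi> \<bullet> (fst p - snd p)))"
    using integrable_mult_bounded[OF P.integrable_product_mult[OF ig integrable_product_mult[OF f h(1)]],
       of "\<lambda>(\<xi>, p). cos (\<xi> \<bullet> (fst p - snd p))" 1]
    by (simp add: case_prod_unfold)
  have int2: "integrable ?P (\<lambda>(x, u). f x * gaussian u * h (x + s *\<^sub>R u))"
    using integrable_mult_bounded[OF integrable_product_mult[OF f integrable_gaussian],
       of "\<lambda>(x, u). h (x + s *\<^sub>R u)" B] h(2)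
    by (simp add: case_prod_unfold)
  have "(LBINT \<xi>. gaussian (s *\<^sub>R \<xi>) * (cos_transform f \<xi> * cos_transform h \<xi>
    + sin_transform f \<xi> * sin_transform h \<xi>))
      = (LBINT \<xi>. (\<integral>p. gaussian (s *\<^sub>R \<xi>) * (f (fst p) * h (snd p)) * cos (\<xi> \<bullet> (fst p - snd p)) \<partial>?P))"
    by (simp add: prod mult.assoc)
  also have "\<dots> = (\<integral>p. (LBINT \<xi>. gaussian (s *\<^sub>R \<xi>) * (f (fst p) * h (snd p)) * cos (\<xi> \<bullet> (fst p - snd p))) \<partial>?P)"
    using P.Fubini_integral[of "\<lambda>\<xi> p. gaussian (s *\<^sub>R \<xi>) * (f (fst p) * h (snd p)) * cos (\<xi> \<bullet> (fst p - snd p))"] int1 by simp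
  also have "\<dots> = (\<integral>p. (f (fst p) * h (snd p)) * (LBINT \<xi>. gaussian (s *\<^sub>R \<xi>) * cos (\<xi> \<bullet> (fst p - snd p))) \<partial>?P)"
    by (subst integral_mult_right_zero[symmetric]) (simp add: mult_ac)
  also have "\<dots>
    = (\<integral>p. ?K * (f (fst p) * h (snd p) * (1 / s ^ DIM('a) * gaussian ((1 / s) *\<^sub>R (fst p - snd p)))) \<partial>?P)"
    using s by (simp add: integral_gaussian_scaled_cos mult_ac)
  also have "\<dots> = ?K * (\<integral>p. f (fst p) * h (snd p) * (1 / s ^ DIM('a) * gaussian ((1 / s) *\<^sub>R (fst p - snd p))) \<partial>?P)"
    by simp
  also have "(\<integral>p. f (fst p) * h (snd p) * (1 / s ^ DIM('a) * gaussian ((1 / s) *\<^sub>R (fst p - snd p))) \<partial>?P)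
      = (LBINT x. (LBINT y. f x * h y * (1 / s ^ DIM('a) * gaussian ((1 / s) *\<^sub>R (x - y)))))"
  proof -
    have "integrable ?P (\<lambda>p. f (fst p) * h (snd p) * (1 / s ^ DIM('a) * gaussian ((1 / s) *\<^sub>R (fst p - snd p))))"
      using s gaussian_le_1
      by (intro integrable_mult_bounded[OF integrable_product_mult[OF f h(1)], where B = "1 / s ^ DIM('a)"])
        (auto intro!: divide_right_mono)
    from lborel_pair.integral_fst'[OF this, symmetric] show ?thesis by simp
  qed
  also have "\<dots> = (LBINT x. (LBINT u. f x * gaussian u * h (x + s *\<^sub>R u)))"
  proof (rule Bochner_Integration.integral_cong[OF refl])
    fix x
    have "(LBINT y. f x * h y * (1 / s ^ DIM('a) * gaussian ((1 / s) *\<^sub>R (x - y))))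
        = s ^ DIM('a) * (LBINT u. f x * h (x + s *\<^sub>R u) * (1 / s ^ DIM('a) * gaussian ((1 / s) *\<^sub>R (x - (x
          + s *\<^sub>R u)))))"
      using s by (subst lborel_integral_affine[of _ s x]) auto
    also have "\<dots> = (LBINT u. f x * gaussian u * h (x + s *\<^sub>R u))"
      using s by (subst integral_mult_right_zero[symmetric]) (simp add: gaussian_def mult_ac)
    finally show "(LBINT y. f x * h y * (1 / s ^ DIM('a) * gaussian ((1 / s) *\<^sub>R (x - y))))
      = (LBINT u. f x * gaussian u * h (x + s *\<^sub>R u))" .
  qed
  also have "\<dots> = (LBINT u. (LBINT x. f x * gaussian u * h (x + s *\<^sub>R u)))"
    using lborel_pair.Fubini_integral[OF int2] by simp
  also have "\<dots> = (LBINT u. gaussian u * (LBINT x. f x * h (x + s *\<^sub>R u)))"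
    by (subst integral_mult_right_zero[symmetric]) (simp add: mult_ac)
  finally show ?thesis .
qed

text \<open>As the width shrinks, continuity of translations in the mean turns the correlation of
  \<open>f\<close> and \<open>h\<close> into the integral of \<open>f x * h x\<close>; there the
  bound on \<open>f\<close> enters, while the bound on \<open>h\<close> gives the majorant in
  \<open>u\<close>. Of the two factors \<open>sqrt (2 * pi) ^ DIM('a)\<close>, one comes from the
  smoothed identity and one from the mass of the Gaussian.\<close>

lemma smoothed_plancherel_limit:
  fixes f h :: "'a::euclidean_space \<Rightarrow> real"
  assumes f: "integrable lborel f" "\<And>x. \<bar>f x\<bar> \<le> A" and h: "integrable lborel h" "\<And>x. \<bar>h x\<bar> \<le> B"
  shows "(\<lambda>n. LBINT \<xi>. gaussian (inverse (real (Suc n)) *\<^sub>R \<xi>) * (cos_transform f \<xi> * cos_transform h \<xi>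
    + sin_transform f \<xi> * sin_transform h \<xi>))
    \<longlonglongrightarrow> (2 * pi) ^ DIM('a) * (LBINT x. f x * h x)"
proof -
  let ?K = "sqrt (2 * pi) ^ DIM('a)"
  let ?c = "\<lambda>n u. LBINT x. f x * h (x + inverse (real (Suc n)) *\<^sub>R u)"
  have [measurable]: "f \<in> borel_measurable borel" "h \<in> borel_measurable borel" using f h by auto
  have i: "integrable lborel (\<lambda>x. f x * h (x + v))" for v
    using integrable_mult_bounded[OF f(1), of "\<lambda>x. h (x + v)" B] h by simp
  have c_lim: "(\<lambda>n. ?c n u) \<longlonglongrightarrow> (LBINT x. f x * h x)" for u
  proof -
    let ?v = "\<lambda>n. inverse (real (Suc n)) *\<^sub>R u"
    have "?v \<longlonglongrightarrow> 0 *\<^sub>R u" by (intro tendsto_scaleR LIMSEQ_inverse_real_of_nat tendsto_const)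
    then have "L1_translation_continuous ?v h"
      by (intro integrable_imp_L1_translation_continuous h) simp
    then have lim: "(\<lambda>n. A * (LBINT x. \<bar>h (x + ?v n) - h x\<bar>)) \<longlonglongrightarrow> 0"
      unfolding L1_translation_continuous_def by (rule tendsto_mult_right_zero)
    have "norm (?c n u - (LBINT x. f x * h x)) \<le> A * (LBINT x. \<bar>h (x + ?v n) - h x\<bar>)" for n
    proof -
      have "norm (?c n u - (LBINT x. f x * h x)) = norm (LBINT x. f x * (h (x + ?v n) - h x))"
        using i[of "?v n"] i[of 0] by (simp add: right_diff_distrib)
      also have "\<dots> \<le> (LBINT x. norm (f x * (h (x + ?v n) - h x)))"
        by (rule integral_norm_bound)
      also have "\<dots> \<le> (LBINT x. A * \<bar>h (x + ?v n) - h x\<bar>)"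
      proof (rule integral_mono)
        show "integrable lborel (\<lambda>x. norm (f x * (h (x + ?v n) - h x)))"
          unfolding right_diff_distrib using i[of "?v n"] i[of 0] by simp
        show "integrable lborel (\<lambda>x. A * \<bar>h (x + ?v n) - h x\<bar>)"
          using h(1) lborel_integrable_translate[OF h(1), of "?v n"] by simp
      qed (use f(2) in \<open>simp add: abs_mult mult_right_mono\<close>)
      finally show ?thesis by simp
    qed
    then have "(\<lambda>n. ?c n u - (LBINT x. f x * h x)) \<longlonglongrightarrow> 0"
      by (intro Lim_null_comparison[OF _ lim]) simp
    then show ?thesis by (simp add: LIM_zero_iff)
  qed
  have "(\<lambda>n. LBINT u. gaussian u * ?c n u) \<longlonglongrightarrow> (\<integral>u. gaussian u * (LBINT x. f x * h x) \<partial>(lborel :: 'a measure))"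
  proof (rule integral_dominated_convergence[where w = "\<lambda>u. gaussian u * (B * (LBINT x. \<bar>f x\<bar>))"])
    show "AE u in lborel. norm (gaussian u * ?c n u) \<le> gaussian u * (B * (LBINT x. \<bar>f x\<bar>))" for n
    proof (intro AE_I2)
      fix u
      have "\<bar>?c n u\<bar> \<le> B * (LBINT x. \<bar>f x\<bar>)"
        by (rule abs_integral_mult_bounded_le[OF f(1)]) (use h in auto)
      then show "norm (gaussian u * ?c n u) \<le> gaussian u * (B * (LBINT x. \<bar>f x\<bar>))"
        using gaussian_pos[of u] by (simp add: abs_mult)
    qed
    show "AE u in lborel. (\<lambda>n. gaussian u * ?c n u) \<longlonglongrightarrow> gaussian u * (LBINT x. f x * h x)"
      by (intro AE_I2 tendsto_intros c_lim)
  qed (use integrable_gaussian in auto)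
  then have "(\<lambda>n. ?K * (LBINT u. gaussian u * ?c n u)) \<longlonglongrightarrow> ?K * (?K * (LBINT x. f x * h x))"
    by (intro tendsto_mult_left) (simp add: integral_gaussian)
  moreover have "?K * ?K = (2 * pi) ^ DIM('a)"
    unfolding power_mult_distrib[symmetric] by simp
  moreover have "(LBINT \<xi>. gaussian (inverse (real (Suc n)) *\<^sub>R \<xi>) * (cos_transform f \<xi> * cos_transform h \<xi>
    + sin_transform f \<xi> * sin_transform h \<xi>))
      = ?K * (LBINT u. gaussian u * ?c n u)" for n
    by (rule smoothed_plancherel[OF f(1) h]) simp
  ultimately show ?thesis
    by (simp only: mult.assoc[symmetric])
qed

text \<open>The Gaussian factors increase to 1 with \<open>n\<close>, and the smoothed integrals
  converge by \<open>smoothed_plancherel_limit\<close> with \<open>h = f\<close>; monotone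
  convergence then gives integrability of the limit.\<close>

lemma integrable_transform_sq:
  fixes f :: "'a::euclidean_space \<Rightarrow> real"
  assumes f: "integrable lborel f" "\<And>x. \<bar>f x\<bar> \<le> A"
  shows "integrable lborel (\<lambda>\<xi>. (cos_transform f \<xi>)\<^sup>2 + (sin_transform f \<xi>)\<^sup>2)"
proof -
  let ?F = "\<lambda>\<xi>. (cos_transform f \<xi>)\<^sup>2 + (sin_transform f \<xi>)\<^sup>2"
  let ?s = "\<lambda>n. inverse (real (Suc n))"
  have [measurable]: "f \<in> borel_measurable borel" using f by auto
  have bdd: "\<bar>?F \<xi>\<bar> \<le> 2 * (LBINT x. \<bar>f x\<bar>)\<^sup>2" for \<xi>
  proof -
    have "\<bar>LBINT x. f x * c x\<bar> \<le> (LBINT x. \<bar>f x\<bar>)"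
      if "c \<in> borel_measurable borel" "\<And>x. \<bar>c x\<bar> \<le> 1" for c :: "'a \<Rightarrow> real"
      using abs_integral_mult_bounded_le[OF f(1), of c 1] that by simp
    from this[of "\<lambda>x. cos (\<xi> \<bullet> x)"] this[of "\<lambda>x. sin (\<xi> \<bullet> x)"]
    have "(cos_transform f \<xi>)\<^sup>2 \<le> (LBINT x. \<bar>f x\<bar>)\<^sup>2" "(sin_transform f \<xi>)\<^sup>2 \<le> (LBINT x. \<bar>f x\<bar>)\<^sup>2"
      by (simp_all add: cos_transform_def sin_transform_def power2_le_iff_abs_le)
    then show ?thesis by simp
  qed
  show ?thesis
  proof (rule integrable_monotone_convergence[where f = "\<lambda>n \<xi>. gaussian (?s n *\<^sub>R \<xi>) * ?F \<xi>"])
    show "integrable lborel (\<lambda>\<xi>. gaussian (?s n *\<^sub>R \<xi>) * ?F \<xi>)" for n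
      by (rule integrable_mult_bounded[OF integrable_gaussian_scaled _ bdd]) auto
    show "AE \<xi> in lborel. mono (\<lambda>n. gaussian (?s n *\<^sub>R \<xi>) * ?F \<xi>)"
    proof (intro AE_I2 monoI mult_right_mono)
      fix \<xi> :: 'a and m n :: nat assume "m \<le> n"
      then have "?s n \<le> ?s m" by (intro le_imp_inverse_le) auto
      then have "(?s n)\<^sup>2 \<le> (?s m)\<^sup>2" by (intro power_mono) auto
      then have "(?s n)\<^sup>2 * (\<xi> \<bullet> \<xi>) \<le> (?s m)\<^sup>2 * (\<xi> \<bullet> \<xi>)" by (intro mult_right_mono) auto
      then show "gaussian (?s m *\<^sub>R \<xi>) \<le> gaussian (?s n *\<^sub>R \<xi>)"
        by (simp add: gaussian_def power2_eq_square mult.assoc)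
    qed simp
    show "AE \<xi> in lborel. (\<lambda>n. gaussian (?s n *\<^sub>R \<xi>) * ?F \<xi>) \<longlonglongrightarrow> ?F \<xi>"
      using tendsto_mult_right[OF gaussian_scaled_tendsto] by (intro AE_I2) fastforce
    show "(\<lambda>n. LBINT \<xi>. gaussian (?s n *\<^sub>R \<xi>) * ?F \<xi>) \<longlonglongrightarrow> (2 * pi) ^ DIM('a) * (LBINT x. f x * f x)"
      using smoothed_plancherel_limit[OF f f] by (simp add: power2_eq_square)
  qed auto
qed

text \<open>Once the squares are integrable, their sum dominates the mixed product, and the Gaussian
  factor can be removed by dominated convergence.\<close>

lemma
  fixes f h :: "'a::euclidean_space \<Rightarrow> real"
  assumes f: "integrable lborel f" "\<And>x. \<bar>f x\<bar> \<le> A" and h: "integrable lborel h" "\<And>x. \<bar>h x\<bar> \<le> B"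
  shows integrable_plancherel:
      "integrable lborel (\<lambda>\<xi>. cos_transform f \<xi> * cos_transform h \<xi> + sin_transform f \<xi> * sin_transform h \<xi>)"
    and plancherel:
      "(LBINT \<xi>. cos_transform f \<xi> * cos_transform h \<xi> + sin_transform f \<xi> * sin_transform h \<xi>)
        = (2 * pi) ^ DIM('a) * (LBINT x. f x * h x)"
proof -
  let ?F = "\<lambda>\<xi>. cos_transform f \<xi> * cos_transform h \<xi> + sin_transform f \<xi> * sin_transform h \<xi>"
  let ?w = "\<lambda>\<xi>. ((cos_transform f \<xi>)\<^sup>2 + (sin_transform f \<xi>)\<^sup>2) + ((cos_transform h \<xi>)\<^sup>2 + (sin_transform h \<xi>)\<^sup>2)"
  let ?s = "\<lambda>n. inverse (real (Suc n))"
  have [measurable]: "f \<in> borel_measurable borel" "h \<in> borel_measurable borel" using f h by auto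
  have w: "integrable lborel ?w" using f h by (intro Bochner_Integration.integrable_add integrable_transform_sq)
  have le: "\<bar>?F \<xi>\<bar> \<le> ?w \<xi>" for \<xi>
  proof -
    have *: "\<bar>a * b\<bar> \<le> a\<^sup>2 + b\<^sup>2" for a b :: real
    proof -
      have "2 * (\<bar>a\<bar> * \<bar>b\<bar>) \<le> a\<^sup>2 + b\<^sup>2"
        using sum_squares_bound[of "\<bar>a\<bar>" "\<bar>b\<bar>"] by (simp add: mult.assoc)
      moreover have "0 \<le> \<bar>a\<bar> * \<bar>b\<bar>" by simp
      ultimately show ?thesis unfolding abs_mult by linarith
    qed
    show ?thesis using *[of "cos_transform f \<xi>" "cos_transform h \<xi>"] *[of "sin_transform f \<xi>"
      "sin_transform h \<xi>"] by linarith
  qed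
  show "integrable lborel ?F"
    by (rule Bochner_Integration.integrable_bound[OF w]) (auto intro!: AE_I2 order.trans[OF le] simp del: power2_eq_square)
  have "(\<lambda>n. LBINT \<xi>. gaussian (?s n *\<^sub>R \<xi>) * ?F \<xi>) \<longlonglongrightarrow> (LBINT \<xi>. ?F \<xi>)"
  proof (rule integral_dominated_convergence[where w = ?w])
    show "AE \<xi> in lborel. (\<lambda>n. gaussian (?s n *\<^sub>R \<xi>) * ?F \<xi>) \<longlonglongrightarrow> ?F \<xi>"
      using tendsto_mult_right[OF gaussian_scaled_tendsto] by (intro AE_I2) fastforce
    show "AE \<xi> in lborel. norm (gaussian (?s n *\<^sub>R \<xi>) * ?F \<xi>) \<le> ?w \<xi>" for n
    proof (intro AE_I2)
      fix \<xi> :: 'a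
      have "norm (gaussian (?s n *\<^sub>R \<xi>) * ?F \<xi>) \<le> 1 * \<bar>?F \<xi>\<bar>"
        unfolding real_norm_def abs_mult using gaussian_pos[of "?s n *\<^sub>R \<xi>"] gaussian_le_1[of "?s n *\<^sub>R \<xi>"]
        by (intro mult_right_mono) auto
      also have "\<dots> \<le> ?w \<xi>" using le by simp
      finally show "norm (gaussian (?s n *\<^sub>R \<xi>) * ?F \<xi>) \<le> ?w \<xi>" .
    qed
  qed (use w in auto)
  then show "(LBINT \<xi>. ?F \<xi>) = (2 * pi) ^ DIM('a) * (LBINT x. f x * h x)"
    using smoothed_plancherel_limit[OF f h] by (rule LIMSEQ_unique)
qed

section \<open>Calculus of smooth functions\<close>

lemma dir_deriv_eq: "(f has_derivative f') (at x) \<Longrightarrow> dir_deriv v f x = f' v"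
  unfolding dir_deriv_def by (metis frechet_derivative_at)

lemma has_derivative_dir_deriv:
  assumes "f differentiable (at x)"
  shows "(f has_derivative (\<lambda>v. \<Sum>i\<in>Basis. (v \<bullet> i) * dir_deriv i f x)) (at x)"
proof -
  let ?f' = "frechet_derivative f (at x)"
  have f': "(f has_derivative ?f') (at x)" using assms by (simp add: frechet_derivative_works)
  then interpret bounded_linear ?f' by (rule has_derivative_bounded_linear)
  have "?f' v = (\<Sum>i\<in>Basis. (v \<bullet> i) * dir_deriv i f x)" for v
  proof -
    have "?f' (\<Sum>i\<in>Basis. (v \<bullet> i) *\<^sub>R i) = (\<Sum>i\<in>Basis. (v \<bullet> i) * dir_deriv i f x)"
      by (simp only: sum scale dir_deriv_def real_scaleR_def)
    then show ?thesis by (simp only: euclidean_representation)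
  qed
  then have "?f' = (\<lambda>v. \<Sum>i\<in>Basis. (v \<bullet> i) * dir_deriv i f x)" by auto
  with f' show ?thesis by simp
qed

lemma dir_deriv_mult:
  assumes "f differentiable (at x)" "g differentiable (at x)"
  shows "dir_deriv v (\<lambda>x. f x * g x) x = dir_deriv v f x * g x + f x * dir_deriv v g x"
  using dir_deriv_eq[OF has_derivative_mult[OF assms[unfolded frechet_derivative_works]]]
  by (simp add: dir_deriv_def)

lemma dir_deriv_add:
  assumes "f differentiable (at x)" "g differentiable (at x)"
  shows "dir_deriv v (\<lambda>x. f x + g x) x = dir_deriv v f x + dir_deriv v g x"
  using dir_deriv_eq[OF has_derivative_add[OF assms[unfolded frechet_derivative_works]]]
  by (simp add: dir_deriv_def)

lemma dir_deriv_const [simp]: "dir_deriv v (\<lambda>x. c) = (\<lambda>x. 0)"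
  using dir_deriv_eq[OF has_derivative_const] by fastforce

lemma dir_deriv_inner [simp]: "dir_deriv v (\<lambda>x. x \<bullet> a) = (\<lambda>x. v \<bullet> a)"
  by (rule ext, rule dir_deriv_eq) (auto intro!: derivative_eq_intros)

lemma dir_deriv_compose_real:
  assumes "f differentiable (at x)" "(g has_real_derivative g') (at (f x))"
  shows "dir_deriv v (\<lambda>x. g (f x)) x = g' * dir_deriv v f x"
proof -
  have "((\<lambda>x. g (f x)) has_derivative (\<lambda>v. g' * frechet_derivative f (at x) v)) (at x)"
    using has_derivative_compose[OF assms(1)[unfolded frechet_derivative_works] assms(2)[unfolded has_field_derivative_def]] .
  from dir_deriv_eq[OF this] show ?thesis by (simp add: dir_deriv_def)
qed

lemma differentiable_compose_real:
  assumes "f differentiable (at x)" "(g has_real_derivative g') (at (f x))"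
  shows "(\<lambda>x. g (f x)) differentiable (at x)"
  using differentiable_compose[of g f x] assms field_differentiable_imp_differentiable
  by (metis differentiable_def has_field_derivative_imp_has_derivative)

section \<open>Closure properties of the classes \<open>Ck\<close>\<close>

lemma Ck_Suc_differentiable: "Ck (Suc k) f \<Longrightarrow> f differentiable (at x)"
  by simp

lemma Ck_imp_continuous_on: "Ck k f \<Longrightarrow> continuous_on UNIV f"
  by (cases k) (auto simp: continuous_at_imp_continuous_on differentiable_imp_continuous_within)

lemma Ck_Suc_imp_Ck: "Ck (Suc k) f \<Longrightarrow> Ck k f"
proof (induction k arbitrary: f)
  case 0
  then show ?case using Ck_imp_continuous_on[of "Suc 0" f] by simp
next
  case (Suc k)
  then show ?case by (metis Ck.simps(2))
qed

lemma Ck_const [simp]: "Ck k (\<lambda>x. c)"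
  by (induction k arbitrary: c) auto

lemma Ck_inner [simp]: "Ck k (\<lambda>x. x \<bullet> a)"
  by (cases k) (auto intro!: continuous_intros derivative_intros)

lemma Ck_add: "Ck k f \<Longrightarrow> Ck k g \<Longrightarrow> Ck k (\<lambda>x. f x + g x)"
proof (induction k arbitrary: f g)
  case (Suc k)
  then have "dir_deriv i (\<lambda>x. f x + g x) = (\<lambda>x. dir_deriv i f x + dir_deriv i g x)" for i
    by (auto simp: dir_deriv_add)
  with Suc show ?case by simp
qed (auto intro: continuous_intros)

lemma Ck_mult: "Ck k f \<Longrightarrow> Ck k g \<Longrightarrow> Ck k (\<lambda>x. f x * g x)"
proof (induction k arbitrary: f g)
  case (Suc k)
  then have "dir_deriv i (\<lambda>x. f x * g x) = (\<lambda>x. dir_deriv i f x * g x + f x * dir_deriv i g x)" for i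
    by (auto simp: dir_deriv_mult)
  with Suc Ck_Suc_imp_Ck[OF Suc.prems(1)] Ck_Suc_imp_Ck[OF Suc.prems(2)] show ?case
    by (simp add: Ck_add)
qed (auto intro: continuous_intros)

lemma Ck_sum: "(\<And>i. i \<in> A \<Longrightarrow> Ck k (f i)) \<Longrightarrow> Ck k (\<lambda>x. \<Sum>i\<in>A. f i x)"
  by (induction A rule: infinite_finite_induct) (auto intro: Ck_add)

lemma Ck_norm_sq: "Ck k (\<lambda>x. x \<bullet> x)"
proof -
  have "Ck k (\<lambda>x. \<Sum>i\<in>Basis. (x \<bullet> i) * (x \<bullet> i))"
    by (intro Ck_sum Ck_mult Ck_inner)
  then show ?thesis by (simp flip: euclidean_inner)
qed

lemma Ck_compose_linear:
  fixes f :: "'b::euclidean_space \<Rightarrow> real" and L :: "'a::euclidean_space \<Rightarrow> 'b"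
  assumes L: "bounded_linear L"
  shows "Ck k f \<Longrightarrow> Ck k (\<lambda>x. f (L x))"
proof (induction k arbitrary: f)
  case 0
  then show ?case
    using continuous_on_compose2[of UNIV f UNIV L] linear_continuous_on[OF L] by simp
next
  case (Suc k)
  have der: "((\<lambda>x. f (L x)) has_derivative (\<lambda>v. \<Sum>i\<in>Basis. (L v \<bullet> i) * dir_deriv i f (L x))) (at x)" for x
    using has_derivative_compose[OF bounded_linear_imp_has_derivative[OF L] has_derivative_dir_deriv[of f "L x"]] Suc.prems by simp
  have "dir_deriv j (\<lambda>x. f (L x)) = (\<lambda>x. \<Sum>i\<in>Basis. (L j \<bullet> i) * dir_deriv i f (L x))" for j
    using dir_deriv_eq[OF der] by auto
  moreover have "Ck k (\<lambda>x. \<Sum>i\<in>Basis. (L j \<bullet> i) * dir_deriv i f (L x))" for j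
    using Suc by (intro Ck_sum Ck_mult Ck_const) auto
  ultimately show ?case using der by (auto simp: differentiable_def)
qed

text \<open>The set \<open>S\<close> is there for inverse powers, which are smooth on the positive
  half-line only. Derivatives are two-sided at each point of \<open>S\<close>, as the chain rule in
  \<open>Ck_compose_real\<close> requires.\<close>

primrec Ck_real_on :: "nat \<Rightarrow> real set \<Rightarrow> (real \<Rightarrow> real) \<Rightarrow> bool" where
  "Ck_real_on 0 S g \<longleftrightarrow> continuous_on S g"
| "Ck_real_on (Suc k) S g \<longleftrightarrow> (\<exists>g'. (\<forall>x\<in>S. (g has_real_derivative g' x) (at x)) \<and> Ck_real_on k S g')"

lemma Ck_real_on_SucI:
  "(\<And>x. x \<in> S \<Longrightarrow> (g has_real_derivative g' x) (at x)) \<Longrightarrow> Ck_real_on k S g' \<Longrightarrow> Ck_real_on (Suc k) S g"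
  by auto

lemma Ck_compose_real:
  assumes S: "\<And>x. f x \<in> S"
  shows "Ck_real_on k S g \<Longrightarrow> Ck k f \<Longrightarrow> Ck k (\<lambda>x. g (f x))"
proof (induction k arbitrary: g)
  case 0
  then show ?case using continuous_on_compose2[of S g UNIV f] S by auto
next
  case (Suc k)
  then obtain g' where g': "\<And>x. x \<in> S \<Longrightarrow> (g has_real_derivative g' x) (at x)" "Ck_real_on k S g'"
    unfolding Ck_real_on.simps by blast
  have f: "f differentiable (at x)" for x using Suc.prems by simp
  have "dir_deriv i (\<lambda>x. g (f x)) = (\<lambda>x. g' (f x) * dir_deriv i f x)" for i
    using dir_deriv_compose_real[OF f g'(1)[OF S]] by auto
  moreover have "Ck k (\<lambda>x. g' (f x) * dir_deriv i f x)" if "i \<in> Basis" for i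
    using Suc.IH[OF g'(2) Ck_Suc_imp_Ck[OF Suc.prems(2)]] Suc.prems(2) that by (auto intro!: Ck_mult)
  ultimately show ?case using differentiable_compose_real[OF f g'(1)[OF S]] by auto
qed

text \<open>The family of all \<open>a * sin x + b * cos x\<close> is closed under differentiation,
  so the induction generalises over the coefficients. Inverse powers and \<open>flat_poly\<close>
  are treated alike.\<close>

lemma Ck_real_on_sin_cos: "Ck_real_on k UNIV (\<lambda>x. a * sin x + b * cos x)"
proof (induction k arbitrary: a b)
  case (Suc k)
  have "((\<lambda>x. a * sin x + b * cos x) has_real_derivative (- b) * sin x + a * cos x) (at x)" for x
    by (auto intro!: derivative_eq_intros)
  then show ?case using Suc[of "- b" a] by (rule Ck_real_on_SucI)
qed (auto intro!: continuous_intros)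

lemma Ck_cos: "Ck k f \<Longrightarrow> Ck k (\<lambda>x. cos (f x))"
  using Ck_compose_real[where S=UNIV and f=f, OF _ Ck_real_on_sin_cos[of k 0 1]] by simp

lemma Ck_real_on_inverse_power: "Ck_real_on k {0<..} (\<lambda>x. c * inverse x ^ m)"
proof (induction k arbitrary: c m)
  case (Suc k)
  have "((\<lambda>x. c * inverse x ^ m) has_real_derivative (- c * m) * inverse x ^ Suc m) (at x)" if "x \<in> {0<..}" for x
  proof -
    have "((\<lambda>x. inverse x ^ m) has_real_derivative of_nat m * (- (inverse x ^ Suc (Suc 0)) * inverse x ^ (m - Suc 0))) (at x)"
      using that by (intro DERIV_power DERIV_inverse) simp
    from DERIV_cmult[OF this, of c] show ?thesis by (cases m) (simp_all add: mult_ac)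
  qed
  then show ?case using Suc[of "- c * m" "Suc m"] by (rule Ck_real_on_SucI)
qed (auto intro!: continuous_intros)

text \<open>The functions \<open>p(1/x) exp(-1/x)\<close>, extended by 0, are closed under
  differentiation: the derivative replaces \<open>p\<close> by \<open>(p - p') X^2\<close>. This
  makes the classical flat function smooth without a formula for its higher derivatives.\<close>

definition flat_poly :: "real poly \<Rightarrow> real \<Rightarrow> real" where
  "flat_poly p x = (if x > 0 then poly p (1 / x) * exp (- (1 / x)) else 0)"

text \<open>The extra power \<open>y ^ k\<close> carries the induction: splitting off the constant
  coefficient of the polynomial raises \<open>k\<close> by one.\<close>

lemma tendsto_poly_exp_0: "((\<lambda>y::real. y ^ k * poly p y * exp (- y)) \<longlongrightarrow> 0) at_top"
proof (induction p arbitrary: k)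
  case (pCons a p)
  have "((\<lambda>y::real. a * (y ^ k / exp y) + y ^ Suc k * poly p y * exp (- y)) \<longlongrightarrow> a * 0 + 0) at_top"
    by (intro tendsto_intros tendsto_power_div_exp_0 pCons.IH)
  then show ?case by (simp add: algebra_simps exp_minus divide_inverse)
qed simp

lemma flat_poly_tendsto_0: "(flat_poly p \<longlongrightarrow> 0) (at 0)"
proof (rule filterlim_split_at_real)
  show "(flat_poly p \<longlongrightarrow> 0) (at_left 0)"
    by (rule tendsto_eventually) (auto simp: eventually_at_left_field flat_poly_def intro!: exI[of _ "-1"])
  have "((\<lambda>x. (1 / x) ^ 0 * poly p (1 / x) * exp (- (1 / x))) \<longlongrightarrow> 0) (at_right 0)"
    using filterlim_compose[OF tendsto_poly_exp_0[of 0 p] filterlim_inverse_at_top_right]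
      by (simp add: divide_inverse)
  then show "(flat_poly p \<longlongrightarrow> 0) (at_right 0)"
    by (rule Lim_transform_eventually) (auto simp: eventually_at_right_field flat_poly_def intro!: exI[of _ 1])
qed

lemma flat_poly_has_derivative:
  "(flat_poly p has_real_derivative flat_poly ((p - pderiv p) * [:0, 0, 1:]) x) (at x)"
proof -
  consider "x > 0" | "x < 0" | "x = 0" by linarith
  then show ?thesis
  proof cases
    case 1
    have "((\<lambda>x. poly p (1 / x) * exp (- (1 / x))) has_real_derivative
       poly (pderiv p) (1 / x) * (- 1 / x\<^sup>2) * exp (- (1 / x))
         + poly p (1 / x) * (exp (- (1 / x)) * (1 / x\<^sup>2))) (at x)"
      using 1 by (auto intro!: derivative_eq_intros simp: power2_eq_square)
    also have "poly (pderiv p) (1 / x) * (- 1 / x\<^sup>2) * exp (- (1 / x))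
      + poly p (1 / x) * (exp (- (1 / x)) * (1 / x\<^sup>2))
      = flat_poly ((p - pderiv p) * [:0, 0, 1:]) x"
      using 1 by (simp add: flat_poly_def algebra_simps power2_eq_square)
    finally show ?thesis
      by (rule has_field_derivative_transform_within_open[where S
        = "{0<..}"]) (use 1 in \<open>auto simp: flat_poly_def\<close>)
  next
    case 2
    have "((\<lambda>x. 0) has_real_derivative 0) (at x)" by simp
    then have "(flat_poly p has_real_derivative 0) (at x)"
      by (rule has_field_derivative_transform_within_open[where S
        = "{..<0}"]) (use 2 in \<open>auto simp: flat_poly_def\<close>)
    then show ?thesis using 2 by (simp add: flat_poly_def)
  next
    case 3
    \<comment> \<open>The difference quotient at 0 is again of this kind, with \<open>p\<close>
      multiplied by \<open>X\<close>, so it tends to 0.\<close>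
    have "((\<lambda>h. (flat_poly p h - flat_poly p 0) / h) \<longlongrightarrow> 0) (at 0)"
      by (rule Lim_transform_eventually[OF flat_poly_tendsto_0[of "p * [:0, 1:]"]])
        (auto simp: eventually_at_filter flat_poly_def)
    then show ?thesis using 3 by (simp add: has_field_derivative_iff flat_poly_def)
  qed
qed

lemma Ck_real_on_flat_poly: "Ck_real_on k UNIV (flat_poly p)"
proof (induction k arbitrary: p)
  case 0
  show ?case unfolding Ck_real_on.simps
    by (rule DERIV_continuous_on[OF has_field_derivative_at_within[OF flat_poly_has_derivative]])
qed (auto intro!: exI flat_poly_has_derivative)

definition flat_exp :: "real \<Rightarrow> real" where "flat_exp = flat_poly 1"

lemma Ck_flat: "Ck k f \<Longrightarrow> Ck k (\<lambda>x. flat_exp (f x))"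
  unfolding flat_exp_def using Ck_compose_real[where S=UNIV and f=f, OF _ Ck_real_on_flat_poly] by simp

lemma flat_eq: "flat_exp x = (if x > 0 then exp (- (1 / x)) else 0)"
  by (simp add: flat_exp_def flat_poly_def)

lemma flat_bounds: "0 \<le> flat_exp x" "flat_exp x \<le> 1"
  by (auto simp: flat_eq)

section \<open>Test functions in time\<close>

abbreviation smooth :: "('a::euclidean_space \<Rightarrow> real) \<Rightarrow> bool" where
  "smooth f \<equiv> \<forall>k. Ck k f"

lemma smooth_dir_deriv: "smooth f \<Longrightarrow> i \<in> Basis \<Longrightarrow> smooth (dir_deriv i f)"
  by (metis Ck.simps(2))

lemma smooth_differentiable: "smooth f \<Longrightarrow> f differentiable (at x)"
  by (metis Ck_Suc_differentiable)

lemma smooth_continuous_on: "smooth f \<Longrightarrow> continuous_on S f"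
  by (metis Ck_imp_continuous_on continuous_on_subset subset_UNIV)

lemma dir_deriv_real: "f differentiable (at x) \<Longrightarrow> dir_deriv 1 f x = deriv f x" for f :: "real \<Rightarrow> real"
  by (metis DERIV_deriv_iff_real_differentiable dir_deriv_eq has_field_derivative_def mult.right_neutral)

text \<open>A primitive of a bump on \<open>(a, b)\<close> is made compactly supported by cancelling its total mass with
  a second bump on \<open>(-2, -1)\<close>, which is invisible at positive times.\<close>

lemma indicator_approx_by_deriv_test_functions:
  fixes a b T :: real
  assumes ab: "0 \<le> a" "a < b" "b < T"
  obtains \<theta> :: "nat \<Rightarrow> real \<Rightarrow> real" where
    "\<And>n. \<theta> n \<in> test_functions_on {..<T}"
    "\<And>n t. 0 < t \<Longrightarrow> \<bar>deriv (\<theta> n) t\<bar> \<le> 1"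
    "\<And>t. 0 < t \<Longrightarrow> (\<lambda>n. deriv (\<theta> n) t) \<longlonglongrightarrow> indicator {a<..<b} t"
proof -
  \<comment> \<open>The factor \<open>n + 1\<close> drives the exponent to 0 inside the interval, so
    these smooth bumps increase to its indicator; outside, the argument of \<open>flat_exp\<close>
    is nonpositive for the times in question.\<close>
  define h where "h n t = flat_exp (real (Suc n) * ((t - a) * (b - t)))" for n t
  define h0 where "h0 t = flat_exp ((t + 2) * (- 1 - t))" for t
  have quad: "Ck k (\<lambda>t::real. (t + p) * (q - t))" for k p q
    using Ck_mult[OF Ck_add[OF Ck_inner[of k "1::real"] Ck_const[of k p]] Ck_add[OF Ck_const[of k q] Ck_mult[OF Ck_const[of k "-1"] Ck_inner[of k "1::real"]]]]
    by (simp add: algebra_simps inner_real_def)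
  have h_smooth: "smooth (h n)" for n
    using Ck_flat[OF Ck_mult[OF Ck_const quad[of _ "-a" b]]] unfolding h_def[abs_def] by simp
  have h0_smooth: "smooth h0"
    using Ck_flat[OF quad[of _ 2 "-1"]] unfolding h0_def[abs_def] by simp
  have h_supp: "h n t = 0" if "t \<le> a \<or> b \<le> t" for n t
    using that ab by (auto simp: h_def flat_eq zero_less_mult_iff)
  have h0_supp: "h0 t = 0" if "t \<le> -2 \<or> -1 \<le> t" for t
    using that by (auto simp: h0_def flat_eq zero_less_mult_iff)
  have h0_cont: "continuous_on S h0" and h_cont: "continuous_on S (h n)" for S n
    by (rule smooth_continuous_on[OF h0_smooth], rule smooth_continuous_on[OF h_smooth])
  define I0 where "I0 = integral {-3..b} h0"
  \<comment> \<open>The midpoint -3/2 of the second bump witnesses that its mass, a divisor below,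
    is positive.\<close>
  have "I0 > 0"
  proof -
    have pos: "h0 (-3/2) > 0" by (simp add: h0_def flat_eq)
    have "I0 \<noteq> 0"
    proof
      assume "I0 = 0"
      then have "\<forall>x\<in>{-3..b}. h0 x = 0"
        using integral_eq_0_iff[of "-3" b h0] ab h0_cont flat_bounds(1) by (simp add: I0_def h0_def)
      with pos ab show False by (force dest: bspec[of _ _ "-3/2"])
    qed
    moreover have "I0 \<ge> 0" unfolding I0_def
      by (intro integral_nonneg integrable_continuous_interval h0_cont) (simp add: h0_def flat_bounds)
    ultimately show ?thesis by simp
  qed
  define c where "c n = integral {-3..b} (h n) / I0" for n
  define g where "g n t = h n t - c n * h0 t" for n t
  have g_smooth: "smooth (g n)" for n
    using Ck_add[OF _ Ck_mult[OF Ck_const[of _ "- c n"]], of _ "h n" h0] h_smooth h0_smooth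
    unfolding g_def[abs_def] by simp
  have g_cont: "continuous_on S (g n)" for S n by (rule smooth_continuous_on[OF g_smooth])
  have g_supp: "g n t = 0" if "t \<le> -2 \<or> b \<le> t" for n t
    using that h_supp h0_supp ab by (auto simp: g_def)
  have g_int: "integral {-3..b} (g n) = 0" for n
  proof -
    have "integral {-3..b} (g n) = integral {-3..b} (h n) - c n * I0"
      unfolding g_def I0_def
        by (simp add: Henstock_Kurzweil_Integration.integral_diff integrable_continuous_interval h_cont h0_cont continuous_on_mult_left)
    then show ?thesis using \<open>I0 > 0\<close> by (simp add: c_def)
  qed
  \<comment> \<open>The lower limit lies to the left of all supports, so \<open>\<theta> n\<close>
    is 0 up to -2 and the fundamental theorem of calculus is needed only at interior points of the
    interval of integration.\<close>
  define \<theta> where "\<theta> n t = integral {-3..t} (g n)" for n t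
  have \<theta>_low: "\<theta> n t = 0" if "t \<le> -2" for n t
  proof -
    have "integral {-3..t} (g n) = integral {-3..t} (\<lambda>_. 0)"
      using that by (intro integral_cong) (simp add: g_supp)
    then show ?thesis by (simp add: \<theta>_def)
  qed
  have \<theta>_high: "\<theta> n t = 0" if "b \<le> t" for n t
  proof -
    have "integral {-3..t} (g n) = integral {-3..b} (g n) + integral {b..t} (g n)"
      using that ab by (intro Henstock_Kurzweil_Integration.integral_combine[symmetric] integrable_continuous_interval g_cont) auto
    moreover have "integral {b..t} (g n) = integral {b..t} (\<lambda>_. 0)"
      by (intro integral_cong) (simp add: g_supp)
    ultimately show ?thesis by (simp add: \<theta>_def g_int)
  qed
  have \<theta>_deriv: "(\<theta> n has_real_derivative g n t) (at t)" for n t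
  proof (cases "t < -2")
    case True
    have "((\<lambda>_. 0) has_real_derivative g n t) (at t)" using True by (simp add: g_supp)
    then show ?thesis
      by (rule has_field_derivative_transform_within_open[where S = "{..<-2}"]) (use True \<theta>_low in auto)
  next
    case False
    then have "((\<lambda>u. integral {-3..u} (g n)) has_real_derivative g n t) (at t within {-3..t+1})"
      by (intro integral_has_real_derivative g_cont) auto
    then show ?thesis
      unfolding \<theta>_def using False by (subst (asm) at_within_interior) auto
  qed
  have \<theta>_dd: "dir_deriv 1 (\<theta> n) = g n" for n
    using dir_deriv_eq[OF \<theta>_deriv[unfolded has_field_derivative_def]] by auto
  show thesis
  proof
    fix n
    have "Ck k (\<theta> n)" for k
    proof (rule Ck_Suc_imp_Ck)
      show "Ck (Suc k) (\<theta> n)"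
        using \<theta>_deriv g_smooth by (auto simp: \<theta>_dd Basis_real_def differentiable_def has_field_derivative_def)
    qed
    moreover have "\<theta> n t = 0" if "t \<notin> {-2..b}" for t
      using that \<theta>_low[of t n] \<theta>_high[of t n] by force
    ultimately show "\<theta> n \<in> test_functions_on {..<T}"
      unfolding test_functions_on_def using ab by (auto intro!: exI[of _ "{-2..b}"])
    show "\<bar>deriv (\<theta> n) t\<bar> \<le> 1" if "0 < t" for t
      using that flat_bounds
        by (simp add: DERIV_imp_deriv[OF \<theta>_deriv] g_def h0_supp h_def abs_le_iff order.trans[OF _ flat_bounds(1)])
  next
    fix t :: real assume t: "0 < t"
    have "(\<lambda>n. h n t) \<longlonglongrightarrow> indicator {a<..<b} t"
    proof (cases "t \<in> {a<..<b}")
      case True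
      define e where "e = (t - a) * (b - t)"
      have "e > 0" using True by (simp add: e_def)
      have "(\<lambda>n. exp (- (inverse (real (Suc n)) * inverse e))) \<longlonglongrightarrow> exp (- (0 * inverse e))"
        by (intro tendsto_intros LIMSEQ_inverse_real_of_nat)
      then show ?thesis using True \<open>e > 0\<close> by (simp add: h_def flat_eq divide_inverse flip: e_def)
    next
      case False
      then show ?thesis by (auto simp: h_supp)
    qed
    then show "(\<lambda>n. deriv (\<theta> n) t) \<longlonglongrightarrow> indicator {a<..<b} t"
      using t by (simp add: DERIV_imp_deriv[OF \<theta>_deriv] g_def h0_supp)
  qed
qed

section \<open>A decaying weight and its cutoffs\<close>

text \<open>Only arguments at most 1 occur below, being \<open>1 - m q\<close> with nonnegative
  \<open>m\<close> and \<open>q\<close>. There compactness of \<open>{0..1}\<close> suffices, as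
  negative arguments give 0.\<close>

lemma flat_poly_bounded:
  obtains C where "C \<ge> 0" "\<And>x. x \<le> 1 \<Longrightarrow> \<bar>flat_poly p x\<bar> \<le> C" 
proof -
  have "continuous_on {0..1} (flat_poly p)"
    by (rule DERIV_continuous_on[OF has_field_derivative_at_within[OF flat_poly_has_derivative]])
  then have "bounded (flat_poly p ` {0..1})"
    by (intro compact_imp_bounded compact_continuous_image) auto
  then obtain C where "\<forall>y\<in>flat_poly p ` {0..1}. norm y \<le> C"
    unfolding bounded_iff by blast
  then have C: "\<bar>flat_poly p x\<bar> \<le> C" if "x \<in> {0..1}" for x
    using that by auto
  show thesis
  proof (rule that[of "max C 0"])
    fix x :: real assume "x \<le> 1"
    then show "\<bar>flat_poly p x\<bar> \<le> max C 0"
      using C[of x] by (cases "x > 0") (auto simp: flat_poly_def le_max_iff_disj)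
  qed simp
qed

text \<open>The exponent provides one factor per coordinate, and each factor is at most the
  integrable function \<open>1 / (1 + t^2)\<close> of that coordinate.\<close>

lemma integrable_radial_weight:
  "integrable lborel (\<lambda>x::'a::euclidean_space. inverse (1 + x \<bullet> x) ^ DIM('a))"
proof (rule Bochner_Integration.integrable_bound)
  have "integrable lborel (\<lambda>x::real. inverse (1 + x\<^sup>2))"
    using integrable_inverse_1_plus_square by (simp add: set_integrable_def einterval_def)
  then show "integrable lborel (\<lambda>x::'a. \<Prod>b\<in>Basis. inverse (1 + (x \<bullet> b)\<^sup>2))"
    by (intro integrable_lborel_prod[where f = "\<lambda>_ x. inverse (1 + x\<^sup>2)"])
  have "inverse (1 + x \<bullet> x) ^ DIM('a) \<le> (\<Prod>b\<in>Basis. inverse (1 + (x \<bullet> b)\<^sup>2))" for x :: 'a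
  proof -
    have "(\<Prod>b\<in>(Basis::'a set). inverse (1 + x \<bullet> x)) \<le> (\<Prod>b\<in>Basis. inverse (1 + (x \<bullet> b)\<^sup>2))"
    proof (intro prod_mono conjI le_imp_inverse_le add_left_mono)
      fix b :: 'a assume "b \<in> Basis"
      then show "(x \<bullet> b)\<^sup>2 \<le> x \<bullet> x"
        using Basis_le_norm[of b x] power_mono[of "\<bar>x \<bullet> b\<bar>" "norm x" 2] by (simp add: power2_norm_eq_inner)
      show "0 < 1 + (x \<bullet> b)\<^sup>2" by (simp add: add_pos_nonneg)
    qed simp
    then show ?thesis by simp
  qed
  then show "AE x::'a in lborel. norm (inverse (1 + x \<bullet> x) ^ DIM('a)) \<le> norm (\<Prod>b\<in>Basis. inverse (1 + (x \<bullet> b)\<^sup>2))"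
    by (auto simp: prod_nonneg)
qed simp

lemma dir_deriv_norm_sq: "dir_deriv v (\<lambda>x. x \<bullet> x) x = 2 * (x \<bullet> v)"
  using dir_deriv_eq[OF has_derivative_inner[OF has_derivative_ident has_derivative_ident], of v x]
  by (simp add: inner_commute)

text \<open>The derivatives are required for \<open>q > -1\<close>, an open set containing all
  values of \<open>x \<bullet> x\<close>, so that the chain rule also holds at the origin.\<close>

lemma
  fixes x :: "'a::euclidean_space" and S S1 S2 :: "real \<Rightarrow> real"
  assumes S: "\<And>q. q > -1 \<Longrightarrow> (S has_real_derivative S1 q) (at q)" "\<And>q. q > -1 \<Longrightarrow> (S1 has_real_derivative S2 q) (at q)"
  shows grad_radial: "grad (\<lambda>x. S (x \<bullet> x)) x = (2 * S1 (x \<bullet> x)) *\<^sub>R x"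
    and laplacian_radial: "laplacian (\<lambda>x. S (x \<bullet> x)) x = 4 * S2 (x \<bullet> x) * (x \<bullet> x) + 2 * DIM('a) * S1 (x \<bullet> x)"
proof -
  have pos: "x \<bullet> x > -1" for x :: 'a using inner_ge_zero[of x] by linarith
  have diff: "(\<lambda>x. x \<bullet> x) differentiable (at x)" for x :: 'a
    using Ck_norm_sq[of "Suc 0", where 'a='a] by simp
  have dd: "dir_deriv v (\<lambda>x::'a. S (x \<bullet> x)) = (\<lambda>x. S1 (x \<bullet> x) * (2 * (x \<bullet> v)))" for v
    using dir_deriv_compose_real[OF diff S(1)[OF pos]] by (auto simp: dir_deriv_norm_sq)
  show "grad (\<lambda>x. S (x \<bullet> x)) x = (2 * S1 (x \<bullet> x)) *\<^sub>R x"
  proof -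
    have "grad (\<lambda>x. S (x \<bullet> x)) x = (\<Sum>i\<in>Basis. (2 * S1 (x \<bullet> x)) *\<^sub>R ((x \<bullet> i) *\<^sub>R i))"
      unfolding grad_def dd by (intro sum.cong) auto
    also have "\<dots> = (2 * S1 (x \<bullet> x)) *\<^sub>R x"
      by (simp only: scaleR_sum_right[symmetric] euclidean_representation)
    finally show ?thesis .
  qed
  have lin: "(\<lambda>x. 2 * (x \<bullet> v)) differentiable (at x)" for v x :: 'a by (auto intro!: derivative_intros)
  have lin': "dir_deriv v (\<lambda>x. 2 * (x \<bullet> v)) x = 2 * (v \<bullet> v)" for v x :: 'a
    by (rule dir_deriv_eq) (auto intro!: derivative_eq_intros)
  have "dir_deriv v (dir_deriv v (\<lambda>x::'a. S (x \<bullet> x))) x = 4 * S2 (x \<bullet> x) * ((x \<bullet> v) * (x \<bullet> v))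
    + 2 * S1 (x \<bullet> x) * (v \<bullet> v)" for v
    unfolding dd dir_deriv_mult[OF differentiable_compose_real[OF diff S(2)[OF pos]] lin]
      dir_deriv_compose_real[OF diff S(2)[OF pos]] dir_deriv_norm_sq lin' by (simp add: algebra_simps)
  then have "laplacian (\<lambda>x. S (x \<bullet> x)) x
      = (\<Sum>v\<in>Basis. 4 * S2 (x \<bullet> x) * ((x \<bullet> v) * (x \<bullet> v)) + 2 * S1 (x \<bullet> x) * (v \<bullet> v))"
    unfolding laplacian_def by simp
  also have "\<dots> = 4 * S2 (x \<bullet> x) * (x \<bullet> x) + 2 * DIM('a) * S1 (x \<bullet> x)"
    by (subst euclidean_inner[of x x]) (simp add: sum.distrib sum_distrib_left inner_Basis)
  finally show "laplacian (\<lambda>x. S (x \<bullet> x)) x = 4 * S2 (x \<bullet> x) * (x \<bullet> x) + 2 * DIM('a) * S1 (x \<bullet> x)" .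
qed


definition flat_deriv_poly :: "real poly \<Rightarrow> real poly" where
  "flat_deriv_poly p = (p - pderiv p) * [:0, 0, 1:]"

text \<open>The cutoff is a bump in \<open>q / (n + 1)\<close>. On its support \<open>1 + q \<le> 2 (n + 1)\<close>, so each derivative falling on
  it still gains a factor \<open>1 / (1 + q)\<close>, uniformly in \<open>n\<close>.\<close>

lemma radial_cutoff_weight:
  fixes d :: nat
  defines "A \<equiv> \<lambda>q. inverse (1 + q) ^ d"
  obtains S S1 S2 :: "nat \<Rightarrow> real \<Rightarrow> real" and C A1 A2 where
    "\<And>n q. q > -1 \<Longrightarrow> (S n has_real_derivative S1 n q) (at q)"
    "\<And>n q. q > -1 \<Longrightarrow> (S1 n has_real_derivative S2 n q) (at q)"
    "\<And>n q. q \<ge> 0 \<Longrightarrow> \<bar>S n q\<bar> \<le> C * A q"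
    "\<And>n q. q \<ge> 0 \<Longrightarrow> \<bar>S1 n q\<bar> * (1 + q) \<le> C * A q"
    "\<And>n q. q \<ge> 0 \<Longrightarrow> \<bar>S2 n q\<bar> * (1 + q)\<^sup>2 \<le> C * A q"
    "\<And>q. q \<ge> 0 \<Longrightarrow> (\<lambda>n. S n q) \<longlonglongrightarrow> A q"
    "\<And>q. q \<ge> 0 \<Longrightarrow> (\<lambda>n. S1 n q) \<longlonglongrightarrow> A1 q"
    "\<And>q. q \<ge> 0 \<Longrightarrow> (\<lambda>n. S2 n q) \<longlonglongrightarrow> A2 q"
    "\<And>n k f. Ck k f \<Longrightarrow> (\<And>x. f x > -1) \<Longrightarrow> Ck k (\<lambda>x. S n (f x :: real))"
    "\<And>n q. q \<ge> real (Suc n) \<Longrightarrow> S n q = 0"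
proof -
  let ?u = "\<lambda>q::real. inverse (1 + q)"
  define A1 where "A1 q = - real d * ?u q ^ Suc d" for q
  define A2 where "A2 q = real d * real (Suc d) * ?u q ^ Suc (Suc d)" for q
  define p1 where "p1 = flat_deriv_poly 1"
  define p2 where "p2 = flat_deriv_poly p1"
  define m where "m n = inverse (real (Suc n))" for n
  \<comment> \<open>The factor \<open>exp 1\<close> compensates
    \<open>flat_exp 1 = exp (- 1)\<close>, so the cutoffs tend to 1.\<close>
  define B where "B n q = exp 1 * flat_exp (1 - m n * q)" for n q
  define B1 where "B1 n q = - (exp 1 * m n * flat_poly p1 (1 - m n * q))" for n q
  define B2 where "B2 n q = exp 1 * (m n)\<^sup>2 * flat_poly p2 (1 - m n * q)" for n q
  have m: "0 < m n" "m n \<le> 1" for n by (auto simp: m_def inverse_le_1_iff)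
  have m_lim: "m \<longlonglongrightarrow> 0" unfolding m_def by (rule LIMSEQ_inverse_real_of_nat)
  have A': "(A has_real_derivative A1 q) (at q)" "(A1 has_real_derivative A2 q) (at q)" if "q > -1" for q
  proof -
    have *: "((\<lambda>q. c * ?u q ^ k) has_real_derivative - c * real k * ?u q ^ Suc k) (at q)" for c k
    proof -
      have "((\<lambda>q. ?u q) has_real_derivative - (?u q ^ Suc (Suc 0) * 1)) (at q)"
        using that by (auto intro!: derivative_eq_intros)
      from DERIV_cmult[OF DERIV_power[OF this, of k], of c] show ?thesis
        by (cases k) (simp_all add: mult_ac)
    qed
    from *[of 1 d] show "(A has_real_derivative A1 q) (at q)" by (simp add: A_def A1_def[abs_def])
    from *[of "- real d" "Suc d"] show "(A1 has_real_derivative A2 q) (at q)"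
      by (simp add: A1_def[abs_def] A2_def)
  qed
  have B': "(B n has_real_derivative B1 n q) (at q)" "(B1 n has_real_derivative B2 n q) (at q)" for n q
  proof -
    have *: "((\<lambda>q. flat_poly p (1 - m n * q)) has_real_derivative - m n * flat_poly (flat_deriv_poly p) (1 - m n * q)) (at q)" for p
    proof -
      have "((\<lambda>q. 1 - m n * q) has_real_derivative - m n) (at q)" by (auto intro!: derivative_eq_intros)
      from DERIV_chain2[where f = "flat_poly p", OF flat_poly_has_derivative this] show ?thesis
        by (simp add: flat_deriv_poly_def mult.commute)
    qed
    from DERIV_cmult[OF *[of 1], of "exp 1"] show "(B n has_real_derivative B1 n q) (at q)"
      by (simp add: B_def[abs_def] B1_def flat_exp_def p1_def mult.assoc)
    from DERIV_cmult[OF *[of p1], of "- (exp 1 * m n)"] show "(B1 n has_real_derivative B2 n q) (at q)"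
      by (simp add: B1_def[abs_def] B2_def p2_def power2_eq_square mult_ac)
  qed
  obtain c1 where c1: "c1 \<ge> 0" "\<And>x. x \<le> 1 \<Longrightarrow> \<bar>flat_poly p1 x\<bar> \<le> c1" using flat_poly_bounded by blast
  obtain c2 where c2: "c2 \<ge> 0" "\<And>x. x \<le> 1 \<Longrightarrow> \<bar>flat_poly p2 x\<bar> \<le> c2" using flat_poly_bounded by blast
  \<comment> \<open>The factors 1, 2 and 4 are powers of the bound 2 on
    \<open>m n * (1 + q)\<close>, one power for each derivative of the cutoff.\<close>
  define c where "c = exp 1 * (1 + 2 * c1 + 4 * c2)"
  have c_ge: "exp 1 \<le> c" "exp 1 * (2 * c1) \<le> c" "exp 1 * (4 * c2) \<le> c" "0 \<le> c"
    using c1(1) c2(1) by (auto simp: c_def intro!: mult_left_mono add_nonneg_nonneg)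
  have bB: "\<bar>B n q\<bar> \<le> c" for n q
    using flat_bounds[of "1 - m n * q"] c_ge(1)
      by (auto simp: B_def abs_mult mult_le_one intro!: order.trans[OF _ c_ge(1)])
  have mq: "m n * (1 + q) \<le> 2" if "1 - m n * q > 0" for n q
    using that m(2)[of n] by (simp add: distrib_left)
  have bB1: "\<bar>B1 n q\<bar> * (1 + q) \<le> c" if "q \<ge> 0" for n q
  proof (cases "1 - m n * q > 0")
    case True
    have "\<bar>B1 n q\<bar> * (1 + q) = exp 1 * (\<bar>flat_poly p1 (1 - m n * q)\<bar> * (m n * (1 + q)))"
      using m(1)[of n] by (simp add: B1_def abs_mult)
    also have "\<dots> \<le> exp 1 * (c1 * 2)"
      using c1(2)[of "1 - m n * q"] m(1)[of n] that mq[OF True] c1(1) by (intro mult_left_mono mult_mono) auto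
    finally show ?thesis using c_ge(2) by (simp add: mult.commute)
  next
    case False
    then show ?thesis using c_ge(4) by (simp add: B1_def flat_poly_def)
  qed
  have bB2: "\<bar>B2 n q\<bar> * (1 + q)\<^sup>2 \<le> c" if "q \<ge> 0" for n q
  proof (cases "1 - m n * q > 0")
    case True
    have "\<bar>B2 n q\<bar> * (1 + q)\<^sup>2 = exp 1 * (\<bar>flat_poly p2 (1 - m n * q)\<bar> * (m n * (1 + q))\<^sup>2)"
      using m(1)[of n] by (simp add: B2_def abs_mult power_mult_distrib)
    also have "\<dots> \<le> exp 1 * (c2 * 2\<^sup>2)"
      using c2(2)[of "1 - m n * q"] m(1)[of n] that mq[OF True] c2(1)
        by (intro mult_left_mono mult_mono power_mono) auto
    finally show ?thesis using c_ge(3) by (simp add: mult.commute)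
  next
    case False
    then show ?thesis using c_ge(4) by (simp add: B2_def flat_poly_def)
  qed
  have A_pos: "A q > 0" if "q \<ge> 0" for q using that by (simp add: A_def)
  have bA1: "\<bar>A1 q\<bar> * (1 + q) = d * A q" if "q \<ge> 0" for q
  proof -
    have "?u q ^ Suc d * (1 + q) = ?u q ^ d" using that by simp
    then show ?thesis using that by (simp add: A1_def A_def abs_mult mult.assoc del: power_Suc)
  qed
  have bA2: "\<bar>A2 q\<bar> * (1 + q)\<^sup>2 = d * Suc d * A q" if "q \<ge> 0" for q
  proof -
    have "?u q ^ Suc (Suc d) * (1 + q)\<^sup>2 = ?u q ^ d * (?u q * (1 + q))\<^sup>2"
      by (simp add: power2_eq_square mult_ac)
    also have "\<dots> = ?u q ^ d" using that by simp
    finally have "?u q ^ Suc (Suc d) * (1 + q)\<^sup>2 = ?u q ^ d" .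
    then show ?thesis using that by (simp add: A2_def A_def abs_mult mult.assoc distrib_left del: power_Suc)
  qed
  \<comment> \<open>The summands are the Leibniz bounds for the zeroth, first and second derivative
    of \<open>A q * B n q\<close>.\<close>
  let ?C = "c + (d * c + c) + (d * Suc d * c + 2 * d * c + c)"
  have C_ge: "c \<le> ?C" "d * c + c \<le> ?C" "d * Suc d * c + 2 * d * c + c \<le> ?C" using c_ge(4) by auto
  have B_lim: "(\<lambda>n. B n q) \<longlonglongrightarrow> 1" for q
  proof -
    have "isCont flat_exp x" for x
      using flat_poly_has_derivative DERIV_isCont unfolding flat_exp_def by blast
    then have "(\<lambda>n. B n q) \<longlonglongrightarrow> exp 1 * flat_exp (1 - 0 * q)"
      unfolding B_def by (intro tendsto_intros isCont_tendsto_compose[where g = flat_exp] m_lim) auto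
    then show ?thesis by (simp add: flat_eq flip: exp_add)
  qed
  have B1_lim: "(\<lambda>n. B1 n q) \<longlonglongrightarrow> 0" and B2_lim: "(\<lambda>n. B2 n q) \<longlonglongrightarrow> 0" for q
  proof -
    have cont: "(\<lambda>n. flat_poly p (1 - m n * q)) \<longlonglongrightarrow> flat_poly p (1 - 0 * q)" for p
      using flat_poly_has_derivative DERIV_isCont by (intro isCont_tendsto_compose[where g
        = "flat_poly p"] tendsto_intros m_lim) blast
    have "(\<lambda>n. B1 n q) \<longlonglongrightarrow> - (exp 1 * 0 * flat_poly p1 (1 - 0 * q))" "(\<lambda>n. B2 n q)
      \<longlonglongrightarrow> exp 1 * 0\<^sup>2 * flat_poly p2 (1 - 0 * q)"
      unfolding B1_def B2_def by (intro tendsto_intros m_lim cont)+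
    then show "(\<lambda>n. B1 n q) \<longlonglongrightarrow> 0" "(\<lambda>n. B2 n q) \<longlonglongrightarrow> 0" by simp_all
  qed
  show thesis
  proof (rule that[of "\<lambda>n q. A q * B n q" "\<lambda>n q. A1 q * B n q + A q * B1 n q"
        "\<lambda>n q. A2 q * B n q + 2 * A1 q * B1 n q + A q * B2 n q" ?C A1 A2])
    show "((\<lambda>q. A q * B n q) has_real_derivative A1 q * B n q + A q * B1 n q) (at q)" if "q > -1" for n q
      using DERIV_mult[OF A'(1)[OF that] B'(1)] by (simp add: algebra_simps)
    show "((\<lambda>q. A1 q * B n q + A q * B1 n q) has_real_derivative A2 q * B n q + 2 * A1 q * B1 n q
      + A q * B2 n q) (at q)" if "q > -1" for n q
      using DERIV_add[OF DERIV_mult[OF A'(2)[OF that] B'(1)[of n q]] DERIV_mult[OF A'(1)[OF that] B'(2)[of n q]]] by (simp add: algebra_simps)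
    fix n :: nat and q :: real assume q: "q \<ge> 0"
    note A0 = less_imp_le[OF A_pos[OF q]]
    have "\<bar>A q * B n q\<bar> \<le> c * A q"
      using bB[of n q] A0 by (simp add: abs_mult mult.commute[of "A q"] mult_right_mono)
    also have "\<dots> \<le> ?C * A q" by (rule mult_right_mono[OF C_ge(1) A0])
    finally show "\<bar>A q * B n q\<bar> \<le> ?C * A q" .
    have "\<bar>A1 q * B n q + A q * B1 n q\<bar> * (1 + q) \<le> (\<bar>A1 q\<bar> * (1 + q)) * \<bar>B n q\<bar> + A q * (\<bar>B1 n q\<bar> * (1 + q))"
    proof -
      have "\<bar>A1 q * B n q + A q * B1 n q\<bar> \<le> \<bar>A1 q\<bar> * \<bar>B n q\<bar> + A q * \<bar>B1 n q\<bar>"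
        using abs_triangle_ineq[of "A1 q * B n q" "A q * B1 n q"] A0 by (simp add: abs_mult)
      from mult_right_mono[OF this, of "1 + q"] q show ?thesis by (simp add: algebra_simps)
    qed
    also have "\<dots> \<le> (d * A q) * c + A q * c"
      unfolding bA1[OF q] using bB[of n q] bB1[OF q, of n] A0 by (intro add_mono mult_left_mono) auto
    also have "\<dots> = (d * c + c) * A q" by (simp add: algebra_simps)
    also have "\<dots> \<le> ?C * A q" by (rule mult_right_mono[OF C_ge(2) A0])
    finally show "\<bar>A1 q * B n q + A q * B1 n q\<bar> * (1 + q) \<le> ?C * A q" .
    have "\<bar>A2 q * B n q + 2 * A1 q * B1 n q + A q * B2 n q\<bar> * (1 + q)\<^sup>2
      \<le> (\<bar>A2 q\<bar> * (1 + q)\<^sup>2) * \<bar>B n q\<bar> + 2 * (\<bar>A1 q\<bar> * (1 + q)) * (\<bar>B1 n q\<bar> * (1 + q)) + A q * (\<bar>B2 n q\<bar> * (1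
        + q)\<^sup>2)"
    proof -
      have "\<bar>A2 q * B n q + 2 * A1 q * B1 n q + A q * B2 n q\<bar> \<le> \<bar>A2 q * B n q\<bar> + \<bar>2 * A1 q * B1 n q\<bar>
        + \<bar>A q * B2 n q\<bar>"
        by linarith
      also have "\<dots> = \<bar>A2 q\<bar> * \<bar>B n q\<bar> + 2 * \<bar>A1 q\<bar> * \<bar>B1 n q\<bar> + A q * \<bar>B2 n q\<bar>"
        using A0 by (simp add: abs_mult)
      finally show ?thesis using mult_right_mono[of _ _ "(1 + q)\<^sup>2"] q
        by (fastforce simp: algebra_simps power2_eq_square)
    qed
    also have "\<dots> \<le> (d * Suc d * A q) * c + 2 * (d * A q) * c + A q * c"
      unfolding bA1[OF q] bA2[OF q] using bB[of n q] bB1[OF q, of n] bB2[OF q, of n] A0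
      by (intro add_mono mult_left_mono) auto
    also have "\<dots> = (d * Suc d * c + 2 * d * c + c) * A q" by (simp add: algebra_simps)
    also have "\<dots> \<le> ?C * A q" by (rule mult_right_mono[OF C_ge(3) A0])
    finally show "\<bar>A2 q * B n q + 2 * A1 q * B1 n q + A q * B2 n q\<bar> * (1 + q)\<^sup>2 \<le> ?C * A q" .
  next
    fix q :: real
    have "(\<lambda>n. A q * B n q) \<longlonglongrightarrow> A q * 1" "(\<lambda>n. A1 q * B n q + A q * B1 n q) \<longlonglongrightarrow> A1 q * 1 + A q * 0"
      "(\<lambda>n. A2 q * B n q + 2 * A1 q * B1 n q + A q * B2 n q) \<longlonglongrightarrow> A2 q * 1 + 2 * A1 q * 0 + A q * 0"
      by (intro tendsto_intros B_lim B1_lim B2_lim)+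
    then show "(\<lambda>n. A q * B n q) \<longlonglongrightarrow> A q" "(\<lambda>n. A1 q * B n q + A q * B1 n q) \<longlonglongrightarrow> A1 q"
       "(\<lambda>n. A2 q * B n q + 2 * A1 q * B1 n q + A q * B2 n q) \<longlonglongrightarrow> A2 q" by simp_all
  next
    fix n k and f :: "'b::euclidean_space \<Rightarrow> real" assume f: "Ck k f" "\<And>x. f x > -1"
    have "Ck k (\<lambda>x. 1 + f x)" "Ck k (\<lambda>x. 1 + (- m n) * f x)" by (intro Ck_add Ck_mult Ck_const f(1))+
    have f_pos: "0 < 1 + f x" for x using f(2)[of x] by linarith
    have "Ck k (\<lambda>x. 1 * inverse (1 + f x) ^ d)"
      by (rule Ck_compose_real[where S = "{0<..}" and f = "\<lambda>x. 1 + f x", OF _ Ck_real_on_inverse_power])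
        (use \<open>Ck k (\<lambda>x. 1 + f x)\<close> f_pos in auto)
    moreover have "Ck k (\<lambda>x. exp 1 * flat_exp (1 + (- m n) * f x))"
      by (intro Ck_mult Ck_const Ck_flat \<open>Ck k (\<lambda>x. 1 + (- m n) * f x)\<close>)
    ultimately have "Ck k (\<lambda>x. (1 * inverse (1 + f x) ^ d) * (exp 1 * flat_exp (1 + (- m n) * f x)))"
      by (rule Ck_mult)
    then show "Ck k (\<lambda>x. A (f x) * B n (f x))" by (simp add: A_def B_def)
  next
    show "A q * B n q = 0" if "real (Suc n) \<le> q" for n q
    proof -
      have "m n * real (Suc n) \<le> m n * q" using that m(1)[of n] by (intro mult_left_mono) auto
      then show ?thesis by (simp add: B_def flat_eq m_def)
    qed
  qed
qed


lemma smooth_grad_measurable: 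
  fixes f :: "'a::euclidean_space \<Rightarrow> real"
  assumes "smooth f"
  shows "f \<in> borel_measurable borel" "grad f \<in> borel_measurable borel" "laplacian f \<in> borel_measurable borel"
proof -
  show "f \<in> borel_measurable borel"
    by (intro borel_measurable_continuous_onI smooth_continuous_on assms)
  have "continuous_on UNIV (\<lambda>x. \<Sum>i\<in>Basis. dir_deriv i f x *\<^sub>R i)"
    by (intro continuous_intros smooth_continuous_on smooth_dir_deriv assms)
  then show "grad f \<in> borel_measurable borel"
    by (intro borel_measurable_continuous_onI) (simp add: grad_def[abs_def])
  have "continuous_on UNIV (\<lambda>x. \<Sum>i\<in>Basis. dir_deriv i (dir_deriv i f) x)"
    by (intro continuous_intros smooth_continuous_on smooth_dir_deriv assms)
  then show "laplacian f \<in> borel_measurable borel"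
    by (intro borel_measurable_continuous_onI) (simp add: laplacian_def[abs_def])
qed

text \<open>The weight has no compact support. It therefore comes with test functions
  \<open>\<sigma> n\<close> that converge to it together with gradient and Laplacian, under a common
  majorant \<open>C * \<rho>\<close> fit for dominated convergence.\<close>

lemma decaying_weight:
  obtains \<rho> :: "'a::euclidean_space \<Rightarrow> real" and \<sigma> :: "nat \<Rightarrow> 'a \<Rightarrow> real" and g :: "'a \<Rightarrow> 'a" and l :: "'a \<Rightarrow> real"
    and C where
    "integrable lborel \<rho>" "\<And>x. \<rho> x > 0" "\<And>x. \<rho> x \<le> 1"
    "g \<in> borel_measurable borel" "l \<in> borel_measurable borel"
    "\<And>n. \<sigma> n \<in> test_functions"
    "\<And>x. (\<lambda>n. \<sigma> n x) \<longlonglongrightarrow> \<rho> x" "\<And>x. (\<lambda>n. grad (\<sigma> n) x) \<longlonglongrightarrow> g x" "\<And>x. (\<lambda>n. laplacian (\<sigma> n) x) \<longlonglongrightarrow> l x"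
    "\<And>n x. \<bar>\<sigma> n x\<bar> \<le> C * \<rho> x" "\<And>n x. norm (grad (\<sigma> n) x) \<le> C * \<rho> x" "\<And>n x. \<bar>laplacian (\<sigma> n) x\<bar> \<le> C * \<rho> x"
proof -
  define A where "A q = inverse (1 + q) ^ DIM('a)" for q :: real
  show thesis
  proof (rule radial_cutoff_weight[where d = "DIM('a)" and 'a = 'a, folded A_def], goal_cases)
    case (1 S S1 S2 C A1 A2)
    note der = 1(1,2) and bd = 1(3-5) and lim = 1(6-8) and Ck = 1(9) and supp = 1(10)
    define \<rho> where "\<rho> x = A (x \<bullet> x)" for x :: 'a
    define \<sigma> where "\<sigma> n x = S n (x \<bullet> x)" for n and x :: 'a
    have grad_\<sigma>: "grad (\<sigma> n) x = (2 * S1 n (x \<bullet> x)) *\<^sub>R x" for n x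
      unfolding \<sigma>_def by (rule grad_radial[OF der])
    have lap_\<sigma>: "laplacian (\<sigma> n) x = 4 * S2 n (x \<bullet> x) * (x \<bullet> x) + 2 * DIM('a) * S1 n (x \<bullet> x)" for n x
      unfolding \<sigma>_def by (rule laplacian_radial[OF der])
    let ?g = "\<lambda>x::'a. (2 * A1 (x \<bullet> x)) *\<^sub>R x" and ?l = "\<lambda>x::'a. 4 * A2 (x \<bullet> x) * (x \<bullet> x)
      + 2 * DIM('a) * A1 (x \<bullet> x)"
    have \<sigma>_smooth: "smooth (\<sigma> n)" for n
    proof
      have "x \<bullet> x > -1" for x :: 'a using inner_ge_zero[of x] by linarith
      then show "Ck k (\<sigma> n)" for k
        unfolding \<sigma>_def[abs_def] by (intro Ck Ck_norm_sq)
    qed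
    have g_lim: "(\<lambda>n. grad (\<sigma> n) x) \<longlonglongrightarrow> ?g x" for x
      unfolding grad_\<sigma> by (intro tendsto_intros lim) simp
    have l_lim: "(\<lambda>n. laplacian (\<sigma> n) x) \<longlonglongrightarrow> ?l x" for x
      unfolding lap_\<sigma> by (intro tendsto_intros lim) simp_all
    have \<rho>_pos: "\<rho> x > 0" for x by (simp add: \<rho>_def A_def add_pos_nonneg)
    have "C \<ge> 0" using bd(1)[of 0 0] by (simp add: A_def)
    \<comment> \<open>The constant is dictated by the Laplacian, whose two terms contribute
      \<open>4 * C\<close> and \<open>2 * DIM('a) * C\<close>.\<close>
    show thesis
    proof (rule that[of \<rho> ?g ?l \<sigma> "4 * C + 2 * DIM('a) * C"])
      show "integrable lborel \<rho>" unfolding \<rho>_def A_def by (rule integrable_radial_weight)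
      show "\<rho> x > 0" for x by (rule \<rho>_pos)
      show "\<rho> x \<le> 1" for x by (simp add: \<rho>_def A_def power_le_one inverse_le_1_iff)
      show "?g \<in> borel_measurable borel"
        using borel_measurable_LIMSEQ_metric[of "\<lambda>n. grad (\<sigma> n)" borel ?g, OF smooth_grad_measurable(2)[OF \<sigma>_smooth] g_lim] .
      show "?l \<in> borel_measurable borel"
        by (rule borel_measurable_LIMSEQ_real[OF l_lim smooth_grad_measurable(3)[OF \<sigma>_smooth]])
      show "\<sigma> n \<in> test_functions" for n
      proof -
        have "\<sigma> n x = 0" if "x \<notin> cball 0 (Suc n)" for x
        proof -
          have "real (Suc n) * 1 \<le> norm x * norm x" using that by (intro mult_mono) auto
          then have "real (Suc n) \<le> x \<bullet> x" by (simp add: norm_eq_sqrt_inner)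
          then show ?thesis unfolding \<sigma>_def by (rule supp)
        qed
        then show ?thesis
          using \<sigma>_smooth unfolding test_functions_on_def by (auto intro!: exI[of _ "cball 0 (real (Suc n))"])
      qed
      show "(\<lambda>n. \<sigma> n x) \<longlonglongrightarrow> \<rho> x" for x unfolding \<sigma>_def \<rho>_def by (rule lim) simp
      show "(\<lambda>n. grad (\<sigma> n) x) \<longlonglongrightarrow> ?g x" "(\<lambda>n. laplacian (\<sigma> n) x) \<longlonglongrightarrow> ?l x" for x
        by (rule g_lim l_lim)+
      fix n and x :: 'a
      let ?C = "4 * C + 2 * DIM('a) * C"
      have "C * 1 \<le> 2 * DIM('a) * C"
        using \<open>C \<ge> 0\<close> DIM_positive[where 'a='a] by (subst mult.commute, intro mult_right_mono) linarith+
      then have C_le: "C * \<rho> x \<le> ?C * \<rho> x" "2 * C * \<rho> x \<le> ?C * \<rho> x"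
        using \<open>C \<ge> 0\<close> \<rho>_pos[of x] by (intro mult_right_mono; linarith)+
      show "\<bar>\<sigma> n x\<bar> \<le> ?C * \<rho> x"
        using bd(1)[of "x \<bullet> x" n] C_le by (simp add: \<sigma>_def \<rho>_def)
      have "2 * norm x \<le> 1 + x \<bullet> x"
        using sum_squares_bound[of 1 "norm x"] by (simp flip: power2_norm_eq_inner)
      then have x_le: "norm x \<le> 1 + x \<bullet> x"
        using norm_ge_zero[of x] by linarith
      \<comment> \<open>The power of \<open>1 + x \<bullet> x\<close> in the bound on
        \<open>S1\<close> pays for the factor \<open>x\<close> in the gradient; in the Laplacian its
        square pays for \<open>x \<bullet> x\<close>.\<close>
      have "norm (grad (\<sigma> n) x) = 2 * (\<bar>S1 n (x \<bullet> x)\<bar> * norm x)"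
        by (simp add: grad_\<sigma> abs_mult)
      also have "\<dots> \<le> 2 * (\<bar>S1 n (x \<bullet> x)\<bar> * (1 + x \<bullet> x))"
        using x_le by (intro mult_left_mono) auto
      also have "\<dots> \<le> 2 * (C * \<rho> x)" using bd(2)[of "x \<bullet> x" n] by (simp add: \<rho>_def)
      also have "\<dots> \<le> ?C * \<rho> x" using C_le by simp
      finally show "norm (grad (\<sigma> n) x) \<le> ?C * \<rho> x" .
      have "\<bar>laplacian (\<sigma> n) x\<bar> \<le> \<bar>4 * S2 n (x \<bullet> x) * (x \<bullet> x)\<bar> + \<bar>2 * DIM('a) * S1 n (x \<bullet> x)\<bar>"
        unfolding lap_\<sigma> by (rule abs_triangle_ineq)
      also have "\<dots> = 4 * (\<bar>S2 n (x \<bullet> x)\<bar> * (x \<bullet> x)) + 2 * DIM('a) * (\<bar>S1 n (x \<bullet> x)\<bar> * 1)"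
        by (simp add: abs_mult)
      also have "\<dots> \<le> 4 * (\<bar>S2 n (x \<bullet> x)\<bar> * (1 + x \<bullet> x)\<^sup>2) + 2 * DIM('a) * (\<bar>S1 n (x \<bullet> x)\<bar> * (1 + x \<bullet> x))"
      proof (intro add_mono mult_left_mono)
        have "0 \<le> (x \<bullet> x)\<^sup>2 + 1 + x \<bullet> x" by (intro add_nonneg_nonneg) auto
        then show "x \<bullet> x \<le> (1 + x \<bullet> x)\<^sup>2" by (simp add: power2_eq_square algebra_simps)
      qed auto
      also have "\<dots> \<le> 4 * (C * \<rho> x) + 2 * DIM('a) * (C * \<rho> x)"
        using bd(2,3)[of "x \<bullet> x" n] by (intro add_mono mult_left_mono) (auto simp: \<rho>_def)
      also have "\<dots> = ?C * \<rho> x" by (simp add: algebra_simps)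
      finally show "\<bar>laplacian (\<sigma> n) x\<bar> \<le> ?C * \<rho> x" .
    qed
  qed
qed

section \<open>Weak derivatives in time\<close>

text \<open>Half-lines are stable under intersection and generate the Borel sets, so vanishing of
  the integrals extends to all Borel sets; the total integral serves the complement step.\<close>

lemma AE_zero_of_lessThan_integrals:
  fixes f :: "real \<Rightarrow> real"
  assumes f: "integrable lborel f" and total: "(LBINT x. f x) = 0"
    and zero: "\<And>c. (LINT x:{..<c}|lborel. f x) = 0"
  shows "AE x in lborel. f x = 0"
proof (rule sigma_finite_measure.density_zero[OF lborel.sigma_finite_measure_axioms f])
  have sets_eq: "sets (lborel :: real measure) = sigma_sets UNIV (range lessThan)"
    by (subst sets_lborel, subst borel_Iio) simp
  fix A :: "real set" assume "A \<in> sets lborel"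
  then have A: "A \<in> sigma_sets UNIV (range lessThan)" by (simp only: sets_eq)
  have "{..<a} \<inter> {..<b} \<in> range lessThan" for a b :: real
    by (rule range_eqI[of _ _ "min a b"]) auto
  then have "Int_stable (range lessThan :: real set set)"
    by (auto simp: Int_stable_def)
  moreover have "range lessThan \<subseteq> Pow (UNIV :: real set)" by simp
  ultimately show "(LINT x:A|lborel. f x) = 0"
    using A
  proof (induction rule: sigma_sets_induct_disjoint)
    case (compl A)
    then have [measurable]: "A \<in> sets lborel" by (simp only: sets_eq)
    have "(LINT x:UNIV - A|lborel. f x) = (LBINT x. f x - indicator A x * f x)"
      unfolding set_lebesgue_integral_def by (intro Bochner_Integration.integral_cong) (auto simp: indicator_def)
    also have "\<dots> = 0"
      using f integrable_mult_indicator[OF \<open>A \<in> sets lborel\<close> f] compl(2) total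
      by (simp add: set_lebesgue_integral_def)
    finally show ?case .
  next
    case (union A)
    then have Am [measurable]: "A i \<in> sets lborel" for i unfolding sets_eq by blast
    have "set_integrable lborel (\<Union>i. A i) f"
      unfolding set_integrable_def by (rule integrable_mult_indicator[OF sets.countable_UN f]) (use Am in blast)
    then show ?case
      using union(1,3) Am by (subst lebesgue_integral_countable_add) (auto simp: disjoint_family_on_def)
  qed (use zero in \<open>auto simp: set_lebesgue_integral_def\<close>)
qed

lemma smooth_deriv: "smooth f \<Longrightarrow> smooth (deriv f)" for f :: "real \<Rightarrow> real"
proof -
  assume f: "smooth f"
  have "dir_deriv 1 f = deriv f"
    using dir_deriv_real[OF smooth_differentiable[OF f]] by auto
  with smooth_dir_deriv[OF f, of 1] show "smooth (deriv f)" by simp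
qed

lemma test_function_eq_integral_deriv:
  fixes \<theta> :: "real \<Rightarrow> real"
  assumes \<theta>: "\<theta> \<in> test_functions_on {..<T}" and t: "t < T"
  shows "\<theta> t = - (LINT s:{t..T}|lborel. deriv \<theta> s)"
    and "set_integrable lborel {t..T} (deriv \<theta>)"
proof -
  have sm: "smooth \<theta>" and T: "\<theta> T = 0" using \<theta> by (auto simp: test_functions_on_def)
  have cont: "continuous_on {t..T} (deriv \<theta>)"
    by (rule smooth_continuous_on[OF smooth_deriv[OF sm]])
  then show i: "set_integrable lborel {t..T} (deriv \<theta>)"
    by (intro borel_integrable_atLeastAtMost') 
  have "(LINT s:{t..T}|lborel. deriv \<theta> s) = \<theta> T - \<theta> t"
    unfolding set_lebesgue_integral_def
  proof (rule integral_FTC_Icc)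
    fix x show "(\<theta> has_vector_derivative deriv \<theta> x) (at x within {t..T})"
      using smooth_differentiable[OF sm, of x]
      by (metis DERIV_deriv_iff_real_differentiable has_real_derivative_iff_has_vector_derivative has_vector_derivative_at_within)
  qed (use t cont in auto)
  then show "\<theta> t = - (LINT s:{t..T}|lborel. deriv \<theta> s)" using T by simp
qed

lemma smooth_deriv_bounded:
  fixes \<theta> :: "real \<Rightarrow> real"
  assumes \<theta>: "smooth \<theta>"
  obtains B where "B \<ge> 0" "\<And>t. t \<in> {a..b} \<Longrightarrow> \<bar>\<theta> t\<bar> \<le> B" "\<And>t. t \<in> {a..b} \<Longrightarrow> \<bar>deriv \<theta> t\<bar> \<le> B"
proof -
  have "\<exists>B. \<forall>t\<in>{a..b}. \<bar>f t\<bar> \<le> B" if "smooth f" for f :: "real \<Rightarrow> real"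
  proof -
    have "bounded (f ` {a..b})"
      by (intro compact_imp_bounded compact_continuous_image smooth_continuous_on that) simp
    then obtain B where "\<forall>y\<in>f ` {a..b}. norm y \<le> B" unfolding bounded_iff by blast
    then show ?thesis by auto
  qed
  from this[OF \<theta>] this[OF smooth_deriv[OF \<theta>]]
  obtain B1 B2 where "\<forall>t\<in>{a..b}. \<bar>\<theta> t\<bar> \<le> B1" "\<forall>t\<in>{a..b}. \<bar>deriv \<theta> t\<bar> \<le> B2" by auto
  then show thesis by (intro that[of "max 0 (max B1 B2)"]) (auto simp: le_max_iff_disj)
qed

lemma integrable_bounded_interval:
  fixes f :: "real \<Rightarrow> real"
  assumes "f \<in> borel_measurable borel" "\<And>t. \<bar>f t\<bar> \<le> K" "\<And>t. t \<notin> {0<..<T} \<Longrightarrow> f t = 0"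
  shows "integrable lborel f"
proof (rule Bochner_Integration.integrable_bound)
  show "integrable lborel (\<lambda>t. K * indicator {0<..<T} t :: real)" by (cases "0 \<le> T") auto
  show "AE t in lborel. norm (f t) \<le> norm (K * indicator {0<..<T} t)"
    using assms(2,3) by (intro AE_I2) (auto simp: indicator_def intro: order_trans[OF _ abs_ge_self])
qed (use assms in simp)

text \<open>The tests may be nonzero at time 0, so the weak equation encodes a zero initial value as
  well as the derivative, and no constant of integration appears. The difference
  \<open>m - Q\<close> is annihilated by derivatives of test functions; these approximate the
  indicators of \<open>(0, c)\<close>, whence its integrals over half-lines vanish.\<close>

lemma weak_derivative_imp_AE_eq_integral:
  fixes m q :: "real \<Rightarrow> real"
  assumes T: "T > 0"
    and m [measurable]: "m \<in> borel_measurable borel" "\<And>t. \<bar>m t\<bar> \<le> K" "\<And>t. t \<notin> {0<..<T} \<Longrightarrow> m t = 0"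
    and q [measurable]: "q \<in> borel_measurable borel" "\<And>t. \<bar>q t\<bar> \<le> K" "\<And>t. t \<notin> {0<..<T} \<Longrightarrow> q t = 0"
    and weak: "\<And>\<theta>. \<theta> \<in> test_functions_on {..<T} \<Longrightarrow> (LBINT t. m t * deriv \<theta> t + q t * \<theta> t) = 0"
  shows "AE t in lborel. t \<in> {0<..<T} \<longrightarrow> m t = (LINT s:{..t}|lborel. q s)"
proof -
  define Q where "Q t = (LINT s:{..t}|lborel. q s)" for t
  have Q_eq: "Q t = (LBINT s. (if s \<le> t then q s else 0))" for t
    unfolding Q_def set_lebesgue_integral_def
      by (intro Bochner_Integration.integral_cong) (auto simp: indicator_def)
  have [measurable]: "Q \<in> borel_measurable borel" unfolding Q_eq[abs_def] by measurable
  have K: "K \<ge> 0" using m(2)[of 0] by linarith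
  have qi: "integrable lborel q" by (rule integrable_bounded_interval[OF q])
  have Q_bd: "\<bar>Q t\<bar> \<le> (LBINT s. \<bar>q s\<bar>)" for t
    using abs_integral_mult_bounded_le[OF qi, of "indicator {..t}" 1]
    by (simp add: Q_def set_lebesgue_integral_def mult.commute)
  define f where "f t = indicator {0<..<T} t * (m t - Q t)" for t
  have [measurable]: "f \<in> borel_measurable borel" unfolding f_def by measurable
  have f_bd: "\<bar>f t\<bar> \<le> K + (LBINT s. \<bar>q s\<bar>)" for t
    using m(2)[of t] Q_bd[of t] K by (auto simp: f_def indicator_def abs_le_iff intro: order_trans)
  have fi: "integrable lborel f"
    by (rule integrable_bounded_interval[OF _ f_bd, where T = T]) (auto simp: f_def)
  have key: "(LBINT t. f t * deriv \<theta> t) = 0" if \<theta>: "\<theta> \<in> test_functions_on {..<T}" for \<theta>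
  proof -
    have sm: "smooth \<theta>" using \<theta> by (auto simp: test_functions_on_def)
    have [measurable]: "\<theta> \<in> borel_measurable borel" "deriv \<theta> \<in> borel_measurable borel"
      by (rule borel_measurable_continuous_onI[OF smooth_continuous_on[OF sm]],
          rule borel_measurable_continuous_onI[OF smooth_continuous_on[OF smooth_deriv[OF sm]]])
    obtain B where B: "B \<ge> 0" "\<And>t. t \<in> {0..T} \<Longrightarrow> \<bar>\<theta> t\<bar> \<le> B" "\<And>t. t \<in> {0..T} \<Longrightarrow> \<bar>deriv \<theta> t\<bar> \<le> B"
      using smooth_deriv_bounded[where a = 0 and b = T, OF sm] by blast
    define D where "D t = indicator {0<..<T} t * deriv \<theta> t" for t
    have [measurable]: "D \<in> borel_measurable borel" unfolding D_def by measurable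
    have Di: "integrable lborel D"
      using B by (intro integrable_bounded_interval[of D B T]) (auto simp: D_def indicator_def)
    have i1: "integrable lborel (\<lambda>t. m t * deriv \<theta> t)"
    proof (rule integrable_bounded_interval)
      show "\<bar>m t * deriv \<theta> t\<bar> \<le> K * B" for t
      proof (cases "t \<in> {0<..<T}")
        case True
        then show ?thesis using B K m(2)[of t] by (auto simp: abs_mult intro!: mult_mono)
      qed (use B K in \<open>simp add: m(3)\<close>)
      show "m t * deriv \<theta> t = 0" if "t \<notin> {0<..<T}" for t using that by (simp add: m(3))
    qed simp
    have i2: "integrable lborel (\<lambda>t. q t * \<theta> t)"
    proof (rule integrable_bounded_interval)
      show "\<bar>q t * \<theta> t\<bar> \<le> K * B" for t
      proof (cases "t \<in> {0<..<T}")
        case True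
        then show ?thesis using B K q(2)[of t] by (auto simp: abs_mult intro!: mult_mono)
      qed (use B K in \<open>simp add: q(3)\<close>)
      show "q t * \<theta> t = 0" if "t \<notin> {0<..<T}" for t using that by (simp add: q(3))
    qed simp
    have int: "integrable (lborel \<Otimes>\<^sub>M lborel) (\<lambda>(t, s). q t * D s * (if t \<le> s then 1 else 0))"
      using integrable_mult_bounded[OF integrable_product_mult[OF qi Di], of "\<lambda>(t, s). if t \<le> s then 1 else 0" 1]
      by (simp add: case_prod_unfold)
    \<comment> \<open>Writing \<open>\<theta> t\<close> as minus the integral of its derivative over
      \<open>(t, T)\<close> and exchanging the integrals is an integration by parts that asks for no
      regularity of \<open>q\<close>.\<close>
    have "(LBINT t. q t * \<theta> t) = (LBINT t. - (LBINT s. q t * D s * (if t \<le> s then 1 else 0)))"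
    proof (rule Bochner_Integration.integral_cong[OF refl])
      fix t
      show "q t * \<theta> t = - (LBINT s. q t * D s * (if t \<le> s then 1 else 0))"
      proof (cases "t \<in> {0<..<T}")
        case True
        \<comment> \<open>\<open>D\<close> is cut off on an open interval, so the two integrands may
          differ at the endpoint \<open>T\<close>.\<close>
        have "AE s in lborel. D s * (if t \<le> s then 1 else 0) = indicator {t..T} s *\<^sub>R deriv \<theta> s"
          using AE_lborel_singleton[of T] by eventually_elim (use True in \<open>auto simp: D_def indicator_def\<close>)
        then have "(LBINT s. D s * (if t \<le> s then 1 else 0)) = (LINT s:{t..T}|lborel. deriv \<theta> s)"
          unfolding set_lebesgue_integral_def by (intro integral_cong_AE) simp_all
        also have "\<dots> = - \<theta> t" using test_function_eq_integral_deriv(1)[OF \<theta>, of t] True by simp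
        finally show ?thesis by (simp add: mult.assoc)
      qed (simp add: q)
    qed
    also have "\<dots> = - (LBINT s. (LBINT t. q t * D s * (if t \<le> s then 1 else 0)))"
      using lborel_pair.Fubini_integral[OF int] by simp
    also have "(LBINT s. (LBINT t. q t * D s * (if t \<le> s then 1 else 0))) = (LBINT s. D s * Q s)"
    proof (rule Bochner_Integration.integral_cong[OF refl])
      fix s
      have "(LBINT t. q t * D s * (if t \<le> s then 1 else 0)) = (LBINT t. D s * (if t \<le> s then q t else 0))"
        by (rule Bochner_Integration.integral_cong) auto
      then show "(LBINT t. q t * D s * (if t \<le> s then 1 else 0)) = D s * Q s" by (simp add: Q_eq)
    qed
    finally have "(LBINT t. q t * \<theta> t) = - (LBINT s. D s * Q s)" .
    moreover have "integrable lborel (\<lambda>s. D s * Q s)"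
      by (rule integrable_mult_bounded[OF Di _ Q_bd]) simp
    moreover have "(LBINT t. f t * deriv \<theta> t) = (LBINT t. m t * deriv \<theta> t - D t * Q t)"
      using m(3) by (intro Bochner_Integration.integral_cong) (auto simp: f_def D_def indicator_def algebra_simps)
    ultimately show ?thesis
      using weak[OF \<theta>] i1 i2 by simp
  qed
  have zero1: "(LINT t:{..<c}|lborel. f t) = 0" if "c < T" for c
  proof (cases "c > 0")
    case True
    obtain \<theta> where \<theta>: "\<And>n. \<theta> n \<in> test_functions_on {..<T}"
      "\<And>n t. 0 < t \<Longrightarrow> \<bar>deriv (\<theta> n) t\<bar> \<le> 1"
      "\<And>t. 0 < t \<Longrightarrow> (\<lambda>n. deriv (\<theta> n) t) \<longlonglongrightarrow> indicator {0<..<c} t"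
      using indicator_approx_by_deriv_test_functions[OF order_refl True \<open>c < T\<close>] by blast
    have "(\<lambda>n. LBINT t. f t * deriv (\<theta> n) t) \<longlonglongrightarrow> (LBINT t. f t * indicator {0<..<c} t)"
    proof (rule integral_dominated_convergence[where w = "\<lambda>t. \<bar>f t\<bar>"])
      have f0: "f t = 0" if "t \<le> 0" for t using that by (simp add: f_def)
      show "AE t in lborel. (\<lambda>n. f t * deriv (\<theta> n) t) \<longlonglongrightarrow> f t * indicator {0<..<c} t"
      proof (intro AE_I2)
        show "(\<lambda>n. f t * deriv (\<theta> n) t) \<longlonglongrightarrow> f t * indicator {0<..<c} t" for t
          using f0 by (cases "0 < t") (auto intro!: tendsto_mult_left \<theta>(3))
      qed
      show "AE t in lborel. norm (f t * deriv (\<theta> n) t) \<le> \<bar>f t\<bar>" for n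
      proof (intro AE_I2)
        show "norm (f t * deriv (\<theta> n) t) \<le> \<bar>f t\<bar>" for t
          using f0[of t] \<theta>(2)[of t n] by (cases "0 < t") (auto simp: abs_mult mult_left_le)
      qed
      have "smooth (\<theta> n)" for n using \<theta>(1)[of n] by (auto simp: test_functions_on_def)
      then have [measurable]: "deriv (\<theta> n) \<in> borel_measurable borel" for n
        by (rule borel_measurable_continuous_onI[OF smooth_continuous_on[OF smooth_deriv]])
      show "(\<lambda>t. f t * deriv (\<theta> n) t) \<in> borel_measurable lborel" for n by simp
    qed (use fi in auto)
    then have "(LBINT t. f t * indicator {0<..<c} t) = 0"
      by (simp add: key[OF \<theta>(1)] LIMSEQ_const_iff)
    moreover have "(LINT t:{..<c}|lborel. f t) = (LBINT t. f t * indicator {0<..<c} t)"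
      unfolding set_lebesgue_integral_def
        by (intro Bochner_Integration.integral_cong) (auto simp: f_def indicator_def)
    ultimately show ?thesis by simp
  next
    case False
    then have "(LINT t:{..<c}|lborel. f t) = (\<integral>t. 0 \<partial>(lborel :: real measure))"
      unfolding set_lebesgue_integral_def
        by (intro Bochner_Integration.integral_cong) (auto simp: f_def indicator_def)
    then show ?thesis by simp
  qed
  \<comment> \<open>The approximation covers \<open>c < T\<close> only; the full integral is reached
    by letting \<open>c\<close> tend to \<open>T\<close>.\<close>
  have total: "(LBINT t. f t) = 0"
  proof -
    let ?c = "\<lambda>n. T - inverse (real (Suc n))"
    have "(\<lambda>n. LBINT t. indicator {..<?c n} t *\<^sub>R f t) \<longlonglongrightarrow> (LBINT t. f t)"
    proof (rule integral_dominated_convergence[where w = "\<lambda>t. \<bar>f t\<bar>"])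
      show "AE t in lborel. (\<lambda>n. indicator {..<?c n} t *\<^sub>R f t) \<longlonglongrightarrow> f t"
      proof (intro AE_I2 tendsto_eventually)
        fix t
        have "?c \<longlonglongrightarrow> T - 0" by (intro tendsto_intros LIMSEQ_inverse_real_of_nat)
        then have ev: "t < T \<Longrightarrow> \<forall>\<^sub>F n in sequentially. t < ?c n"
          by (intro order_tendstoD(1)) auto
        show "\<forall>\<^sub>F n in sequentially. indicator {..<?c n} t *\<^sub>R f t = f t"
        proof (cases "t < T")
          case True
          from ev[OF True] show ?thesis by eventually_elim simp
        qed (simp add: f_def)
      qed
    qed (use fi in \<open>auto simp: indicator_def\<close>)
    moreover have "(LBINT t. indicator {..<?c n} t *\<^sub>R f t) = 0" for n
      using zero1[of "?c n"] by (simp add: set_lebesgue_integral_def)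
    ultimately show ?thesis by (simp add: LIMSEQ_const_iff)
  qed
  have "AE t in lborel. f t = 0"
  proof (rule AE_zero_of_lessThan_integrals[OF fi total])
    fix c
    show "(LINT t:{..<c}|lborel. f t) = 0"
    proof (cases "c < T")
      case False
      then have "(LINT t:{..<c}|lborel. f t) = (LBINT t. f t)"
        unfolding set_lebesgue_integral_def
          by (intro Bochner_Integration.integral_cong) (auto simp: f_def indicator_def)
      then show ?thesis using total by simp
    qed (rule zero1)
  qed
  then show ?thesis by eventually_elim (auto simp: f_def Q_def)
qed

section \<open>Modulated test functions\<close>

lemma smooth_mult: "smooth f \<Longrightarrow> smooth g \<Longrightarrow> smooth (\<lambda>x. f x * g x)"
  by (blast intro: Ck_mult)

lemma tensor_test_function:
  fixes \<theta> :: "real \<Rightarrow> real" and \<psi> :: "'a::euclidean_space \<Rightarrow> real"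
  assumes "\<theta> \<in> test_functions_on {..<T}" "\<psi> \<in> test_functions"
  shows "(\<lambda>(t, x). \<theta> t * \<psi> x) \<in> test_functions_on ({..<T} \<times> UNIV)"
proof -
  obtain K L where K: "compact K" "K \<subseteq> {..<T}" "\<And>t. t \<notin> K \<Longrightarrow> \<theta> t = 0"
    and L: "compact L" "\<And>x. x \<notin> L \<Longrightarrow> \<psi> x = 0"
    using assms by (auto simp: test_functions_on_def)
  have "Ck k (\<lambda>p :: real \<times> 'a. \<theta> (fst p) * \<psi> (snd p))" for k
    using assms
    by (intro Ck_mult Ck_compose_linear[OF bounded_linear_fst, of k \<theta>] Ck_compose_linear[OF bounded_linear_snd, of k \<psi>])
      (simp_all add: test_functions_on_def)
  then show ?thesis
    unfolding test_functions_on_def case_prod_unfold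
    using K L by (auto intro!: exI[of _ "K \<times> L"] compact_Times)
qed

lemma
  fixes \<psi> :: "'a::euclidean_space \<Rightarrow> real"
  shows laplacian_cmult: "smooth \<psi> \<Longrightarrow> laplacian (\<lambda>y. c * \<psi> y) x = c * laplacian \<psi> x"
  and grad_cmult: "smooth \<psi> \<Longrightarrow> grad (\<lambda>y. c * \<psi> y) x = c *\<^sub>R grad \<psi> x"
proof -
  assume \<psi>: "smooth \<psi>"
  have d: "dir_deriv i (\<lambda>y. c * f y) = (\<lambda>y. c * dir_deriv i f y)" if "smooth f" for f :: "'a \<Rightarrow> real" and i
    using dir_deriv_mult[OF differentiable_const[of c] smooth_differentiable[OF that]] by auto
  show "grad (\<lambda>y. c * \<psi> y) x = c *\<^sub>R grad \<psi> x"
    by (simp add: grad_def d[OF \<psi>] scaleR_sum_right)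
  have "dir_deriv i (dir_deriv i (\<lambda>y. c * \<psi> y)) x = c * dir_deriv i (dir_deriv i \<psi>) x" if "i \<in> Basis" for i
    by (simp add: d[OF \<psi>] d[OF smooth_dir_deriv[OF \<psi> that]])
  then show "laplacian (\<lambda>y. c * \<psi> y) x = c * laplacian \<psi> x"
    by (simp add: laplacian_def sum_distrib_left)
qed

lemma
  fixes \<sigma> :: "'a::euclidean_space \<Rightarrow> real" and \<xi> x :: 'a and a :: real
  assumes \<sigma>: "\<sigma> \<in> test_functions"
  defines "\<psi> \<equiv> \<lambda>x. \<sigma> x * cos (\<xi> \<bullet> x - a)"
  shows modulated_test_function: "\<psi> \<in> test_functions"
    and grad_modulated: "grad \<psi> x = cos (\<xi> \<bullet> x - a) *\<^sub>R grad \<sigma> x - (\<sigma> x * sin (\<xi> \<bullet> x - a)) *\<^sub>R \<xi>"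
    and laplacian_modulated: "laplacian \<psi> x = laplacian \<sigma> x * cos (\<xi> \<bullet> x - a)
        - 2 * (grad \<sigma> x \<bullet> \<xi>) * sin (\<xi> \<bullet> x - a) - \<sigma> x * (\<xi> \<bullet> \<xi>) * cos (\<xi> \<bullet> x - a)"
proof -
  have sm: "smooth \<sigma>" using \<sigma> by (auto simp: test_functions_on_def)
  have lin: "Ck k (\<lambda>x. \<xi> \<bullet> x - b)" for k b
    using Ck_add[OF Ck_inner[of k \<xi>] Ck_const[of k "-b"]] by (simp add: inner_commute)
  have sm_cos: "smooth (\<lambda>x. cos (\<xi> \<bullet> x - b))" for b by (intro allI Ck_cos lin)
  \<comment> \<open>A phase shift reduces smoothness of the sine to that of the cosine.\<close>
  have sin_eq: "sin (\<xi> \<bullet> x - a) = cos (\<xi> \<bullet> x - (a + pi / 2))" for x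
    using sin_cos_eq[of "\<xi> \<bullet> x - a"] cos_minus[of "pi / 2 - (\<xi> \<bullet> x - a)"] by (simp add: algebra_simps)
  have sm_sin: "smooth (\<lambda>x. sin (\<xi> \<bullet> x - a))" unfolding sin_eq by (rule sm_cos)
  have sm_\<psi>: "smooth \<psi>" unfolding \<psi>_def by (intro smooth_mult sm sm_cos)
  then show "\<psi> \<in> test_functions"
    using \<sigma> unfolding test_functions_on_def \<psi>_def by auto
  note diff = smooth_differentiable
  have dcos: "dir_deriv i (\<lambda>x. cos (\<xi> \<bullet> x - a)) = (\<lambda>x. - ((\<xi> \<bullet> i) * sin (\<xi> \<bullet> x - a)))" for i
    by (rule ext, rule dir_deriv_eq) (auto intro!: derivative_eq_intros)
  have dsin: "dir_deriv i (\<lambda>x. sin (\<xi> \<bullet> x - a)) = (\<lambda>x. (\<xi> \<bullet> i) * cos (\<xi> \<bullet> x - a))" for i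
    by (rule ext, rule dir_deriv_eq) (auto intro!: derivative_eq_intros)
  have d\<psi>: "dir_deriv i \<psi> = (\<lambda>x. dir_deriv i \<sigma> x * cos (\<xi> \<bullet> x - a) + (- (\<xi> \<bullet> i)) * (\<sigma> x * sin (\<xi> \<bullet> x - a)))" for i
    unfolding \<psi>_def using dir_deriv_mult[OF diff[OF sm] diff[OF sm_cos]] by (auto simp: dcos)
  show "grad \<psi> x = cos (\<xi> \<bullet> x - a) *\<^sub>R grad \<sigma> x - (\<sigma> x * sin (\<xi> \<bullet> x - a)) *\<^sub>R \<xi>"
  proof -
    have "grad \<psi> x
      = (\<Sum>i\<in>Basis. cos (\<xi> \<bullet> x - a) *\<^sub>R (dir_deriv i \<sigma> x *\<^sub>R i) - (\<sigma> x * sin (\<xi> \<bullet> x - a)) *\<^sub>R ((\<xi> \<bullet> i) *\<^sub>R i))"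
      unfolding grad_def d\<psi> by (intro sum.cong refl) (simp add: algebra_simps)
    also have "\<dots> = cos (\<xi> \<bullet> x - a) *\<^sub>R grad \<sigma> x - (\<sigma> x * sin (\<xi> \<bullet> x - a)) *\<^sub>R (\<Sum>i\<in>Basis. (\<xi> \<bullet> i) *\<^sub>R i)"
      by (simp only: sum_subtractf grad_def scaleR_sum_right)
    finally show ?thesis by (simp only: euclidean_representation)
  qed
  have dd: "dir_deriv i (dir_deriv i \<psi>) x = dir_deriv i (dir_deriv i \<sigma>) x * cos (\<xi> \<bullet> x - a)
      - 2 * sin (\<xi> \<bullet> x - a) * (dir_deriv i \<sigma> x * (\<xi> \<bullet> i)) - \<sigma> x * cos (\<xi> \<bullet> x - a) * ((\<xi> \<bullet> i) * (\<xi> \<bullet> i))" if "i \<in> Basis" for i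
  proof -
    have sm_d: "smooth (dir_deriv i \<sigma>)" by (rule smooth_dir_deriv[OF sm that])
    have "smooth (\<lambda>x. dir_deriv i \<sigma> x * cos (\<xi> \<bullet> x - a))" "smooth (\<lambda>x. \<sigma> x * sin (\<xi> \<bullet> x - a))"
      "smooth (\<lambda>x. (- (\<xi> \<bullet> i)) * (\<sigma> x * sin (\<xi> \<bullet> x - a)))"
      by (intro smooth_mult sm_d sm_cos sm_sin sm allI Ck_const)+
    note d2 = this[THEN diff]
    show ?thesis
      unfolding d\<psi> dir_deriv_add[OF d2(1,3)] dir_deriv_mult[OF diff[OF sm_d] diff[OF sm_cos]]
        dir_deriv_mult[OF differentiable_const d2(2)] dir_deriv_mult[OF diff[OF sm] diff[OF sm_sin]] dcos dsin
      by (simp add: algebra_simps)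
  qed
  have "laplacian \<psi> x = laplacian \<sigma> x * cos (\<xi> \<bullet> x - a)
      - 2 * sin (\<xi> \<bullet> x - a) * (\<Sum>i\<in>Basis. dir_deriv i \<sigma> x * (\<xi> \<bullet> i)) - \<sigma> x * cos (\<xi> \<bullet> x - a) * (\<Sum>i\<in>Basis. (\<xi> \<bullet> i) * (\<xi> \<bullet> i))"
  proof -
    have "laplacian \<psi> x = (\<Sum>i\<in>Basis. dir_deriv i (dir_deriv i \<sigma>) x * cos (\<xi> \<bullet> x - a)
      - 2 * sin (\<xi> \<bullet> x - a) * (dir_deriv i \<sigma> x * (\<xi> \<bullet> i)) - \<sigma> x * cos (\<xi> \<bullet> x - a) * ((\<xi> \<bullet> i) * (\<xi> \<bullet> i)))"
      unfolding laplacian_def by (intro sum.cong refl dd)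
    then show ?thesis
      by (simp only: sum_subtractf sum_distrib_left sum_distrib_right laplacian_def)
  qed
  also have "(\<Sum>i\<in>Basis. dir_deriv i \<sigma> x * (\<xi> \<bullet> i)) = grad \<sigma> x \<bullet> \<xi>"
    unfolding grad_def inner_sum_left by (intro sum.cong refl) (simp add: inner_commute)
  also have "(\<Sum>i\<in>Basis. (\<xi> \<bullet> i) * (\<xi> \<bullet> i)) = \<xi> \<bullet> \<xi>" by (rule euclidean_inner[symmetric])
  finally show "laplacian \<psi> x = laplacian \<sigma> x * cos (\<xi> \<bullet> x - a)
        - 2 * (grad \<sigma> x \<bullet> \<xi>) * sin (\<xi> \<bullet> x - a) - \<sigma> x * (\<xi> \<bullet> \<xi>) * cos (\<xi> \<bullet> x - a)"
    by (simp add: mult_ac)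
qed

section \<open>The energy identity for a single mode\<close>

lemma integral_exp_decay:
  fixes r T l :: real
  assumes l: "l > 0" and r: "r \<le> T"
  shows "(LINT t:{r..T}|lborel. exp (- l * t)) = (exp (- l * r) - exp (- l * T)) / l"
proof -
  have "(LINT t:{r..T}|lborel. exp (- l * t)) = - exp (- l * T) / l - (- exp (- l * r) / l)"
    unfolding set_lebesgue_integral_def
  proof (rule integral_FTC_Icc[OF r])
    fix x show "((\<lambda>t. - exp (- l * t) / l) has_vector_derivative exp (- l * x)) (at x within {r..T})"
      using l by (auto intro!: derivative_eq_intros simp flip: has_real_derivative_iff_has_vector_derivative)
  qed (intro continuous_intros)
  then show ?thesis by (simp add: diff_divide_distrib)
qed

text \<open>An integrated form of \<open>(Q^2)' = 2 q Q\<close> that does not differentiate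
  \<open>Q\<close>: the square is a double integral over \<open>{..t}\<close> times itself, and the
  diagonal cuts it into two halves, each equal to the integral of \<open>q r * Q r\<close>.\<close>

lemma sq_integral_eq:
  fixes q :: "real \<Rightarrow> real"
  assumes q: "integrable lborel q"
  defines "Q \<equiv> \<lambda>t. LINT s:{..t}|lborel. q s"
  shows "(Q t)\<^sup>2 = 2 * (LINT r:{..t}|lborel. q r * Q r)"
proof -
  have [measurable]: "q \<in> borel_measurable borel" using q by auto
  have Q_eq: "Q t = (LBINT s. (if s \<le> t then q s else 0))" for t
    unfolding Q_def set_lebesgue_integral_def
      by (intro Bochner_Integration.integral_cong) (auto simp: indicator_def)
  \<comment> \<open>With the strict inequality, the triangles \<open>s <= r\<close> and
    \<open>r < s\<close> are disjoint and cover the square.\<close>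
  have Q_eq': "Q t = (LBINT s. (if s < t then q s else 0))" for t
  proof -
    have "AE s in lborel. (if s \<le> t then q s else 0) = (if s < t then q s else 0)"
      using AE_lborel_singleton[of t] by eventually_elim auto
    then show ?thesis unfolding Q_eq by (intro integral_cong_AE) auto
  qed
  let ?P = "lborel \<Otimes>\<^sub>M lborel :: (real \<times> real) measure"
  define c where "c r = (if r \<le> t then q r else 0)" for r
  have [measurable]: "c \<in> borel_measurable borel" unfolding c_def by measurable
  have ci: "integrable lborel c"
  proof -
    have "c = (\<lambda>r. q r * indicator {..t} r)" by (auto simp: c_def)
    then show ?thesis using integrable_mult_bounded[OF q, of "indicator {..t}" 1] by simp
  qed
  have i: "integrable ?P (\<lambda>(r, s). c r * q s * (if s \<le> r then 1 else 0))"
      "integrable ?P (\<lambda>(r, s). q r * c s * (if r < s then 1 else 0))"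
    using integrable_mult_bounded[OF integrable_product_mult[OF ci q], of "\<lambda>(r, s). if s \<le> r then 1 else 0" 1]
      integrable_mult_bounded[OF integrable_product_mult[OF q ci], of "\<lambda>(r, s). if r < s then 1 else 0" 1]
    by (simp_all add: case_prod_unfold)
  have cQ: "(LBINT r. c r * Q r) = (LINT r:{..t}|lborel. q r * Q r)"
    unfolding set_lebesgue_integral_def by (intro Bochner_Integration.integral_cong) (auto simp: c_def)
  have "(Q t)\<^sup>2 = (LBINT r. c r) * (LBINT s. c s)"
    by (simp add: Q_eq c_def power2_eq_square)
  also have "\<dots> = (\<integral>p. c (fst p) * c (snd p) \<partial>?P)"
    by (rule integral_product_mult[OF ci ci, symmetric])
  \<comment> \<open>On each triangle only the larger variable needs the cutoff at \<open>t\<close>;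
    the smaller one inherits it.\<close>
  also have "\<dots> = (\<integral>p. (case p of (r, s) \<Rightarrow> c r * q s * (if s \<le> r then 1 else 0))
    + (case p of (r, s) \<Rightarrow> q r * c s * (if r < s then 1 else 0)) \<partial>?P)"
    by (intro Bochner_Integration.integral_cong) (auto simp: c_def)
  also have "\<dots> = (\<integral>p. (case p of (r, s) \<Rightarrow> c r * q s * (if s \<le> r then 1 else 0)) \<partial>?P)
    + (\<integral>p. (case p of (r, s) \<Rightarrow> q r * c s * (if r < s then 1 else 0)) \<partial>?P)"
    by (rule Bochner_Integration.integral_add[OF i])
  also have "(\<integral>p. (case p of (r, s) \<Rightarrow> c r * q s * (if s \<le> r then 1 else 0)) \<partial>?P) = (LBINT r. c r * Q r)"
    unfolding lborel_pair.integral_fst'[OF i(1), symmetric]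
  proof (rule Bochner_Integration.integral_cong[OF refl])
    fix r
    have "(LBINT s. c r * q s * (if s \<le> r then 1 else 0)) = (LBINT s. c r * (if s \<le> r then q s else 0))"
      by (intro Bochner_Integration.integral_cong) auto
    then show "(LBINT s. (case (r, s) of (r, s) \<Rightarrow> c r * q s * (if s \<le> r then 1 else 0))) = c r * Q r"
      by (simp add: Q_eq)
  qed
  also have "(\<integral>p. (case p of (r, s) \<Rightarrow> q r * c s * (if r < s then 1 else 0)) \<partial>?P) = (LBINT s. c s * Q s)"
    unfolding lborel_pair.integral_snd[OF i(2), symmetric]
  proof (rule Bochner_Integration.integral_cong[OF refl])
    fix s
    have "(LBINT r. q r * c s * (if r < s then 1 else 0)) = (LBINT r. c s * (if r < s then q r else 0))"
      by (intro Bochner_Integration.integral_cong) auto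
    then show "(LBINT r. q r * c s * (if r < s then 1 else 0)) = c s * Q s"
      by (simp add: Q_eq')
  qed
  finally show ?thesis by (simp add: cQ)
qed

text \<open>On \<open>(0, T)\<close> the following weight is the integral of \<open>exp (- l * t)\<close> over \<open>t \<in> (r, T)\<close>.\<close>

definition energy_weight :: "real \<Rightarrow> real \<Rightarrow> real \<Rightarrow> real" where
  "energy_weight l T r = indicator {0<..<T} r * ((exp (- l * r) - exp (- l * T)) / l)"

lemma energy_weight_measurable [measurable]: "energy_weight l T \<in> borel_measurable borel"
  unfolding energy_weight_def[abs_def] by measurable

lemma energy_weight_bounds:
  assumes "l > 0"
  shows "0 \<le> energy_weight l T r" "energy_weight l T r \<le> exp (- l * r) / l" "\<bar>energy_weight l T r\<bar> \<le> 1 / l"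
proof -
  show *: "0 \<le> energy_weight l T r" using assms by (auto simp: energy_weight_def indicator_def)
  show "energy_weight l T r \<le> exp (- l * r) / l"
    using assms by (auto simp: energy_weight_def indicator_def divide_right_mono)
  show "\<bar>energy_weight l T r\<bar> \<le> 1 / l"
  proof (cases "r \<in> {0<..<T}")
    case True
    have "exp (- l * r) \<le> 1" using assms True by simp
    then have "exp (- l * r) - exp (- l * T) \<le> 1" using exp_gt_zero[of "- l * T"] by linarith
    then have "energy_weight l T r \<le> 1 / l" using assms True by (simp add: energy_weight_def divide_right_mono)
    then show ?thesis using * by simp
  qed (use assms in \<open>simp add: energy_weight_def\<close>)
qed

text \<open>Insert the formula for the square of the primitive and exchange the integrals: for fixed
  \<open>r\<close> the exponential is integrated over \<open>t\<close> in \<open>(r, T)\<close>,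
  which gives the weight. There is no boundary term, because the primitive starts from 0.\<close>

lemma energy_identity:
  fixes m q :: "real \<Rightarrow> real"
  assumes l: "l > 0"
    and m [measurable]: "m \<in> borel_measurable borel" "\<And>t. \<bar>m t\<bar> \<le> K" "\<And>t. t \<notin> {0<..<T} \<Longrightarrow> m t = 0"
    and q [measurable]: "q \<in> borel_measurable borel" "\<And>t. \<bar>q t\<bar> \<le> K" "\<And>t. t \<notin> {0<..<T} \<Longrightarrow> q t = 0"
    and ae: "AE t in lborel. t \<in> {0<..<T} \<longrightarrow> m t = (LINT s:{..t}|lborel. q s)"
  shows "(LBINT t. exp (- l * t) * (m t)\<^sup>2) = 2 * (LBINT r. energy_weight l T r * (m r * q r))"
proof -
  define Q where "Q t = (LINT s:{..t}|lborel. q s)" for t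
  have Q_eq: "Q t = (LBINT s. (if s \<le> t then q s else 0))" for t
    unfolding Q_def set_lebesgue_integral_def
      by (intro Bochner_Integration.integral_cong) (auto simp: indicator_def)
  have [measurable]: "Q \<in> borel_measurable borel" unfolding Q_eq[abs_def] by measurable
  have qi: "integrable lborel q" by (rule integrable_bounded_interval[OF q])
  have Q_bd: "\<bar>Q t\<bar> \<le> 1 * (LBINT s. \<bar>q s\<bar>)" for t
    using abs_integral_mult_bounded_le[OF qi, of "indicator {..t}" 1]
    by (simp add: Q_def set_lebesgue_integral_def mult.commute)
  define e where "e t = indicator {0<..<T} t * exp (- l * t)" for t :: real
  have [measurable]: "e \<in> borel_measurable borel" unfolding e_def by measurable
  have ei: "integrable lborel e"
  proof (rule integrable_bounded_interval[where T = T])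
    show "\<bar>e t\<bar> \<le> 1" for t using l by (auto simp: e_def indicator_def)
  qed (auto simp: e_def)
  have qQi: "integrable lborel (\<lambda>r. q r * Q r)"
    by (rule integrable_mult_bounded[OF qi _ Q_bd]) simp
  have int: "integrable (lborel \<Otimes>\<^sub>M lborel) (\<lambda>(t, r). e t * (q r * Q r) * (if r \<le> t then 1 else 0))"
    using integrable_mult_bounded[OF integrable_product_mult[OF ei qQi], of "\<lambda>(t, r). if r \<le> t then 1 else 0" 1]
    by (simp add: case_prod_unfold)
  have "(LBINT t. exp (- l * t) * (m t)\<^sup>2) = (LBINT t. e t * (Q t)\<^sup>2)"
    using ae by (intro integral_cong_AE, simp, simp, eventually_elim) (auto simp: e_def Q_def m(3) indicator_def)
  also have "\<dots> = (LBINT t. 2 * (LBINT r. e t * (q r * Q r) * (if r \<le> t then 1 else 0)))"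
  proof (rule Bochner_Integration.integral_cong[OF refl])
    fix t
    have "(Q t)\<^sup>2 = 2 * (LINT r:{..t}|lborel. q r * Q r)"
      unfolding Q_def by (rule sq_integral_eq[OF qi])
    also have "(LINT r:{..t}|lborel. q r * Q r) = (LBINT r. (if r \<le> t then q r * Q r else 0))"
      unfolding set_lebesgue_integral_def by (intro Bochner_Integration.integral_cong) auto
    finally have "e t * (Q t)\<^sup>2 = e t * (2 * (LBINT r. (if r \<le> t then q r * Q r else 0)))"
      by simp
    also have "\<dots> = 2 * (LBINT r. e t * (if r \<le> t then q r * Q r else 0))" by simp
    also have "(LBINT r. e t * (if r \<le> t then q r * Q r else 0)) = (LBINT r. e t * (q r * Q r) * (if r
      \<le> t then 1 else 0))"
      by (intro Bochner_Integration.integral_cong) auto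
    finally show "e t * (Q t)\<^sup>2 = 2 * (LBINT r. e t * (q r * Q r) * (if r \<le> t then 1 else 0))" .
  qed
  also have "\<dots> = 2 * (LBINT t. (LBINT r. e t * (q r * Q r) * (if r \<le> t then 1 else 0)))" by simp
  also have "(LBINT t. (LBINT r. e t * (q r * Q r) * (if r \<le> t then 1 else 0)))
    = (LBINT r. (LBINT t. e t * (q r * Q r) * (if r \<le> t then 1 else 0)))"
    using lborel_pair.Fubini_integral[OF int] by simp
  also have "\<dots> = (LBINT r. energy_weight l T r * (m r * q r))"
  proof (rule integral_cong_AE)
    show "AE r in lborel. (LBINT t. e t * (q r * Q r) * (if r \<le> t then 1 else 0))
      = energy_weight l T r * (m r * q r)"
      using ae
    proof eventually_elim
      case (elim r)
      show ?case
      proof (cases "r \<in> {0<..<T}")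
        case True
        have "AE t in lborel. e t * (q r * Q r) * (if r \<le> t then 1 else 0)
          = (q r * Q r) * (indicator {r..T} t *\<^sub>R exp (- l * t))"
          using AE_lborel_singleton[of T] by eventually_elim (use True in \<open>auto simp: e_def indicator_def\<close>)
        then have "(LBINT t. e t * (q r * Q r) * (if r \<le> t then 1 else 0))
          = (LBINT t. (q r * Q r) * (indicator {r..T} t *\<^sub>R exp (- l * t)))"
          by (intro integral_cong_AE) simp_all
        also have "\<dots> = q r * Q r * ((exp (- l * r) - exp (- l * T)) / l)"
          using integral_exp_decay[OF l, of r T] True by (simp add: set_lebesgue_integral_def)
        finally show ?thesis using True elim by (simp add: energy_weight_def Q_def)
      qed (simp add: q energy_weight_def)
    qed
  qed simp_all
  finally show ?thesis .
qed

section \<open>Functions dominated by the weight\<close>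

lemma cos_transform_joint_measurable [measurable]:
  fixes f :: "real \<times> 'a::euclidean_space \<Rightarrow> real"
  assumes [measurable]: "f \<in> borel_measurable borel"
  shows "(\<lambda>p. cos_transform (\<lambda>x. f (fst p, x)) (snd p)) \<in> borel_measurable (lborel \<Otimes>\<^sub>M lborel)"
    "(\<lambda>p. sin_transform (\<lambda>x. f (fst p, x)) (snd p)) \<in> borel_measurable (lborel \<Otimes>\<^sub>M lborel)"
  unfolding cos_transform_def sin_transform_def by measurable

locale weighted_time_functions =
  fixes T :: real and \<rho> :: "'a::euclidean_space \<Rightarrow> real"
  assumes T: "T > 0" and \<rho>_int: "integrable lborel \<rho>" and \<rho>_pos: "\<And>x. \<rho> x > 0" and \<rho>_le_1: "\<And>x. \<rho> x \<le> 1"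
begin

text \<open>One bound makes every time slice both bounded and integrable, as Plancherel's identity
  requires, with constants independent of time, and confines the function to times in
  \<open>(0, T)\<close>.\<close>

definition dominated_by_weight :: "real \<Rightarrow> (real \<times> 'a \<Rightarrow> real) \<Rightarrow> bool" where
  "dominated_by_weight K f \<longleftrightarrow> f \<in> borel_measurable borel \<and> K \<ge> 0 \<and> (\<forall>t x. \<bar>f (t, x)\<bar>
    \<le> K * (indicator {0<..<T} t * \<rho> x))"

abbreviation C_hat :: "(real \<times> 'a \<Rightarrow> real) \<Rightarrow> real \<times> 'a \<Rightarrow> real" where
  "C_hat f \<equiv> \<lambda>p. cos_transform (\<lambda>x. f (fst p, x)) (snd p)"
abbreviation S_hat :: "(real \<times> 'a \<Rightarrow> real) \<Rightarrow> real \<times> 'a \<Rightarrow> real" where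
  "S_hat f \<equiv> \<lambda>p. sin_transform (\<lambda>x. f (fst p, x)) (snd p)"

lemma \<rho>_measurable [measurable]: "\<rho> \<in> borel_measurable borel" using \<rho>_int by auto

lemma
  assumes f: "dominated_by_weight K f"
  shows dominated_measurable: "f \<in> borel_measurable borel"
    and dominated_nonneg: "K \<ge> 0"
    and dominated_le_weight: "\<bar>f (t, x)\<bar> \<le> K * \<rho> x"
    and dominated_le: "\<bar>f (t, x)\<bar> \<le> K"
    and dominated_eq_0: "t \<notin> {0<..<T} \<Longrightarrow> f (t, x) = 0"
    and dominated_slice_integrable: "integrable lborel (\<lambda>x. f (t, x))"
proof -
  show [measurable]: "f \<in> borel_measurable borel" and K: "K \<ge> 0" using f by (auto simp: dominated_by_weight_def)
  have *: "\<bar>f (t, x)\<bar> \<le> K * (indicator {0<..<T} t * \<rho> x)" for t x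
    using f by (auto simp: dominated_by_weight_def)
  have "indicator {0<..<T} t * \<rho> x \<le> \<rho> x" for t x using \<rho>_pos[of x] by (simp add: indicator_def)
  then show K1: "\<bar>f (t, x)\<bar> \<le> K * \<rho> x" for t x
    using order_trans[OF * mult_left_mono[OF _ K]] by blast
  show "\<bar>f (t, x)\<bar> \<le> K"
    using order_trans[OF K1[of t x]] mult_left_mono[OF \<rho>_le_1 K] by simp
  show "t \<notin> {0<..<T} \<Longrightarrow> f (t, x) = 0" using *[of t x] by simp
  show "integrable lborel (\<lambda>x. f (t, x))"
  proof (rule Bochner_Integration.integrable_bound)
    show "integrable lborel (\<lambda>x. K * \<rho> x)" using \<rho>_int by simp
    show "AE x in lborel. norm (f (t, x)) \<le> norm (K * \<rho> x)"
      using order_trans[OF K1 abs_ge_self] by (intro AE_I2) simp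
  qed simp
qed

lemma
  assumes f: "dominated_by_weight K f"
  shows C_hat_bound: "\<bar>C_hat f p\<bar> \<le> K * (LBINT x. \<rho> x)"
    and S_hat_bound: "\<bar>S_hat f p\<bar> \<le> K * (LBINT x. \<rho> x)"
    and C_hat_eq_0: "fst p \<notin> {0<..<T} \<Longrightarrow> C_hat f p = 0"
    and S_hat_eq_0: "fst p \<notin> {0<..<T} \<Longrightarrow> S_hat f p = 0"
proof -
  have le: "(LBINT x. \<bar>f (t, x)\<bar>) \<le> K * (LBINT x. \<rho> x)" for t
  proof -
    have "(LBINT x. \<bar>f (t, x)\<bar>) \<le> (LBINT x. K * \<rho> x)"
      using dominated_le_weight[OF f] dominated_slice_integrable[OF f] \<rho>_int by (intro integral_mono) auto
    then show ?thesis by simp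
  qed
  show "\<bar>C_hat f p\<bar> \<le> K * (LBINT x. \<rho> x)"
    unfolding cos_transform_def
    using abs_integral_mult_bounded_le[OF dominated_slice_integrable[OF f, of "fst p"], of "\<lambda>x. cos (snd p \<bullet> x)" 1] le[of "fst p"]
    by simp
  show "\<bar>S_hat f p\<bar> \<le> K * (LBINT x. \<rho> x)"
    unfolding sin_transform_def
    using abs_integral_mult_bounded_le[OF dominated_slice_integrable[OF f, of "fst p"], of "\<lambda>x. sin (snd p \<bullet> x)" 1] le[of "fst p"]
    by simp
  show "fst p \<notin> {0<..<T} \<Longrightarrow> C_hat f p = 0" "fst p \<notin> {0<..<T} \<Longrightarrow> S_hat f p = 0"
    using dominated_eq_0[OF f] by (simp_all add: cos_transform_def sin_transform_def)
qed

lemma integrable_slice_mult: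
  assumes f: "dominated_by_weight K f" and h: "dominated_by_weight L h"
  shows "integrable lborel (\<lambda>x. f (t, x) * h (t, x))"
  by (rule integrable_mult_bounded[OF dominated_slice_integrable[OF f] borel_measurable_integrable[OF dominated_slice_integrable[OF h]] dominated_le[OF h]])

lemma plancherel_slice:
  assumes f: "dominated_by_weight K f" and h: "dominated_by_weight L h"
  shows "(LBINT \<xi>. C_hat f (t, \<xi>) * C_hat h (t, \<xi>) + S_hat f (t, \<xi>) * S_hat h (t, \<xi>))
      = (2 * pi) ^ DIM('a) * (LBINT x. f (t, x) * h (t, x))"
    and integrable_plancherel_slice:
      "integrable lborel (\<lambda>\<xi>. C_hat f (t, \<xi>) * C_hat h (t, \<xi>) + S_hat f (t, \<xi>) * S_hat h (t, \<xi>))"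
  using plancherel[OF dominated_slice_integrable[OF f] dominated_le[OF f] dominated_slice_integrable[OF h] dominated_le[OF h], of t t]
    integrable_plancherel[OF dominated_slice_integrable[OF f] dominated_le[OF f] dominated_slice_integrable[OF h] dominated_le[OF h], of t t]
  by simp_all

text \<open>Plancherel at each fixed time turns the frequency integral into the integral of a square
  over space, which is bounded in time and lives on a bounded interval.\<close>

lemma integrable_transform_sq_space_time:
  assumes f: "dominated_by_weight K f"
  shows "integrable (lborel \<Otimes>\<^sub>M lborel) (\<lambda>p. (C_hat f p)\<^sup>2 + (S_hat f p)\<^sup>2)"
proof -
  note K = dominated_nonneg[OF f] and [measurable] = dominated_measurable[OF f]
  note Kb = dominated_le_weight[OF f] dominated_le[OF f] dominated_eq_0[OF f] dominated_slice_integrable[OF f]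
  have [measurable]: "(\<lambda>t. LBINT x. f (t, x) * f (t, x)) \<in> borel_measurable borel" by measurable
  show ?thesis
  proof (rule lborel_pair.Fubini_integrable)
    have "(LBINT \<xi>. norm ((C_hat f (t, \<xi>))\<^sup>2 + (S_hat f (t, \<xi>))\<^sup>2))
      = (2 * pi) ^ DIM('a) * (LBINT x. f (t, x) * f (t, x))" for t
      using plancherel_slice[OF f f, of t] by (simp add: power2_eq_square)
    moreover have "integrable lborel (\<lambda>t. (2 * pi) ^ DIM('a) * (LBINT x. f (t, x) * f (t, x)))"
    proof (rule Bochner_Integration.integrable_mult_right, rule integrable_bounded_interval[where T = T])
      show "\<bar>LBINT x. f (t, x) * f (t, x)\<bar> \<le> K * (LBINT x. K * \<rho> x)" for t
      proof -
        have "\<bar>LBINT x. f (t, x) * f (t, x)\<bar> \<le> K * (LBINT x. \<bar>f (t, x)\<bar>)"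
          by (rule abs_integral_mult_bounded_le[OF Kb(4) _ Kb(2)]) simp
        also have "\<dots> \<le> K * (LBINT x. K * \<rho> x)"
          using Kb(1,4) \<rho>_int K by (intro mult_left_mono integral_mono) auto
        finally show ?thesis .
      qed
    qed (auto simp: Kb)
    ultimately show "integrable lborel (\<lambda>t. LBINT \<xi>. norm ((C_hat f (t, \<xi>))\<^sup>2 + (S_hat f (t, \<xi>))\<^sup>2))"
      by simp
    show "AE t in lborel. integrable lborel (\<lambda>\<xi>. (C_hat f (t, \<xi>))\<^sup>2 + (S_hat f (t, \<xi>))\<^sup>2)"
      using integrable_plancherel_slice[OF f f] by (simp add: power2_eq_square)
  qed simp
qed

lemma integrable_transform_mult_space_time:
  assumes f: "dominated_by_weight K f" and h: "dominated_by_weight L h"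
  shows "integrable (lborel \<Otimes>\<^sub>M lborel) (\<lambda>p. C_hat f p * C_hat h p + S_hat f p * S_hat h p)"
proof (rule Bochner_Integration.integrable_bound)
  have [measurable]: "f \<in> borel_measurable borel" "h \<in> borel_measurable borel"
    using f h by (auto simp: dominated_by_weight_def)
  show "integrable (lborel \<Otimes>\<^sub>M lborel) (\<lambda>p. ((C_hat f p)\<^sup>2 + (S_hat f p)\<^sup>2) + ((C_hat h p)\<^sup>2 + (S_hat h p)\<^sup>2))"
    by (rule Bochner_Integration.integrable_add[OF integrable_transform_sq_space_time[OF f] integrable_transform_sq_space_time[OF h]])
  have "\<bar>a * c + b * d\<bar> \<le> (a\<^sup>2 + b\<^sup>2) + (c\<^sup>2 + d\<^sup>2)" for a b c d :: real
  proof -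
    have *: "2 * \<bar>a * c\<bar> \<le> a\<^sup>2 + c\<^sup>2" for a c :: real
      using sum_squares_bound[of "\<bar>a\<bar>" "\<bar>c\<bar>"] by (simp add: abs_mult)
    show ?thesis using *[of a c] *[of b d] abs_triangle_ineq[of "a * c" "b * d"] by linarith
  qed
  then show "AE p in lborel \<Otimes>\<^sub>M lborel. norm (C_hat f p * C_hat h p + S_hat f p * S_hat h p)
    \<le> norm (((C_hat f p)\<^sup>2 + (S_hat f p)\<^sup>2) + ((C_hat h p)\<^sup>2 + (S_hat h p)\<^sup>2))"
    by (intro AE_I2) simp
  show "(\<lambda>p. C_hat f p * C_hat h p + S_hat f p * S_hat h p) \<in> borel_measurable (lborel \<Otimes>\<^sub>M lborel)" by measurable
qed

end

section \<open>The linear problem\<close>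

text \<open>The functions \<open>g\<close> and \<open>l\<close> play the role of the gradient and the Laplacian of the weight \<open>\<rho>\<close>; they are
  only known as limits along the cutoffs \<open>\<sigma> n\<close>, which is all that testing requires.\<close>

locale linear_problem = weighted_time_functions T \<rho> for T and \<rho> :: "'a::euclidean_space \<Rightarrow> real" +
  fixes z w :: "real \<times> 'a \<Rightarrow> real" and V :: "real \<times> 'a \<Rightarrow> 'a" and M C R :: real
    and \<sigma> :: "nat \<Rightarrow> 'a \<Rightarrow> real" and g :: "'a \<Rightarrow> 'a" and l :: "'a \<Rightarrow> real"
  assumes zwV [measurable]: "z \<in> borel_measurable borel" "w \<in> borel_measurable borel" "V \<in> borel_measurable borel"
    and bounded: "\<And>p. \<bar>z p\<bar> \<le> M" "\<And>p. \<bar>w p\<bar> \<le> M" "\<And>p. norm (V p) \<le> M"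
    and vanish: "\<And>t x. t \<notin> {0<..<T} \<Longrightarrow> z (t, x) = 0" "\<And>t x. t \<notin> {0<..<T} \<Longrightarrow> w (t, x) = 0" "\<And>t x. t \<notin> {0<..<T}
      \<Longrightarrow> V (t, x) = 0"
    and C_pos: "C > 0"
    and V_le: "\<And>p. norm (V p) \<le> C * \<bar>w p\<bar>"
    and w_sq_le: "\<And>p. (w p)\<^sup>2 \<le> C * (w p * z p)"
    and weak: "\<And>\<phi>. \<phi> \<in> test_functions_on ({..<T} \<times> UNIV) \<Longrightarrow>
      (LBINT p. z p * deriv (\<lambda>s. \<phi> (s, snd p)) (fst p) + w p * laplacian (\<lambda>y. \<phi> (fst p, y)) (snd p)
        + V p \<bullet> grad (\<lambda>y. \<phi> (fst p, y)) (snd p)) = 0"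
    and gl [measurable]: "g \<in> borel_measurable borel" "l \<in> borel_measurable borel"
    and \<sigma>: "\<And>n. \<sigma> n \<in> test_functions"
    and \<sigma>_lim: "\<And>x. (\<lambda>n. \<sigma> n x) \<longlonglongrightarrow> \<rho> x" "\<And>x. (\<lambda>n. grad (\<sigma> n) x) \<longlonglongrightarrow> g x" "\<And>x. (\<lambda>n. laplacian (\<sigma> n) x) \<longlonglongrightarrow> l x"
    and \<sigma>_le: "\<And>n x. \<bar>\<sigma> n x\<bar> \<le> R * \<rho> x" "\<And>n x. norm (grad (\<sigma> n) x) \<le> R * \<rho> x" "\<And>n x. \<bar>laplacian (\<sigma> n) x\<bar> \<le> R * \<rho> x"
begin

lemma R_nonneg: "R \<ge> 0"
  using order_trans[OF abs_ge_zero \<sigma>_le(1)[of 0 0]] \<rho>_pos[of 0] by (simp add: zero_le_mult_iff)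

lemma M_nonneg: "M \<ge> 0"
  using order_trans[OF abs_ge_zero bounded(1)] .

lemma gl_le: "norm (g x) \<le> R * \<rho> x" "\<bar>l x\<bar> \<le> R * \<rho> x"
  using LIMSEQ_le_const2[OF tendsto_norm[OF \<sigma>_lim(2)]] LIMSEQ_le_const2[OF tendsto_rabs[OF \<sigma>_lim(3)]] \<sigma>_le(2,3) by blast+

text \<open>This is \<open>w * laplacian \<psi> + V \<bullet> grad \<psi>\<close> for \<open>\<psi> x = \<rho> x * cos (\<xi> \<bullet> x - a)\<close>. The phases \<open>a = 0\<close> and
  \<open>a = pi / 2\<close> yield the cosine and sine modes.\<close>

definition flux :: "'a \<Rightarrow> real \<Rightarrow> real \<times> 'a \<Rightarrow> real" where
  "flux \<xi> a p = w p * (l (snd p) * cos (\<xi> \<bullet> snd p - a) - 2 * (g (snd p) \<bullet> \<xi>) * sin (\<xi> \<bullet> snd p - a)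
      - \<rho> (snd p) * (\<xi> \<bullet> \<xi>) * cos (\<xi> \<bullet> snd p - a))
    + V p \<bullet> (cos (\<xi> \<bullet> snd p - a) *\<^sub>R g (snd p) - (\<rho> (snd p) * sin (\<xi> \<bullet> snd p - a)) *\<^sub>R \<xi>)"

definition z_wt :: "real \<times> 'a \<Rightarrow> real" where "z_wt p = z p * \<rho> (snd p)"
definition w_wt :: "real \<times> 'a \<Rightarrow> real" where "w_wt p = w p * \<rho> (snd p)"
text \<open>The flux is sorted by its order in \<open>\<xi>\<close>. Up to signs and trigonometric
  factors, \<open>lower_order\<close> is the part of order zero, \<open>first_order i\<close> the
  coefficient of \<open>\<xi> \<bullet> i\<close>, with the factor 2 from the cross term in the
  Laplacian of a product, and \<open>w_wt\<close> the coefficient of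
  \<open>\<xi> \<bullet> \<xi>\<close>.\<close>

definition lower_order :: "real \<times> 'a \<Rightarrow> real" where "lower_order p = w p * l (snd p) + V p \<bullet> g (snd p)"
definition first_order :: "'a \<Rightarrow> real \<times> 'a \<Rightarrow> real" where
  "first_order i p = (2 * w p) * (g (snd p) \<bullet> i) + \<rho> (snd p) * (V p \<bullet> i)"

section \<open>Domination of the weighted quantities\<close>

lemma dominatedI:
  assumes "f \<in> borel_measurable borel" "K \<ge> 0" "\<And>t x. t \<in> {0<..<T} \<Longrightarrow> \<bar>f (t, x)\<bar> \<le> K * \<rho> x"
    "\<And>t x. t \<notin> {0<..<T} \<Longrightarrow> f (t, x) = 0"
  shows "dominated_by_weight K f"
  unfolding dominated_by_weight_def
proof (intro conjI allI)
  show "\<bar>f (t, x)\<bar> \<le> K * (indicator {0<..<T} t * \<rho> x)" for t x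
    using assms(3,4)[of t x] by (cases "t \<in> {0<..<T}") simp_all
qed (use assms in auto)

lemma comp_snd_measurable [measurable]:
  "f \<in> borel_measurable borel \<Longrightarrow> (\<lambda>p :: real \<times> 'a. f (snd p)) \<in> borel_measurable borel"
  by (rule measurable_compose[OF borel_measurable_continuous_onI[OF continuous_on_snd[OF continuous_on_id]]])

lemma comp_fst_measurable [measurable]:
  "f \<in> borel_measurable borel \<Longrightarrow> (\<lambda>p :: real \<times> 'a. f (fst p)) \<in> borel_measurable borel"
  by (rule measurable_compose[OF borel_measurable_continuous_onI[OF continuous_on_fst[OF continuous_on_id]]])

lemma z_wt_measurable [measurable]: "z_wt \<in> borel_measurable borel"
  and w_wt_measurable [measurable]: "w_wt \<in> borel_measurable borel"
  unfolding z_wt_def[abs_def] w_wt_def[abs_def] by measurable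

lemma flux_measurable [measurable]: "flux \<xi> a \<in> borel_measurable borel"
  unfolding flux_def[abs_def] by measurable

lemma z_wt_dominated: "dominated_by_weight M z_wt"
proof (rule dominatedI)
  show "\<bar>z_wt (t, x)\<bar> \<le> M * \<rho> x" for t x
    using mult_right_mono[OF bounded(1)[of "(t, x)"], of "\<rho> x"] \<rho>_pos[of x] by (simp add: z_wt_def abs_mult)
qed (auto simp: z_wt_def vanish M_nonneg)

lemma w_wt_dominated: "dominated_by_weight M w_wt"
proof (rule dominatedI)
  show "\<bar>w_wt (t, x)\<bar> \<le> M * \<rho> x" for t x
    using mult_right_mono[OF bounded(2)[of "(t, x)"], of "\<rho> x"] \<rho>_pos[of x] by (simp add: w_wt_def abs_mult)
qed (auto simp: w_wt_def vanish M_nonneg)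

text \<open>Derivatives of the weight cost only a factor \<open>R\<close>, and \<open>V\<close> is
  controlled by \<open>w\<close>. A bound in terms of \<open>w_wt\<close> is essential, since the
  dissipation controls \<open>w\<close> but not \<open>z\<close>; \<open>first_order\<close> is
  treated in the same way.\<close>

lemma abs_lower_order_le: "\<bar>lower_order p\<bar> \<le> (R * (1 + C)) * \<bar>w_wt p\<bar>"
proof -
  let ?r = "\<rho> (snd p)"
  have "\<bar>w p * l (snd p)\<bar> \<le> \<bar>w p\<bar> * (R * ?r)"
    unfolding abs_mult by (intro mult_left_mono gl_le) auto
  moreover have "\<bar>V p \<bullet> g (snd p)\<bar> \<le> (C * \<bar>w p\<bar>) * (R * ?r)"
    using order_trans[OF Cauchy_Schwarz_ineq2 mult_mono[OF V_le gl_le(1)]] C_pos by simp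
  ultimately have "\<bar>lower_order p\<bar> \<le> \<bar>w p\<bar> * (R * ?r) + (C * \<bar>w p\<bar>) * (R * ?r)"
    unfolding lower_order_def using abs_triangle_ineq[of "w p * l (snd p)" "V p \<bullet> g (snd p)"] by linarith
  then show ?thesis using \<rho>_pos[of "snd p"] by (simp add: w_wt_def abs_mult algebra_simps)
qed

lemma abs_first_order_le:
  assumes "i \<in> Basis"
  shows "\<bar>first_order i p\<bar> \<le> (2 * R + C) * \<bar>w_wt p\<bar>"
proof -
  let ?r = "\<rho> (snd p)"
  have "\<bar>(2 * w p) * (g (snd p) \<bullet> i)\<bar> \<le> (2 * \<bar>w p\<bar>) * (R * ?r)"
    unfolding abs_mult using order_trans[OF Basis_le_norm[OF assms] gl_le(1)] by (intro mult_mono) auto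
  moreover have "\<bar>?r * (V p \<bullet> i)\<bar> \<le> ?r * (C * \<bar>w p\<bar>)"
    unfolding abs_mult using order_trans[OF Basis_le_norm[OF assms] V_le] \<rho>_pos[of "snd p"]
      by (intro mult_mono) auto
  ultimately have "\<bar>first_order i p\<bar> \<le> (2 * \<bar>w p\<bar>) * (R * ?r) + ?r * (C * \<bar>w p\<bar>)"
    unfolding first_order_def using abs_triangle_ineq[of "(2 * w p) * (g (snd p) \<bullet> i)" "?r * (V p \<bullet> i)"]
      by linarith
  then show ?thesis using \<rho>_pos[of "snd p"] by (simp add: w_wt_def abs_mult algebra_simps)
qed

lemma lower_order_dominated: "dominated_by_weight (R * (1 + C) * M) lower_order"
proof (rule dominatedI)
  show "\<bar>lower_order (t, x)\<bar> \<le> R * (1 + C) * M * \<rho> x" for t x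
    using order_trans[OF abs_lower_order_le mult_left_mono[OF dominated_le_weight[OF w_wt_dominated]]] R_nonneg C_pos
    by (simp add: mult.assoc)
  show "lower_order \<in> borel_measurable borel" unfolding lower_order_def by measurable
qed (use R_nonneg C_pos M_nonneg in \<open>auto simp: lower_order_def vanish\<close>)

lemma first_order_dominated:
  assumes "i \<in> Basis"
  shows "dominated_by_weight ((2 * R + C) * M) (first_order i)"
proof (rule dominatedI)
  show "\<bar>first_order i (t, x)\<bar> \<le> (2 * R + C) * M * \<rho> x" for t x
    using order_trans[OF abs_first_order_le[OF assms] mult_left_mono[OF dominated_le_weight[OF w_wt_dominated]]] R_nonneg C_pos
    by (simp add: mult.assoc)
  show "first_order i \<in> borel_measurable borel" unfolding first_order_def by measurable
qed (use R_nonneg C_pos M_nonneg in \<open>auto simp: first_order_def vanish\<close>)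

lemma flux_eq: "flux \<xi> a p = lower_order p * cos (\<xi> \<bullet> snd p - a) - (\<xi> \<bullet> \<xi>) * (w_wt p * cos (\<xi> \<bullet> snd p - a))
    - (\<Sum>i\<in>Basis. (\<xi> \<bullet> i) * (first_order i p * sin (\<xi> \<bullet> snd p - a)))"
proof -
  have "(\<Sum>i\<in>Basis. (\<xi> \<bullet> i) * (first_order i p * sin (\<xi> \<bullet> snd p - a)))
    = (2 * w p) * sin (\<xi> \<bullet> snd p - a) * (\<Sum>i\<in>Basis. (g (snd p) \<bullet> i) * (\<xi> \<bullet> i))
      + \<rho> (snd p) * sin (\<xi> \<bullet> snd p - a) * (\<Sum>i\<in>Basis. (V p \<bullet> i) * (\<xi> \<bullet> i))"
    unfolding first_order_def sum_distrib_left sum.distrib[symmetric]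
      by (intro sum.cong refl) (simp add: algebra_simps)
  also have "\<dots> = (2 * w p) * sin (\<xi> \<bullet> snd p - a) * (g (snd p) \<bullet> \<xi>) + \<rho> (snd p) * sin (\<xi> \<bullet> snd p - a) * (V p \<bullet> \<xi>)"
    by (simp only: euclidean_inner[symmetric])
  finally show ?thesis
    by (simp add: flux_def lower_order_def w_wt_def inner_diff_right algebra_simps)
qed

lemma
  shows integrable_flux: "integrable lborel (\<lambda>x. flux \<xi> a (t, x))"
    and integral_flux: "(LBINT x. flux \<xi> a (t, x)) = (LBINT x. lower_order (t, x) * cos (\<xi> \<bullet> x - a))
      - (\<xi> \<bullet> \<xi>) * (LBINT x. w_wt (t, x) * cos (\<xi> \<bullet> x - a))
      - (\<Sum>i\<in>Basis. (\<xi> \<bullet> i) * (LBINT x. first_order i (t, x) * sin (\<xi> \<bullet> x - a)))"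
proof -
  have 1: "integrable lborel (\<lambda>x. lower_order (t, x) * cos (\<xi> \<bullet> x - a))"
    by (rule integrable_mult_bounded[OF dominated_slice_integrable[OF lower_order_dominated], where B = 1]) auto
  have 2: "integrable lborel (\<lambda>x. (\<xi> \<bullet> \<xi>) * (w_wt (t, x) * cos (\<xi> \<bullet> x - a)))"
    by (intro Bochner_Integration.integrable_mult_right impI integrable_mult_bounded[OF dominated_slice_integrable[OF w_wt_dominated], where B = 1]) auto
  have 3: "integrable lborel (\<lambda>x. (\<xi> \<bullet> i) * (first_order i (t, x) * sin (\<xi> \<bullet> x - a)))" if "i \<in> Basis" for i
    by (intro Bochner_Integration.integrable_mult_right impI integrable_mult_bounded[OF dominated_slice_integrable[OF first_order_dominated[OF that]], where B = 1]) auto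
  show "integrable lborel (\<lambda>x. flux \<xi> a (t, x))"
    unfolding flux_eq snd_conv using 1 2 3
    by (intro Bochner_Integration.integrable_diff Bochner_Integration.integrable_sum) auto
  have "(LBINT x. flux \<xi> a (t, x)) = (LBINT x. lower_order (t, x) * cos (\<xi> \<bullet> x - a))
      - (LBINT x. (\<xi> \<bullet> \<xi>) * (w_wt (t, x) * cos (\<xi> \<bullet> x - a)))
      - (\<Sum>i\<in>Basis. (LBINT x. (\<xi> \<bullet> i) * (first_order i (t, x) * sin (\<xi> \<bullet> x - a))))"
    unfolding flux_eq snd_conv
    by (subst Bochner_Integration.integral_diff, intro Bochner_Integration.integrable_diff 1 2, intro Bochner_Integration.integrable_sum 3, assumption,
        subst Bochner_Integration.integral_diff[OF 1 2], subst Bochner_Integration.integral_sum, rule 3, assumption, rule refl)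
  then show "(LBINT x. flux \<xi> a (t, x)) = (LBINT x. lower_order (t, x) * cos (\<xi> \<bullet> x - a))
      - (\<xi> \<bullet> \<xi>) * (LBINT x. w_wt (t, x) * cos (\<xi> \<bullet> x - a))
      - (\<Sum>i\<in>Basis. (\<xi> \<bullet> i) * (LBINT x. first_order i (t, x) * sin (\<xi> \<bullet> x - a)))"
    by simp
qed

text \<open>The modulated weight is not compactly supported, so the equation is tested with
  \<open>\<theta> t * \<sigma> n x * cos (\<xi> \<bullet> x - a)\<close> before \<open>n\<close>
  tends to infinity. For fixed \<open>\<xi>\<close> all integrands are dominated by a multiple of
  the weight on \<open>(0, T)\<close>.\<close>

lemma weak_modulated:
  assumes \<theta>: "\<theta> \<in> test_functions_on {..<T}"
  shows "(LBINT t. (LBINT x. z (t, x) * \<rho> x * cos (\<xi> \<bullet> x - a)) * deriv \<theta> t + (LBINT x. flux \<xi> a (t, x)) * \<theta> t) = 0"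
proof -
  define \<psi> where "\<psi> n x = \<sigma> n x * cos (\<xi> \<bullet> x - a)" for n x
  let ?c = "\<lambda>x. cos (\<xi> \<bullet> x - a)" and ?s = "\<lambda>x. sin (\<xi> \<bullet> x - a)"
  have \<psi>_test: "\<psi> n \<in> test_functions" for n unfolding \<psi>_def by (rule modulated_test_function[OF \<sigma>])
  have \<psi>_smooth: "smooth (\<psi> n)" for n using \<psi>_test[of n] by (auto simp: test_functions_on_def)
  have \<psi>_grad: "grad (\<psi> n) x = ?c x *\<^sub>R grad (\<sigma> n) x - (\<sigma> n x * ?s x) *\<^sub>R \<xi>" for n x
    unfolding \<psi>_def by (rule grad_modulated[OF \<sigma>])
  have \<psi>_lap: "laplacian (\<psi> n) x
    = laplacian (\<sigma> n) x * ?c x - 2 * (grad (\<sigma> n) x \<bullet> \<xi>) * ?s x - \<sigma> n x * (\<xi> \<bullet> \<xi>) * ?c x" for n x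
    unfolding \<psi>_def by (rule laplacian_modulated[OF \<sigma>])
  note [measurable] = smooth_grad_measurable[OF \<psi>_smooth]
  have sm: "smooth \<theta>" using \<theta> by (auto simp: test_functions_on_def)
  have [measurable]: "\<theta> \<in> borel_measurable borel" "deriv \<theta> \<in> borel_measurable borel"
    by (rule borel_measurable_continuous_onI[OF smooth_continuous_on[OF sm]],
        rule borel_measurable_continuous_onI[OF smooth_continuous_on[OF smooth_deriv[OF sm]]])
  obtain B where B: "B \<ge> 0" "\<And>t. t \<in> {0..T} \<Longrightarrow> \<bar>\<theta> t\<bar> \<le> B" "\<And>t. t \<in> {0..T} \<Longrightarrow> \<bar>deriv \<theta> t\<bar> \<le> B"
    using smooth_deriv_bounded[where a = 0 and b = T, OF sm] by blast
  define F where "F n p = deriv \<theta> (fst p) * (z p * \<psi> n (snd p)) + \<theta> (fst p) * (w p * laplacian (\<psi> n) (snd p)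
    + V p \<bullet> grad (\<psi> n) (snd p))" for n p
  define G where "G p = deriv \<theta> (fst p) * (z p * (\<rho> (snd p) * ?c (snd p))) + \<theta> (fst p) * flux \<xi> a p" for p
  let ?P = "lborel \<Otimes>\<^sub>M lborel :: (real \<times> 'a) measure"
  have F_zero: "(\<integral>p. F n p \<partial>?P) = 0" for n
  proof -
    let ?\<phi> = "\<lambda>(t, x). \<theta> t * \<psi> n x"
    have d: "deriv (\<lambda>s. \<theta> s * c) t = deriv \<theta> t * c" for c t
      using smooth_differentiable[OF sm, of t]
      by (intro DERIV_imp_deriv DERIV_cmult_right) (simp add: DERIV_deriv_iff_real_differentiable)
    have "F n p = z p * deriv (\<lambda>s. ?\<phi> (s, snd p)) (fst p) + w p * laplacian (\<lambda>y. ?\<phi> (fst p, y)) (snd p)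
        + V p \<bullet> grad (\<lambda>y. ?\<phi> (fst p, y)) (snd p)" for p
      by (simp add: F_def d laplacian_cmult[OF \<psi>_smooth] grad_cmult[OF \<psi>_smooth]) (simp add: algebra_simps)
    then show ?thesis
      using weak[OF tensor_test_function[OF \<theta> \<psi>_test[of n]]] by (simp add: lborel_prod)
  qed
  \<comment> \<open>The powers of \<open>\<xi>\<close> count the derivatives that fall on the
    modulation; they are harmless, as \<open>\<xi>\<close> is fixed in the limit.\<close>
  define K where "K = B * (M * R) + B * (M * (R + 2 * (R * norm \<xi>) + R * (\<xi> \<bullet> \<xi>)) + M * (R + R * norm \<xi>))"
  have F_bd: "norm (F n p) \<le> K * (indicator {0<..<T} (fst p) * \<rho> (snd p))" for n p
  proof (cases "fst p \<in> {0<..<T}")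
    case True
    let ?r = "\<rho> (snd p)"
    have r: "?r \<ge> 0" using \<rho>_pos[of "snd p"] by simp
    have \<sigma>1: "\<bar>\<sigma> n x * c\<bar> \<le> R * \<rho> x" if "\<bar>c\<bar> \<le> 1" for x c
      using mult_mono[OF \<sigma>_le(1)[of n x] that] R_nonneg \<rho>_pos[of x] by (simp add: abs_mult)
    have b\<psi>: "\<bar>\<psi> n (snd p)\<bar> \<le> R * ?r" unfolding \<psi>_def by (rule \<sigma>1) simp
    have bg: "norm (grad (\<psi> n) (snd p)) \<le> (R + R * norm \<xi>) * ?r"
    proof -
      have "norm (grad (\<psi> n) (snd p)) \<le> norm (?c (snd p) *\<^sub>R grad (\<sigma> n) (snd p))
        + norm ((\<sigma> n (snd p) * ?s (snd p)) *\<^sub>R \<xi>)"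
        unfolding \<psi>_grad by (rule norm_triangle_ineq4)
      also have "\<dots> = \<bar>?c (snd p)\<bar> * norm (grad (\<sigma> n) (snd p)) + \<bar>\<sigma> n (snd p) * ?s (snd p)\<bar> * norm \<xi>" by simp
      also have "\<dots> \<le> 1 * (R * ?r) + (R * ?r) * norm \<xi>"
        using \<sigma>_le(2)[of n "snd p"] \<sigma>1[of "?s (snd p)" "snd p"] by (intro add_mono mult_mono) auto
      finally show ?thesis by (simp add: algebra_simps)
    qed
    have bl: "\<bar>laplacian (\<psi> n) (snd p)\<bar> \<le> (R + 2 * (R * norm \<xi>) + R * (\<xi> \<bullet> \<xi>)) * ?r"
    proof -
      have "\<bar>laplacian (\<sigma> n) (snd p) * ?c (snd p)\<bar> \<le> (R * ?r) * 1"
        unfolding abs_mult using \<sigma>_le(3)[of n "snd p"] by (intro mult_mono) auto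
      moreover have "\<bar>2 * (grad (\<sigma> n) (snd p) \<bullet> \<xi>) * ?s (snd p)\<bar> \<le> 2 * (R * ?r * norm \<xi>) * 1"
      proof -
        have "\<bar>grad (\<sigma> n) (snd p) \<bullet> \<xi>\<bar> \<le> norm (grad (\<sigma> n) (snd p)) * norm \<xi>" by (rule Cauchy_Schwarz_ineq2)
        also have "\<dots> \<le> R * ?r * norm \<xi>" using \<sigma>_le(2)[of n "snd p"] by (intro mult_right_mono) auto
        finally have "\<bar>2 * (grad (\<sigma> n) (snd p) \<bullet> \<xi>)\<bar> \<le> 2 * (R * ?r * norm \<xi>)" by simp
        then show ?thesis unfolding abs_mult[of _ "?s (snd p)"]
          by (intro mult_mono) (auto intro: order_trans[OF abs_ge_zero])
      qed
      moreover have "\<bar>\<sigma> n (snd p) * (\<xi> \<bullet> \<xi>) * ?c (snd p)\<bar> \<le> (R * ?r) * (\<xi> \<bullet> \<xi>)"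
        using mult_right_mono[OF \<sigma>1[of "?c (snd p)" "snd p"], of "\<xi> \<bullet> \<xi>"] by (simp add: abs_mult mult_ac)
      ultimately show ?thesis unfolding \<psi>_lap by (simp add: algebra_simps)
    qed
    have bV: "\<bar>V p \<bullet> grad (\<psi> n) (snd p)\<bar> \<le> M * ((R + R * norm \<xi>) * ?r)"
      using order_trans[OF Cauchy_Schwarz_ineq2 mult_mono[OF bounded(3) bg M_nonneg]] by simp
    have bw: "\<bar>w p * laplacian (\<psi> n) (snd p)\<bar> \<le> M * ((R + 2 * (R * norm \<xi>) + R * (\<xi> \<bullet> \<xi>)) * ?r)"
      unfolding abs_mult by (intro mult_mono bounded bl M_nonneg) auto
    have bz: "\<bar>z p * \<psi> n (snd p)\<bar> \<le> M * (R * ?r)"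
      unfolding abs_mult by (intro mult_mono bounded b\<psi> M_nonneg) auto
    have t: "fst p \<in> {0..T}" using True by auto
    have "norm (F n p) \<le> \<bar>deriv \<theta> (fst p) * (z p * \<psi> n (snd p))\<bar> + \<bar>\<theta> (fst p) * (w p * laplacian (\<psi> n) (snd p)
      + V p \<bullet> grad (\<psi> n) (snd p))\<bar>"
      unfolding F_def real_norm_def by (rule abs_triangle_ineq)
    also have "\<dots> = \<bar>deriv \<theta> (fst p)\<bar> * \<bar>z p * \<psi> n (snd p)\<bar> + \<bar>\<theta> (fst p)\<bar> * \<bar>w p * laplacian (\<psi> n) (snd p)
      + V p \<bullet> grad (\<psi> n) (snd p)\<bar>"
      by (simp only: abs_mult)
    also have "\<dots> \<le> B * (M * (R * ?r)) + B * (M * ((R + 2 * (R * norm \<xi>) + R * (\<xi> \<bullet> \<xi>)) * ?r) + M * ((R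
      + R * norm \<xi>) * ?r))"
      using B(1) by (intro add_mono mult_mono B(2,3)[OF t] bz order_trans[OF abs_triangle_ineq] bw bV) auto
    also have "\<dots> = K * ?r" by (simp add: K_def algebra_simps)
    finally show ?thesis using True by simp
  next
    case False
    then show ?thesis using vanish[of "fst p" "snd p"] by (simp add: F_def)
  qed
  have F_borel: "F n \<in> borel_measurable borel" for n
    unfolding F_def[abs_def] by measurable
  have G_borel: "G \<in> borel_measurable borel"
    unfolding G_def[abs_def] by measurable
  have [measurable]: "F n \<in> borel_measurable ?P" "G \<in> borel_measurable ?P" for n
    using F_borel G_borel by (simp_all add: lborel_prod)
  have W: "integrable ?P (\<lambda>p. K * (indicator {0<..<T} (fst p) * \<rho> (snd p)))"
    using integrable_product_mult[OF _ \<rho>_int, of "indicator {0<..<T}"] T by simp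
  have F_lim: "(\<lambda>n. F n p) \<longlonglongrightarrow> G p" for p
    unfolding F_def G_def flux_def \<psi>_grad \<psi>_lap unfolding \<psi>_def
    by (intro tendsto_intros \<sigma>_lim)
  have "(\<lambda>n. \<integral>p. F n p \<partial>?P) \<longlonglongrightarrow> (\<integral>p. G p \<partial>?P)"
    by (rule integral_dominated_convergence[OF _ _ W]) (auto intro!: AE_I2 F_lim F_bd simp del: real_norm_def)
  then have "(\<integral>p. G p \<partial>?P) = 0" by (simp add: F_zero LIMSEQ_const_iff)
  moreover have "integrable ?P G"
    by (rule integrable_dominated_convergence[OF _ _ W]) (auto intro!: AE_I2 F_lim F_bd simp del: real_norm_def)
  ultimately have "(LBINT t. (LBINT x. G (t, x))) = 0"
    using lborel_pair.integral_fst'[of G] by simp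
  moreover have "(LBINT x. G (t, x)) = (LBINT x. z (t, x) * \<rho> x * ?c x) * deriv \<theta> t
    + (LBINT x. flux \<xi> a (t, x)) * \<theta> t" for t
  proof -
    have "integrable lborel (\<lambda>x. z_wt (t, x) * ?c x)"
      by (rule integrable_mult_bounded[OF dominated_slice_integrable[OF z_wt_dominated], where B = 1]) auto
    then have iz: "integrable lborel (\<lambda>x. z (t, x) * \<rho> x * ?c x)" by (simp add: z_wt_def)
    show ?thesis using iz integrable_flux[of \<xi> a t]
      by (simp add: G_def mult.commute[of _ "deriv \<theta> t"] mult.commute[of _ "\<theta> t"] mult.assoc)
  qed
  ultimately show ?thesis by simp
qed

end

section \<open>The energy estimate\<close>

text \<open>The term \<open>- k * w\<close> is split as \<open>- (1 + k) * w + w\<close>: the first part is the dissipation, everything else is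
  of lower order relative to \<open>1 + k\<close> and is absorbed by Young's inequality.\<close>

lemma mode_estimate:
  fixes z w g u H k :: real
  assumes k: "k \<ge> 0" and u: "u\<^sup>2 \<le> k * H" and d: "\<delta> > 0" and H: "H \<ge> 0"
  shows "z * (g - k * w - u) / (1 + k) \<le> - (z * w) + 3 * \<delta> * (w\<^sup>2 + g\<^sup>2 + H) + z\<^sup>2 / (1 + k) / (4 * \<delta>)"
proof -
  define X where "X = w + g - u"
  have N: "1 + k > 0" using k by simp
  have "X\<^sup>2 \<le> 3 * (w\<^sup>2 + g\<^sup>2 + u\<^sup>2)"
  proof -
    have "3 * (w\<^sup>2 + g\<^sup>2 + u\<^sup>2) - X\<^sup>2 = (w - g)\<^sup>2 + (w + u)\<^sup>2 + (g + u)\<^sup>2"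
      by (simp add: X_def power2_eq_square algebra_simps)
    also have "\<dots> \<ge> 0" by simp
    finally show ?thesis by simp
  qed
  \<comment> \<open>The first-order term \<open>u\<close> costs a factor \<open>k\<close>, which the
    denominator \<open>1 + k\<close> of the energy pays for.\<close>
  also have "\<dots> \<le> 3 * ((1 + k) * (w\<^sup>2 + g\<^sup>2 + H))"
  proof -
    have "0 \<le> k * w\<^sup>2" "0 \<le> k * g\<^sup>2" using k by simp_all
    then have "w\<^sup>2 + g\<^sup>2 + u\<^sup>2 \<le> (1 + k) * (w\<^sup>2 + g\<^sup>2 + H)" using u H by (simp add: algebra_simps)
    then show ?thesis by simp
  qed
  finally have X: "X\<^sup>2 \<le> 3 * ((1 + k) * (w\<^sup>2 + g\<^sup>2 + H))" .
  have "z * X \<le> z\<^sup>2 / (4 * \<delta>) + \<delta> * X\<^sup>2"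
  proof -
    have "0 \<le> (z - 2 * \<delta> * X)\<^sup>2" by simp
    then have "4 * \<delta> * (z * X) \<le> z\<^sup>2 + 4 * \<delta> * (\<delta> * X\<^sup>2)" by (simp add: power2_eq_square algebra_simps)
    then show ?thesis using d by (simp add: field_simps)
  qed
  also have "\<dots> \<le> z\<^sup>2 / (4 * \<delta>) + \<delta> * (3 * ((1 + k) * (w\<^sup>2 + g\<^sup>2 + H)))"
    using X d by simp
  finally have *: "z * X / (1 + k) \<le> (z\<^sup>2 / (4 * \<delta>) + \<delta> * (3 * ((1 + k) * (w\<^sup>2 + g\<^sup>2 + H)))) / (1 + k)"
    using N by (simp add: divide_right_mono)
  have "z * (g - k * w - u) / (1 + k) = - (z * w) + z * X / (1 + k)"
    using N by (simp add: X_def field_simps)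
  also have "\<dots> \<le> - (z * w) + (z\<^sup>2 / (4 * \<delta>) + \<delta> * (3 * ((1 + k) * (w\<^sup>2 + g\<^sup>2 + H)))) / (1 + k)"
    using * by simp
  also have "(z\<^sup>2 / (4 * \<delta>) + \<delta> * (3 * ((1 + k) * (w\<^sup>2 + g\<^sup>2 + H)))) / (1 + k)
      = z\<^sup>2 / (4 * \<delta>) / (1 + k) + (1 + k) * (3 * \<delta> * (w\<^sup>2 + g\<^sup>2 + H)) / (1 + k)"
    by (simp add: add_divide_distrib mult_ac)
  also have "(1 + k) * (3 * \<delta> * (w\<^sup>2 + g\<^sup>2 + H)) / (1 + k) = 3 * \<delta> * (w\<^sup>2 + g\<^sup>2 + H)"
    using N by (intro nonzero_mult_div_cancel_left) simp
  also have "z\<^sup>2 / (4 * \<delta>) / (1 + k) = z\<^sup>2 / (1 + k) / (4 * \<delta>)"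
    by (simp add: mult.commute)
  finally show ?thesis by simp
qed

text \<open>For a fixed frequency the modes and their time derivatives are of this kind, with bounds
  that may grow with the frequency. The class is closed under sums and products and consists of
  integrable functions, which settles integrability in time.\<close>

definition bounded_on_interval :: "real \<Rightarrow> (real \<Rightarrow> real) \<Rightarrow> bool" where
  "bounded_on_interval T f \<longleftrightarrow> f \<in> borel_measurable borel \<and> (\<exists>K. \<forall>t. \<bar>f t\<bar> \<le> K) \<and> (\<forall>t. t \<notin> {0<..<T} \<longrightarrow> f t = 0)"

lemma bounded_on_interval_add:
  assumes "bounded_on_interval T f" "bounded_on_interval T g"
  shows "bounded_on_interval T (\<lambda>t. f t + g t)"
proof -
  obtain K L where "\<And>t. \<bar>f t\<bar> \<le> K" "\<And>t. \<bar>g t\<bar> \<le> L" using assms unfolding bounded_on_interval_def by blast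
  then have "\<bar>f t + g t\<bar> \<le> K + L" for t by (rule order_trans[OF abs_triangle_ineq add_mono])
  then show ?thesis using assms unfolding bounded_on_interval_def by auto
qed

lemma bounded_on_interval_mult:
  assumes "bounded_on_interval T f" "bounded_on_interval T g"
  shows "bounded_on_interval T (\<lambda>t. f t * g t)"
proof -
  obtain K L where KL: "\<And>t. \<bar>f t\<bar> \<le> K" "\<And>t. \<bar>g t\<bar> \<le> L" using assms unfolding bounded_on_interval_def by blast
  have "\<bar>f t * g t\<bar> \<le> K * L" for t
    unfolding abs_mult using KL order_trans[OF abs_ge_zero KL(1)] by (intro mult_mono) auto
  then show ?thesis using assms unfolding bounded_on_interval_def by auto
qed

lemma bounded_on_interval_cmult:
  assumes "bounded_on_interval T f"
  shows "bounded_on_interval T (\<lambda>t. c * f t)"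
proof -
  obtain K where K: "\<And>t. \<bar>f t\<bar> \<le> K" using assms unfolding bounded_on_interval_def by blast
  then have "\<bar>c * f t\<bar> \<le> \<bar>c\<bar> * K" for t unfolding abs_mult by (intro mult_left_mono) auto
  then show ?thesis using assms unfolding bounded_on_interval_def by auto
qed

lemma bounded_on_interval_diff:
  assumes "bounded_on_interval T f" "bounded_on_interval T g" shows "bounded_on_interval T (\<lambda>t. f t - g t)"
  using bounded_on_interval_add[OF assms(1) bounded_on_interval_cmult[OF assms(2), of "-1"]] by simp

lemma bounded_on_interval_zero: "bounded_on_interval T (\<lambda>t. 0)"
  unfolding bounded_on_interval_def by auto

lemma bounded_on_interval_sum:
  "(\<And>i. i \<in> I \<Longrightarrow> bounded_on_interval T (f i)) \<Longrightarrow> bounded_on_interval T (\<lambda>t. \<Sum>i\<in>I. f i t)"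
  by (induction I rule: infinite_finite_induct) (auto intro: bounded_on_interval_add simp: bounded_on_interval_zero)

lemma bounded_on_interval_integrable: "bounded_on_interval T f \<Longrightarrow> integrable lborel f"
  unfolding bounded_on_interval_def using integrable_bounded_interval by blast

lemma bounded_on_interval_energy_weight: "l > 0 \<Longrightarrow> bounded_on_interval T (energy_weight l T)"
  unfolding bounded_on_interval_def using energy_weight_bounds(3)[of l T] by (auto simp: energy_weight_def)

definition decay_weight :: "real \<Rightarrow> real \<Rightarrow> real \<Rightarrow> real" where
  "decay_weight l T t = indicator {0<..<T} t * exp (- l * t)"

lemma decay_weight_bounds: "l > 0 \<Longrightarrow> 0 \<le> decay_weight l T t" "l > 0 \<Longrightarrow> \<bar>decay_weight l T t\<bar> \<le> 1"
  by (auto simp: decay_weight_def indicator_def)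

lemma decay_weight_measurable [measurable]: "decay_weight l T \<in> borel_measurable borel"
  unfolding decay_weight_def[abs_def] by measurable

lemma bounded_on_interval_decay_weight: "l > 0 \<Longrightarrow> bounded_on_interval T (decay_weight l T)"
  unfolding bounded_on_interval_def using decay_weight_bounds(2)[of l T] by (auto simp: decay_weight_def)

text \<open>The factor \<open>1 / l\<close> gained here is the Gronwall mechanism: a large decay
  rate makes the energy on the right a small multiple of the energy on the left.\<close>

lemma energy_weight_le: "l > 0 \<Longrightarrow> energy_weight l T t \<le> decay_weight l T t / l"
  using energy_weight_bounds(2)[of l T t] by (auto simp: energy_weight_def decay_weight_def indicator_def)

context linear_problem
begin

text \<open>Time derivatives of the cosine and sine modes of \<open>z_wt\<close>, that is, the
  integrals of \<open>flux\<close> at the phases 0 and \<open>pi / 2\<close>. The shift by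
  \<open>pi / 2\<close> turns the sine into minus the cosine, hence the sign in
  \<open>mode_rhs_S\<close>.\<close>

definition mode_rhs_C :: "real \<times> 'a \<Rightarrow> real" where
  "mode_rhs_C p = C_hat lower_order p - (snd p \<bullet> snd p) * C_hat w_wt p - (\<Sum>i\<in>Basis. (snd p \<bullet> i) * S_hat (first_order i) p)"
definition mode_rhs_S :: "real \<times> 'a \<Rightarrow> real" where
  "mode_rhs_S p = S_hat lower_order p - (snd p \<bullet> snd p) * S_hat w_wt p - (\<Sum>i\<in>Basis. (snd p \<bullet> i) * - C_hat (first_order i) p)"

lemma C_hat_bounded_on_interval: "dominated_by_weight K f \<Longrightarrow> bounded_on_interval T (\<lambda>t. C_hat f (t, \<xi>))"
  and S_hat_bounded_on_interval: "dominated_by_weight K f \<Longrightarrow> bounded_on_interval T (\<lambda>t. S_hat f (t, \<xi>))"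
proof -
  assume f: "dominated_by_weight K f"
  note [measurable] = dominated_measurable[OF f]
  have "(\<lambda>t. C_hat f (t, \<xi>)) \<in> borel_measurable borel" "(\<lambda>t. S_hat f (t, \<xi>)) \<in> borel_measurable borel"
    unfolding cos_transform_def sin_transform_def by measurable
  then show "bounded_on_interval T (\<lambda>t. C_hat f (t, \<xi>))" "bounded_on_interval T (\<lambda>t. S_hat f (t, \<xi>))"
    unfolding bounded_on_interval_def
    using C_hat_bound[OF f, of "(_, \<xi>)"] S_hat_bound[OF f, of "(_, \<xi>)"] C_hat_eq_0[OF f, of "(_, \<xi>)"] S_hat_eq_0[OF f, of "(_, \<xi>)"]
    by (auto intro!: exI[of _ "K * (LBINT x. \<rho> x)"])
qed

lemma mode_rhs_bounded: "bounded_on_interval T (\<lambda>t. mode_rhs_C (t, \<xi>))"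
  "bounded_on_interval T (\<lambda>t. mode_rhs_S (t, \<xi>))"
proof -
  have C: "mode_rhs_C (t, \<xi>)
    = C_hat lower_order (t, \<xi>) - (\<xi> \<bullet> \<xi>) * C_hat w_wt (t, \<xi>) - (\<Sum>i\<in>Basis. (\<xi> \<bullet> i) * S_hat (first_order i) (t, \<xi>))"
    and S: "mode_rhs_S (t, \<xi>)
      = S_hat lower_order (t, \<xi>) - (\<xi> \<bullet> \<xi>) * S_hat w_wt (t, \<xi>) - (\<Sum>i\<in>Basis. - (\<xi> \<bullet> i) * C_hat (first_order i) (t, \<xi>))" for t
    by (simp_all add: mode_rhs_C_def mode_rhs_S_def)
  note B = C_hat_bounded_on_interval S_hat_bounded_on_interval
  show "bounded_on_interval T (\<lambda>t. mode_rhs_C (t, \<xi>))" "bounded_on_interval T (\<lambda>t. mode_rhs_S (t, \<xi>))"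
    unfolding C S
    by (intro bounded_on_interval_diff bounded_on_interval_cmult bounded_on_interval_sum
        B[OF lower_order_dominated] B[OF w_wt_dominated] B[OF first_order_dominated]; assumption)+
qed

lemma mode_energy:
  assumes lam: "lam > 0"
    and m: "bounded_on_interval T m" "\<And>t. m t = (LBINT x. z_wt (t, x) * cos (\<xi> \<bullet> x - a))"
    and q: "bounded_on_interval T q" "\<And>t. q t = (LBINT x. flux \<xi> a (t, x))"
  shows "(LBINT t. decay_weight lam T t * (m t)\<^sup>2) = 2 * (LBINT t. energy_weight lam T t * (m t * q t))"
proof -
  obtain K L where KL: "\<And>t. \<bar>m t\<bar> \<le> K" "\<And>t. \<bar>q t\<bar> \<le> L"
    using m(1) q(1) unfolding bounded_on_interval_def by blast
  have m': "m \<in> borel_measurable borel" "\<And>t. \<bar>m t\<bar> \<le> max K L" "\<And>t. t \<notin> {0<..<T} \<Longrightarrow> m t = 0"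
    using m(1) KL unfolding bounded_on_interval_def by (auto simp: le_max_iff_disj)
  have q': "q \<in> borel_measurable borel" "\<And>t. \<bar>q t\<bar> \<le> max K L" "\<And>t. t \<notin> {0<..<T} \<Longrightarrow> q t = 0"
    using q(1) KL unfolding bounded_on_interval_def by (auto simp: le_max_iff_disj)
  have "(LBINT t. m t * deriv \<theta> t + q t * \<theta> t) = 0" if "\<theta> \<in> test_functions_on {..<T}" for \<theta>
    using weak_modulated[OF that, of \<xi> a] by (simp add: m(2) q(2) z_wt_def)
  then have "AE t in lborel. t \<in> {0<..<T} \<longrightarrow> m t = (LINT s:{..t}|lborel. q s)"
    using weak_derivative_imp_AE_eq_integral[OF T m' q'] by simp
  from energy_identity[OF lam m' q' this]
  have "(LBINT t. exp (- lam * t) * (m t)\<^sup>2) = 2 * (LBINT t. energy_weight lam T t * (m t * q t))" .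
  moreover have "(LBINT t. exp (- lam * t) * (m t)\<^sup>2) = (LBINT t. decay_weight lam T t * (m t)\<^sup>2)"
    using m'(3) by (intro Bochner_Integration.integral_cong) (auto simp: decay_weight_def indicator_def)
  ultimately show ?thesis by simp
qed

lemma mode_energy_CS:
  assumes lam: "lam > 0"
  shows "(LBINT t. decay_weight lam T t * (C_hat z_wt (t, \<xi>))\<^sup>2)
      = 2 * (LBINT t. energy_weight lam T t * (C_hat z_wt (t, \<xi>) * mode_rhs_C (t, \<xi>)))"
    and "(LBINT t. decay_weight lam T t * (S_hat z_wt (t, \<xi>))\<^sup>2)
      = 2 * (LBINT t. energy_weight lam T t * (S_hat z_wt (t, \<xi>) * mode_rhs_S (t, \<xi>)))"
proof -
  show "(LBINT t. decay_weight lam T t * (C_hat z_wt (t, \<xi>))\<^sup>2)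
      = 2 * (LBINT t. energy_weight lam T t * (C_hat z_wt (t, \<xi>) * mode_rhs_C (t, \<xi>)))"
    by (rule mode_energy[OF lam C_hat_bounded_on_interval[OF z_wt_dominated] _ mode_rhs_bounded(1), where a = 0])
      (simp_all add: cos_transform_def sin_transform_def mode_rhs_C_def integral_flux)
  have tr: "cos (y - pi / 2) = sin y" "sin (y - pi / 2) = - cos y" for y :: real
    by (simp_all add: cos_diff sin_diff)
  show "(LBINT t. decay_weight lam T t * (S_hat z_wt (t, \<xi>))\<^sup>2)
      = 2 * (LBINT t. energy_weight lam T t * (S_hat z_wt (t, \<xi>) * mode_rhs_S (t, \<xi>)))"
    by (rule mode_energy[OF lam S_hat_bounded_on_interval[OF z_wt_dominated] _ mode_rhs_bounded(2), where a
      = "pi / 2"])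
      (simp_all add: cos_transform_def sin_transform_def mode_rhs_S_def integral_flux tr)
qed

text \<open>No sign is available at a single frequency. Collected here are the terms whose integrals
  over all frequencies Plancherel converts into integrals over space; \<open>3 * \<delta>\<close>
  comes from \<open>mode_estimate\<close>.\<close>

definition dissipation :: "real \<Rightarrow> real \<times> 'a \<Rightarrow> real" where
  "dissipation \<delta> p = - (C_hat z_wt p * C_hat w_wt p + S_hat z_wt p * S_hat w_wt p)
    + 3 * \<delta> * (((C_hat w_wt p)\<^sup>2 + (S_hat w_wt p)\<^sup>2) + ((C_hat lower_order p)\<^sup>2 + (S_hat lower_order p)\<^sup>2)
       + (\<Sum>i\<in>Basis. (C_hat (first_order i) p)\<^sup>2 + (S_hat (first_order i) p)\<^sup>2))"

definition mode_energy_density :: "real \<times> 'a \<Rightarrow> real" where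
  "mode_energy_density p = ((C_hat z_wt p)\<^sup>2 + (S_hat z_wt p)\<^sup>2) / (1 + snd p \<bullet> snd p)"

text \<open>The sum over coordinates in each right-hand side plays the role of \<open>u\<close> in
  \<open>mode_estimate\<close>; by Cauchy-Schwarz its square is at most \<open>k * H\<close>, with
  \<open>H\<close> the sum of the squared transforms of \<open>first_order i\<close>.\<close>

lemma pointwise_mode_estimate:
  assumes "\<delta> > 0"
  shows "(C_hat z_wt p * mode_rhs_C p + S_hat z_wt p * mode_rhs_S p) / (1 + snd p \<bullet> snd p)
    \<le> dissipation \<delta> p + mode_energy_density p / (4 * \<delta>)"
proof -
  let ?k = "snd p \<bullet> snd p"
  have CS: "(\<Sum>i\<in>Basis. (snd p \<bullet> i) * s i)\<^sup>2 \<le> ?k * (\<Sum>i\<in>Basis. (s i)\<^sup>2)" for s :: "'a \<Rightarrow> real"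
    using Cauchy_Schwarz_ineq_sum[of "\<lambda>i. snd p \<bullet> i" s Basis]
    by (subst euclidean_inner) (simp add: power2_eq_square)
  have "C_hat z_wt p * mode_rhs_C p / (1 + ?k) \<le> - (C_hat z_wt p * C_hat w_wt p)
     + 3 * \<delta> * ((C_hat w_wt p)\<^sup>2 + (C_hat lower_order p)\<^sup>2 + (\<Sum>i\<in>Basis. (S_hat (first_order i) p)\<^sup>2))
       + (C_hat z_wt p)\<^sup>2 / (1 + ?k) / (4 * \<delta>)"
    unfolding mode_rhs_C_def by (rule mode_estimate[OF inner_ge_zero CS assms]) (simp add: sum_nonneg)
  moreover have "S_hat z_wt p * mode_rhs_S p / (1 + ?k) \<le> - (S_hat z_wt p * S_hat w_wt p)
     + 3 * \<delta> * ((S_hat w_wt p)\<^sup>2 + (S_hat lower_order p)\<^sup>2 + (\<Sum>i\<in>Basis. (- C_hat (first_order i) p)\<^sup>2))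
       + (S_hat z_wt p)\<^sup>2 / (1 + ?k) / (4 * \<delta>)"
    unfolding mode_rhs_S_def by (rule mode_estimate[OF inner_ge_zero CS assms]) (simp add: sum_nonneg)
  ultimately show ?thesis
    unfolding dissipation_def mode_energy_density_def add_divide_distrib sum.distrib distrib_left power2_minus
      by linarith
qed

lemma dissipation_integrable: "integrable (lborel \<Otimes>\<^sub>M lborel) (dissipation \<delta>)"
  unfolding dissipation_def[abs_def]
  by (intro Bochner_Integration.integrable_add Bochner_Integration.integrable_minus Bochner_Integration.integrable_mult_right
      Bochner_Integration.integrable_sum
      integrable_transform_mult_space_time[OF z_wt_dominated w_wt_dominated] integrable_transform_sq_space_time[OF w_wt_dominated]
      integrable_transform_sq_space_time[OF lower_order_dominated] integrable_transform_sq_space_time[OF first_order_dominated])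

lemma dissipation_bounded_on_interval: "bounded_on_interval T (\<lambda>t. dissipation \<delta> (t, \<xi>))"
proof -
  note C = C_hat_bounded_on_interval and S = S_hat_bounded_on_interval
  have *: "dissipation \<delta> (t, \<xi>) = - 1 * (C_hat z_wt (t, \<xi>) * C_hat w_wt (t, \<xi>)
    + S_hat z_wt (t, \<xi>) * S_hat w_wt (t, \<xi>))
    + 3 * \<delta> * (((C_hat w_wt (t, \<xi>) * C_hat w_wt (t, \<xi>)) + (S_hat w_wt (t, \<xi>) * S_hat w_wt (t, \<xi>)))
       + ((C_hat lower_order (t, \<xi>) * C_hat lower_order (t, \<xi>))
         + (S_hat lower_order (t, \<xi>) * S_hat lower_order (t, \<xi>)))
       + (\<Sum>i\<in>Basis. (C_hat (first_order i) (t, \<xi>) * C_hat (first_order i) (t, \<xi>))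
         + (S_hat (first_order i) (t, \<xi>) * S_hat (first_order i) (t, \<xi>))))" for t
    unfolding dissipation_def power2_eq_square by simp
  show ?thesis
    unfolding *
    by (intro bounded_on_interval_add bounded_on_interval_mult bounded_on_interval_cmult bounded_on_interval_sum
      C[OF z_wt_dominated] S[OF z_wt_dominated] C[OF w_wt_dominated] S[OF w_wt_dominated]
      C[OF lower_order_dominated] S[OF lower_order_dominated] C[OF first_order_dominated] S[OF first_order_dominated])
qed

lemma mode_energy_density_bounded_on_interval: "bounded_on_interval T (\<lambda>t. mode_energy_density (t, \<xi>))"
proof -
  note C = C_hat_bounded_on_interval and S = S_hat_bounded_on_interval
  have *: "mode_energy_density (t, \<xi>) = inverse (1 + \<xi> \<bullet> \<xi>) * (C_hat z_wt (t, \<xi>) * C_hat z_wt (t, \<xi>)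
    + S_hat z_wt (t, \<xi>) * S_hat z_wt (t, \<xi>))" for t
    unfolding mode_energy_density_def power2_eq_square by (simp add: divide_inverse mult.commute)
  show ?thesis
    unfolding *
    by (intro bounded_on_interval_add bounded_on_interval_mult bounded_on_interval_cmult C[OF z_wt_dominated] S[OF z_wt_dominated])
qed

lemma mode_energy_density_nonneg: "0 \<le> mode_energy_density p"
  by (simp add: mode_energy_density_def)

lemma mode_energy_density_integrable: "integrable (lborel \<Otimes>\<^sub>M lborel) mode_energy_density"
proof (rule Bochner_Integration.integrable_bound[OF integrable_transform_sq_space_time[OF z_wt_dominated]])
  show "mode_energy_density \<in> borel_measurable (lborel \<Otimes>\<^sub>M lborel)"
    unfolding mode_energy_density_def[abs_def] by measurable
  show "AE p in lborel \<Otimes>\<^sub>M lborel. norm (mode_energy_density p) \<le> norm ((C_hat z_wt p)\<^sup>2 + (S_hat z_wt p)\<^sup>2)"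
  proof (intro AE_I2)
    fix p :: "real \<times> 'a"
    have "((C_hat z_wt p)\<^sup>2 + (S_hat z_wt p)\<^sup>2) / (1 + snd p \<bullet> snd p) \<le> ((C_hat z_wt p)\<^sup>2 + (S_hat z_wt p)\<^sup>2) / 1"
      by (intro divide_left_mono) (auto simp: add_pos_nonneg)
    then show "norm (mode_energy_density p) \<le> norm ((C_hat z_wt p)\<^sup>2 + (S_hat z_wt p)\<^sup>2)"
      using mode_energy_density_nonneg[of p] by (simp add: mode_energy_density_def)
  qed
qed

text \<open>With \<open>lam = 1 / \<delta>\<close> the weight gains a factor \<open>\<delta>\<close>
  against \<open>1 / (4 * \<delta>)\<close>, so after the factor 2 of the energy identity half of
  the energy stands on the right. Moving it to the left doubles the remaining factor 2 to 4.\<close>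

lemma fixed_mode_inequality:
  assumes d: "\<delta> > 0"
  defines "lam \<equiv> 1 / \<delta>"
  shows "(LBINT t. decay_weight lam T t * mode_energy_density (t, \<xi>))
    \<le> 4 * (LBINT t. energy_weight lam T t * dissipation \<delta> (t, \<xi>))"
proof -
  have lam: "lam > 0" using d by (simp add: lam_def)
  let ?e = "decay_weight lam T" and ?k = "energy_weight lam T"
  let ?N = "1 + \<xi> \<bullet> \<xi>"
  note ke = bounded_on_interval_energy_weight[OF lam] bounded_on_interval_decay_weight[OF lam]
  note C = C_hat_bounded_on_interval[OF z_wt_dominated] and S = S_hat_bounded_on_interval[OF z_wt_dominated]
  note int = bounded_on_interval_integrable[where T = T]
  note mult = bounded_on_interval_mult
  have i1: "integrable lborel (\<lambda>t. ?e t * (C_hat z_wt (t, \<xi>))\<^sup>2)"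
    "integrable lborel (\<lambda>t. ?e t * (S_hat z_wt (t, \<xi>))\<^sup>2)"
    unfolding power2_eq_square by (intro int mult ke C S)+
  have i2: "integrable lborel (\<lambda>t. ?k t * (C_hat z_wt (t, \<xi>) * mode_rhs_C (t, \<xi>)))"
    "integrable lborel (\<lambda>t. ?k t * (S_hat z_wt (t, \<xi>) * mode_rhs_S (t, \<xi>)))"
    by (intro int mult ke C S mode_rhs_bounded)+
  have i3: "integrable lborel (\<lambda>t. ?k t * dissipation \<delta> (t, \<xi>))"
    "integrable lborel (\<lambda>t. ?e t * mode_energy_density (t, \<xi>))"
    by (intro int mult ke dissipation_bounded_on_interval mode_energy_density_bounded_on_interval)+
  have "(LBINT t. ?e t * mode_energy_density (t, \<xi>))
      = (LBINT t. (?e t * (C_hat z_wt (t, \<xi>))\<^sup>2 + ?e t * (S_hat z_wt (t, \<xi>))\<^sup>2) / ?N)"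
    by (simp add: mode_energy_density_def algebra_simps)
  also have "\<dots> = ((LBINT t. ?e t * (C_hat z_wt (t, \<xi>))\<^sup>2) + (LBINT t. ?e t * (S_hat z_wt (t, \<xi>))\<^sup>2)) / ?N"
    using i1 by simp
  also have "\<dots> = 2 * ((LBINT t. ?k t * (C_hat z_wt (t, \<xi>) * mode_rhs_C (t, \<xi>)))
    + (LBINT t. ?k t * (S_hat z_wt (t, \<xi>) * mode_rhs_S (t, \<xi>)))) / ?N"
    unfolding mode_energy_CS[OF lam] by (simp add: algebra_simps)
  also have "\<dots> = (LBINT t. 2 * ((?k t * (C_hat z_wt (t, \<xi>) * mode_rhs_C (t, \<xi>))
    + ?k t * (S_hat z_wt (t, \<xi>) * mode_rhs_S (t, \<xi>))) / ?N))"
    using i2 by simp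
  also have "\<dots> \<le> (LBINT t. 2 * (?k t * dissipation \<delta> (t, \<xi>)) + (1 / 2) * (?e t * mode_energy_density (t, \<xi>)))"
  proof (rule integral_mono)
    show "integrable lborel (\<lambda>t. 2 * ((?k t * (C_hat z_wt (t, \<xi>) * mode_rhs_C (t, \<xi>))
      + ?k t * (S_hat z_wt (t, \<xi>) * mode_rhs_S (t, \<xi>))) / ?N))"
      using i2 by simp
    show "integrable lborel (\<lambda>t. 2 * (?k t * dissipation \<delta> (t, \<xi>))
      + (1 / 2) * (?e t * mode_energy_density (t, \<xi>)))"
      using i3 by simp
    fix t
    have k0: "0 \<le> ?k t" by (rule energy_weight_bounds(1)[OF lam])
    have "?k t * mode_energy_density (t, \<xi>) \<le> (?e t / lam) * mode_energy_density (t, \<xi>)"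
      by (rule mult_right_mono[OF energy_weight_le[OF lam] mode_energy_density_nonneg])
    then have ke_le: "?k t * (mode_energy_density (t, \<xi>) / (4 * \<delta>))
      \<le> (1 / 4) * (?e t * mode_energy_density (t, \<xi>))"
      using d by (simp add: lam_def field_simps)
    have "(?k t * (C_hat z_wt (t, \<xi>) * mode_rhs_C (t, \<xi>)) + ?k t * (S_hat z_wt (t, \<xi>) * mode_rhs_S (t, \<xi>))) / ?N
      = ?k t * ((C_hat z_wt (t, \<xi>) * mode_rhs_C (t, \<xi>) + S_hat z_wt (t, \<xi>) * mode_rhs_S (t, \<xi>)) / (1
        + snd (t, \<xi>) \<bullet> snd (t, \<xi>)))"
      by (simp add: distrib_left)
    also have "\<dots> \<le> ?k t * (dissipation \<delta> (t, \<xi>) + mode_energy_density (t, \<xi>) / (4 * \<delta>))"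
      by (rule mult_left_mono[OF pointwise_mode_estimate[OF d] k0])
    also have "\<dots> \<le> ?k t * dissipation \<delta> (t, \<xi>) + (1 / 4) * (?e t * mode_energy_density (t, \<xi>))"
      using ke_le by (simp add: distrib_left)
    finally show "2 * ((?k t * (C_hat z_wt (t, \<xi>) * mode_rhs_C (t, \<xi>))
      + ?k t * (S_hat z_wt (t, \<xi>) * mode_rhs_S (t, \<xi>))) / ?N)
      \<le> 2 * (?k t * dissipation \<delta> (t, \<xi>)) + (1 / 2) * (?e t * mode_energy_density (t, \<xi>))" by linarith
  qed
  also have "\<dots> = 2 * (LBINT t. ?k t * dissipation \<delta> (t, \<xi>))
    + (1 / 2) * (LBINT t. ?e t * mode_energy_density (t, \<xi>))"
    using i3 by simp
  finally show ?thesis by simp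
qed

text \<open>At a fixed time Plancherel turns the integral into one over space, whose integrand is
  nonpositive pointwise: the quadratic terms add up to at most \<open>L\<close> times the square of
  \<open>w_wt\<close>, hence to at most \<open>L * C * z_wt * w_wt\<close>.\<close>

lemma integral_dissipation_nonpos:
  obtains \<delta> where "\<delta> > 0" "\<And>t. (LBINT \<xi>. dissipation \<delta> (t, \<xi>)) \<le> 0"
proof -
  \<comment> \<open>The summands bound the squares of \<open>w_wt\<close>, of
    \<open>lower_order\<close> and of the \<open>DIM('a)\<close> functions
    \<open>first_order i\<close>, relative to the square of \<open>w_wt\<close>. The next line is
    chosen so that \<open>3 * \<delta> * L * C = 1\<close>.\<close>
  define L where "L = 1 + (R * (1 + C))\<^sup>2 + DIM('a) * (2 * R + C)\<^sup>2"
  define \<delta> where "\<delta> = 1 / (3 * (L * C))"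
  have L: "L > 0" unfolding L_def by (intro add_pos_nonneg) auto
  then have d: "\<delta> > 0" using C_pos by (simp add: \<delta>_def)
  have wz: "(w_wt p)\<^sup>2 \<le> C * (z_wt p * w_wt p)" for p
    using mult_right_mono[OF w_sq_le[of p], of "(\<rho> (snd p))\<^sup>2"]
      by (simp add: w_wt_def z_wt_def power_mult_distrib power2_eq_square mult_ac)
  show thesis
  proof (rule that[OF d])
    fix t
    note i_zw = integrable_slice_mult[OF z_wt_dominated w_wt_dominated, of t]
      and i_ww = integrable_slice_mult[OF w_wt_dominated w_wt_dominated, of t]
      and i_ll = integrable_slice_mult[OF lower_order_dominated lower_order_dominated, of t]
      and i_ff = integrable_slice_mult[OF first_order_dominated first_order_dominated, of _ _ t]
    note p = plancherel_slice[of _ _ _ _ t] and ip = integrable_plancherel_slice[of _ _ _ _ t]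
    note p_zw = p[OF z_wt_dominated w_wt_dominated] and ip_zw = ip[OF z_wt_dominated w_wt_dominated]
      and p_ww = p[OF w_wt_dominated w_wt_dominated] and ip_ww = ip[OF w_wt_dominated w_wt_dominated]
      and p_ll = p[OF lower_order_dominated lower_order_dominated] and ip_ll
        = ip[OF lower_order_dominated lower_order_dominated]
      and p_ff = p[OF first_order_dominated first_order_dominated] and ip_ff
        = ip[OF first_order_dominated first_order_dominated]
    let ?c = "(2 * pi) ^ DIM('a)"
    have "(LBINT \<xi>. dissipation \<delta> (t, \<xi>))
      = - (?c * (LBINT x. z_wt (t, x) * w_wt (t, x))) + 3 * \<delta> * (?c * (LBINT x. w_wt (t, x) * w_wt (t, x))
         + ?c * (LBINT x. lower_order (t, x) * lower_order (t, x))
           + (\<Sum>i\<in>Basis. ?c * (LBINT x. first_order i (t, x) * first_order i (t, x))))"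
    proof -
      have i_s: "integrable lborel (\<lambda>\<xi>. \<Sum>i\<in>Basis. C_hat (first_order i) (t, \<xi>) * C_hat (first_order i) (t, \<xi>)
        + S_hat (first_order i) (t, \<xi>) * S_hat (first_order i) (t, \<xi>))"
        by (intro Bochner_Integration.integrable_sum ip_ff)
      have sum: "(LBINT \<xi>. (\<Sum>i\<in>Basis. C_hat (first_order i) (t, \<xi>) * C_hat (first_order i) (t, \<xi>)
        + S_hat (first_order i) (t, \<xi>) * S_hat (first_order i) (t, \<xi>)))
        = (\<Sum>i\<in>Basis. ?c * (LBINT x. first_order i (t, x) * first_order i (t, x)))"
        by (subst Bochner_Integration.integral_sum, rule ip_ff, assumption, assumption, intro sum.cong refl p_ff)
      show ?thesis
        unfolding dissipation_def power2_eq_square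
        using p_zw p_ww p_ll sum ip_zw ip_ww ip_ll i_s
        by (simp only: Bochner_Integration.integral_add Bochner_Integration.integrable_add Bochner_Integration.integrable_minus
            Bochner_Integration.integrable_mult_right integral_minus integral_mult_right_zero simp_thms)
    qed
    also have "\<dots> = ?c * (LBINT x. - (z_wt (t, x) * w_wt (t, x)) + 3 * \<delta> * (w_wt (t, x) * w_wt (t, x)
      + lower_order (t, x) * lower_order (t, x)
         + (\<Sum>i\<in>Basis. first_order i (t, x) * first_order i (t, x))))"
      using i_zw i_ww i_ll i_ff
      by (simp add: Bochner_Integration.integral_sum sum_distrib_left distrib_left algebra_simps)
    also have "\<dots> \<le> 0"
    proof (rule mult_nonneg_nonpos)
      have "- (z_wt p * w_wt p) + 3 * \<delta> * (w_wt p * w_wt p + lower_order p * lower_order p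
        + (\<Sum>i\<in>Basis. first_order i p * first_order i p)) \<le> 0" for p
      proof -
        have lo: "lower_order p * lower_order p \<le> (R * (1 + C))\<^sup>2 * (w_wt p)\<^sup>2"
          using power_mono[OF abs_lower_order_le[of p], of 2]
            by (simp add: power_mult_distrib power2_eq_square[of "lower_order p"])
        have "first_order i p * first_order i p \<le> (2 * R + C)\<^sup>2 * (w_wt p)\<^sup>2" if "i \<in> Basis" for i
          using power_mono[OF abs_first_order_le[OF that, of p], of 2]
            by (simp add: power_mult_distrib power2_eq_square[of "first_order i p"])
        then have fo: "(\<Sum>i\<in>(Basis::'a set). first_order i p * first_order i p) \<le> DIM('a) * ((2 * R
          + C)\<^sup>2 * (w_wt p)\<^sup>2)"
          by (rule sum_bounded_above)
        have "w_wt p * w_wt p + lower_order p * lower_order p + (\<Sum>i\<in>Basis. first_order i p * first_order i p)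
          \<le> L * (w_wt p)\<^sup>2"
          using lo fo by (simp add: L_def algebra_simps power2_eq_square)
        also have "\<dots> \<le> L * (C * (z_wt p * w_wt p))" using wz[of p] L by (intro mult_left_mono) auto
        finally have "3 * \<delta> * (w_wt p * w_wt p + lower_order p * lower_order p
          + (\<Sum>i\<in>Basis. first_order i p * first_order i p)) \<le> 3 * \<delta> * (L * (C * (z_wt p * w_wt p)))"
          using d by (intro mult_left_mono) auto
        also have "\<dots> = z_wt p * w_wt p" using L C_pos by (simp add: \<delta>_def)
        finally show ?thesis by simp
      qed
      then have "0 \<le> (LBINT x. - (- (z_wt (t, x) * w_wt (t, x)) + 3 * \<delta> * (w_wt (t, x) * w_wt (t, x)
        + lower_order (t, x) * lower_order (t, x)
         + (\<Sum>i\<in>Basis. first_order i (t, x) * first_order i (t, x)))))"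
        by (intro integral_nonneg_AE AE_I2) (simp only: neg_0_le_iff_le)
      then show "(LBINT x. - (z_wt (t, x) * w_wt (t, x)) + 3 * \<delta> * (w_wt (t, x) * w_wt (t, x)
        + lower_order (t, x) * lower_order (t, x)
         + (\<Sum>i\<in>Basis. first_order i (t, x) * first_order i (t, x)))) \<le> 0"
        by (simp only: integral_minus neg_0_le_iff_le)
    qed simp
    finally show "(LBINT \<xi>. dissipation \<delta> (t, \<xi>)) \<le> 0" .
  qed
qed

lemma z_wt_integrable_sq: "integrable (lborel \<Otimes>\<^sub>M lborel) (\<lambda>p. (z_wt p)\<^sup>2)"
proof (rule Bochner_Integration.integrable_bound)
  show "integrable (lborel \<Otimes>\<^sub>M lborel) (\<lambda>p. M\<^sup>2 * (indicator {0<..<T} (fst p) * \<rho> (snd p)))"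
    using integrable_product_mult[OF _ \<rho>_int, of "indicator {0<..<T}"] T by simp
  show "(\<lambda>p. (z_wt p)\<^sup>2) \<in> borel_measurable (lborel \<Otimes>\<^sub>M lborel)"
    by (simp add: lborel_prod)
  show "AE p in lborel \<Otimes>\<^sub>M lborel. norm ((z_wt p)\<^sup>2) \<le> norm (M\<^sup>2 * (indicator {0<..<T} (fst p) * \<rho> (snd p)))"
  proof (intro AE_I2)
    fix p :: "real \<times> 'a"
    obtain t x where p: "p = (t, x)" by (cases p)
    show "norm ((z_wt p)\<^sup>2) \<le> norm (M\<^sup>2 * (indicator {0<..<T} (fst p) * \<rho> (snd p)))"
    proof (cases "t \<in> {0<..<T}")
      case True
      have "(z_wt p)\<^sup>2 = \<bar>z_wt p\<bar> * \<bar>z_wt p\<bar>" by (simp add: power2_eq_square)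
      also have "\<dots> \<le> M * (M * \<rho> x)"
        unfolding p using M_nonneg
          by (intro mult_mono dominated_le[OF z_wt_dominated] dominated_le_weight[OF z_wt_dominated]) auto
      finally show ?thesis using True \<rho>_pos[of x] by (simp add: p power2_eq_square abs_mult)
    qed (simp add: p dominated_eq_0[OF z_wt_dominated])
  qed
qed

lemma z_eq_0: "AE p in lborel. z p = 0"
proof -
  let ?P = "lborel \<Otimes>\<^sub>M lborel :: (real \<times> 'a) measure"
  obtain \<delta> where d: "\<delta> > 0" and diss: "\<And>t. (LBINT \<xi>. dissipation \<delta> (t, \<xi>)) \<le> 0"
    using integral_dissipation_nonpos by blast
  define lam where "lam = 1 / \<delta>"
  have lam: "lam > 0" using d by (simp add: lam_def)
  let ?e = "decay_weight lam T" and ?k = "energy_weight lam T"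
  define E where "E p = ?e (fst p) * mode_energy_density p" for p
  define A where "A p = ?k (fst p) * dissipation \<delta> p" for p
  have E_nonneg: "0 \<le> E p" for p
    unfolding E_def by (intro mult_nonneg_nonneg decay_weight_bounds[OF lam] mode_energy_density_nonneg)
  have Ei: "integrable ?P E"
    using integrable_mult_bounded[OF mode_energy_density_integrable, of "\<lambda>p. ?e (fst p)" 1] decay_weight_bounds(2)[OF lam]
    by (simp add: E_def[abs_def] mult.commute)
  have Ai: "integrable ?P A"
    using integrable_mult_bounded[OF dissipation_integrable, of "\<lambda>p. ?k (fst p)"
      "1 / lam"] energy_weight_bounds(3)[OF lam]
    by (simp add: A_def[abs_def] mult.commute)
  have "(\<integral>p. E p \<partial>?P) = (LBINT \<xi>. (LBINT t. E (t, \<xi>)))"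
    using lborel_pair.integral_snd[of "\<lambda>t \<xi>. E (t, \<xi>)"] Ei by simp
  also have "\<dots> \<le> (LBINT \<xi>. 4 * (LBINT t. A (t, \<xi>)))"
  proof (rule integral_mono)
    show "integrable lborel (\<lambda>\<xi>. LBINT t. E (t, \<xi>))"
      using lborel_pair.integrable_snd[of "\<lambda>t \<xi>. E (t, \<xi>)"] Ei by simp
    show "integrable lborel (\<lambda>\<xi>. 4 * (LBINT t. A (t, \<xi>)))"
      using lborel_pair.integrable_snd[of "\<lambda>t \<xi>. A (t, \<xi>)"] Ai by simp
    show "(LBINT t. E (t, \<xi>)) \<le> 4 * (LBINT t. A (t, \<xi>))" for \<xi>
      using fixed_mode_inequality[OF d, of \<xi>] by (simp add: E_def A_def lam_def)
  qed
  \<comment> \<open>After the exchange the inner integral runs over all frequencies at one time,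
    where the sign is known.\<close>
  also have "\<dots> = 4 * (LBINT t. (LBINT \<xi>. A (t, \<xi>)))"
    using lborel_pair.Fubini_integral[of "\<lambda>t \<xi>. A (t, \<xi>)"] Ai by simp
  also have "\<dots> \<le> 0"
  proof -
    have "0 \<le> (LBINT t. - (LBINT \<xi>. A (t, \<xi>)))"
      using diss energy_weight_bounds(1)[OF lam]
        by (intro integral_nonneg_AE AE_I2) (simp add: A_def mult_nonneg_nonpos)
    then show ?thesis by simp
  qed
  finally have "(\<integral>p. E p \<partial>?P) = 0"
    using E_nonneg by (intro antisym integral_nonneg_AE) auto
  then have "AE p in ?P. E p = 0"
    using integral_nonneg_eq_0_iff_AE[OF Ei] E_nonneg by simp
  \<comment> \<open>For times in \<open>(0, T)\<close> the decay weight is positive and can be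
    divided out; at other times it carries no information, but the transforms vanish there.\<close>
  then have "AE p in ?P. (C_hat z_wt p)\<^sup>2 + (S_hat z_wt p)\<^sup>2 = 0"
  proof eventually_elim
    case (elim p)
    have N: "1 + snd p \<bullet> snd p \<noteq> 0" using inner_ge_zero[of "snd p"] by linarith
    show ?case
    proof (cases "fst p \<in> {0<..<T}")
      case True
      with elim N show ?thesis by (simp add: E_def decay_weight_def mode_energy_density_def)
    qed (simp add: C_hat_eq_0[OF z_wt_dominated, simplified] S_hat_eq_0[OF z_wt_dominated, simplified])
  qed
  then have "(\<integral>p. (C_hat z_wt p)\<^sup>2 + (S_hat z_wt p)\<^sup>2 \<partial>?P) = 0"
    by (subst integral_cong_AE[where g = "\<lambda>_. 0"]) auto
  \<comment> \<open>Plancherel at each time carries the vanishing back to \<open>z_wt\<close>;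
    positivity of the weight then gives it for \<open>z\<close>.\<close>
  then have "(LBINT t. (LBINT \<xi>. (C_hat z_wt (t, \<xi>))\<^sup>2 + (S_hat z_wt (t, \<xi>))\<^sup>2)) = 0"
    using lborel_pair.integral_fst'[OF integrable_transform_sq_space_time[OF z_wt_dominated]] by simp
  then have "(LBINT t. (LBINT x. (z_wt (t, x))\<^sup>2)) = 0"
    using plancherel_slice[OF z_wt_dominated z_wt_dominated] by (simp add: power2_eq_square)
  then have "(\<integral>p. (z_wt p)\<^sup>2 \<partial>?P) = 0"
    using lborel_pair.integral_fst'[OF z_wt_integrable_sq] by simp
  then have "AE p in ?P. (z_wt p)\<^sup>2 = 0"
    using integral_nonneg_eq_0_iff_AE[OF z_wt_integrable_sq] by simp
  then have "AE p in ?P. z p = 0"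
    by eventually_elim (use \<rho>_pos in \<open>auto simp: z_wt_def less_le\<close>)
  then show ?thesis unfolding lborel_prod .
qed

end

section \<open>Borel representatives and structural inequalities\<close>

lemma AE_lebesgue_on_iff:
  "S \<in> sets borel \<Longrightarrow> (AE x in lebesgue_on S. P x) \<longleftrightarrow> (AE x in lborel. x \<in> S \<longrightarrow> P x)"
  by (subst AE_restrict_space_iff) (auto simp: AE_completion_iff)

text \<open>Elements of \<open>Linfty_on\<close> are Lebesgue measurable and bounded almost
  everywhere on \<open>S\<close>, while the linear problem is formulated with Borel functions and
  pointwise bounds. A Borel version is clamped to make the bound hold everywhere.\<close>

lemma Linfty_on_borel_representative:
  fixes f :: "'a::euclidean_space \<Rightarrow> real"
  assumes f: "f \<in> Linfty_on S" and S: "S \<in> sets borel"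
  obtains f' M where "f' \<in> borel_measurable borel" "M \<ge> 0" "\<And>x. \<bar>f' x\<bar> \<le> M" "AE x in lborel. x \<in> S \<longrightarrow> f x = f' x"
proof -
  obtain C where C: "AE x in lebesgue_on S. norm (f x) \<le> C" using f by (auto simp: Linfty_on_def)
  have "(\<lambda>x. indicator S x *\<^sub>R f x) \<in> borel_measurable lebesgue"
    using f S by (subst borel_measurable_restrict_space_iff[symmetric]) (auto simp: Linfty_on_def)
  from completion_ex_borel_measurable_real[OF this[unfolded real_scaleR_def]]
  obtain g where [measurable]: "g \<in> borel_measurable lborel" and g: "AE x in lborel. indicator S x * f x = g x"
    by blast
  \<comment> \<open>A negative \<open>C\<close> is possible if \<open>S\<close> is a null
    set.\<close>
  define M where "M = max C 0"
  show thesis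
  proof (rule that[of "\<lambda>x. max (- M) (min M (g x))" M])
    show "AE x in lborel. x \<in> S \<longrightarrow> f x = max (- M) (min M (g x))"
      using g C[unfolded AE_lebesgue_on_iff[OF S]]
      by eventually_elim (auto simp: M_def)
  qed (auto simp: M_def)
qed

lemma Linfty_UNIV_vector_borel_representative:
  fixes D :: "'a::euclidean_space \<Rightarrow> 'b::euclidean_space"
  assumes D: "D \<in> Linfty_on UNIV"
  obtains D' M where "D' \<in> borel_measurable borel" "M \<ge> 0" "\<And>x. norm (D' x) \<le> M" "AE x in lborel. D x = D' x"
proof -
  have *: "\<forall>i\<in>Basis. \<exists>f' M. f' \<in> borel_measurable borel \<and> M \<ge> 0 \<and> (\<forall>x. \<bar>f' x\<bar> \<le> M) \<and> (AE x in lborel. D x \<bullet> i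
    = f' x)"
  proof
    fix i :: 'b assume i: "i \<in> Basis"
    have "(\<lambda>x. D x \<bullet> i) \<in> Linfty_on UNIV"
    proof -
      have [measurable]: "D \<in> borel_measurable (lebesgue_on UNIV)" using D by (simp add: Linfty_on_def)
      obtain C where "AE x in lebesgue_on UNIV. norm (D x) \<le> C" using D by (auto simp: Linfty_on_def)
      then have "AE x in lebesgue_on UNIV. norm (D x \<bullet> i) \<le> C"
        by eventually_elim (use Basis_le_norm[OF i] in \<open>auto intro: order_trans\<close>)
      then show ?thesis unfolding Linfty_on_def by auto
    qed
    then show "\<exists>f' M. f' \<in> borel_measurable borel \<and> M \<ge> 0 \<and> (\<forall>x. \<bar>f' x\<bar> \<le> M) \<and> (AE x in lborel. D x \<bullet> i = f' x)"
      by (rule Linfty_on_borel_representative) auto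
  qed
  from bchoice[OF *] obtain f where f: "\<forall>i\<in>Basis. \<exists>M. f i \<in> borel_measurable borel \<and> M \<ge> 0 \<and> (\<forall>x. \<bar>f i x\<bar>
    \<le> M) \<and> (AE x in lborel. D x \<bullet> i = f i x)" ..
  from bchoice[OF f] obtain M where "\<forall>i\<in>Basis. f i \<in> borel_measurable borel \<and> M i \<ge> 0 \<and> (\<forall>x. \<bar>f i x\<bar>
    \<le> M i) \<and> (AE x in lborel. D x \<bullet> i = f i x)" ..
  then have fM: "\<And>i. i \<in> Basis \<Longrightarrow> f i \<in> borel_measurable borel" "\<And>i. i \<in> Basis \<Longrightarrow> M i \<ge> 0"
      "\<And>i x. i \<in> Basis \<Longrightarrow> \<bar>f i x\<bar> \<le> M i" "\<And>i. i \<in> Basis \<Longrightarrow> AE x in lborel. D x \<bullet> i = f i x"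
    by blast+
  show thesis
  proof (rule that[of "\<lambda>x. \<Sum>i\<in>Basis. f i x *\<^sub>R i" "\<Sum>i\<in>Basis. M i"])
    show "(\<lambda>x. \<Sum>i\<in>Basis. f i x *\<^sub>R i) \<in> borel_measurable borel"
      using fM(1) by (intro borel_measurable_sum borel_measurable_scaleR) auto
    show "(\<Sum>i\<in>Basis. M i) \<ge> 0" using fM(2) by (intro sum_nonneg) auto
    show "norm (\<Sum>i\<in>Basis. f i x *\<^sub>R i) \<le> (\<Sum>i\<in>Basis. M i)" for x
      using fM(3) by (intro sum_norm_le) auto
    have "AE x in lborel. \<forall>i\<in>Basis. D x \<bullet> i = f i x"
      using fM(4) by (simp add: AE_finite_all)
    then show "AE x in lborel. D x = (\<Sum>i\<in>Basis. f i x *\<^sub>R i)"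
    proof eventually_elim
      case (elim x)
      have "D x = (\<Sum>i\<in>Basis. (D x \<bullet> i) *\<^sub>R i)" by (rule euclidean_representation[symmetric])
      also have "\<dots> = (\<Sum>i\<in>Basis. f i x *\<^sub>R i)" using elim by (intro sum.cong) auto
      finally show ?case .
    qed
  qed
qed

text \<open>Used for \<open>D\<close>, which depends on space only: a null set of points times the
  whole time axis is null, although that axis has infinite measure.\<close>

lemma AE_lborel_snd:
  assumes "AE x in lborel. P (x :: 'b::euclidean_space)"
  shows "AE p in (lborel :: ('a::euclidean_space \<times> 'b) measure). P (snd p)"
proof -
  obtain N where N: "N \<in> null_sets lborel" "{x \<in> space lborel. \<not> P x} \<subseteq> N"
    using assms by (auto elim: AE_E2 simp: eventually_ae_filter)
  have "emeasure (lborel \<Otimes>\<^sub>M lborel :: ('a \<times> 'b) measure) (UNIV \<times> N)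
    = emeasure lborel (UNIV :: 'a set) * emeasure lborel N"
    using N by (intro lborel.emeasure_pair_measure_Times) auto
  then have "UNIV \<times> N \<in> null_sets (lborel \<Otimes>\<^sub>M lborel :: ('a \<times> 'b) measure)"
    using N by (intro null_setsI) (auto simp: null_sets_def)
  then have "AE p in (lborel \<Otimes>\<^sub>M lborel :: ('a \<times> 'b) measure). p \<notin> UNIV \<times> N"
    by (rule AE_not_in)
  then have "AE p in (lborel \<Otimes>\<^sub>M lborel :: ('a \<times> 'b) measure). P (snd p)"
    by eventually_elim (use N(2) in auto)
  then show ?thesis unfolding lborel_prod .
qed

section \<open>Derivatives along time and space slices\<close>

lemma
  fixes \<phi> :: "real \<times> 'a::euclidean_space \<Rightarrow> real"
  assumes \<phi>: "smooth \<phi>"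
  shows deriv_time_slice: "deriv (\<lambda>s. \<phi> (s, x)) t = dir_deriv (1, 0) \<phi> (t, x)"
    and dir_deriv_space_slice: "dir_deriv v (\<lambda>y. \<phi> (t, y)) = (\<lambda>x. dir_deriv (0, v) \<phi> (t, x))"
proof -
  have der: "(\<phi> has_derivative frechet_derivative \<phi> (at p)) (at p)" for p
    using smooth_differentiable[OF \<phi>] by (simp add: frechet_derivative_works)
  have "((\<lambda>s. \<phi> (s, x)) has_derivative (\<lambda>h. frechet_derivative \<phi> (at (t, x)) (h, 0))) (at t)"
    by (rule has_derivative_compose[where f = "\<lambda>s. (s, x)", OF _ der]) (auto intro!: derivative_eq_intros)
  moreover have "(\<lambda>h. frechet_derivative \<phi> (at (t, x)) (h, 0)) = (*) (dir_deriv (1, 0) \<phi> (t, x))"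
  proof
    fix h :: real
    interpret bounded_linear "frechet_derivative \<phi> (at (t, x))" using der by (rule has_derivative_bounded_linear)
    show "frechet_derivative \<phi> (at (t, x)) (h, 0) = dir_deriv (1, 0) \<phi> (t, x) * h"
      using scale[of h "(1, 0)"] by (simp add: dir_deriv_def mult.commute)
  qed
  ultimately show "deriv (\<lambda>s. \<phi> (s, x)) t = dir_deriv (1, 0) \<phi> (t, x)"
    by (intro DERIV_imp_deriv) (simp add: has_field_derivative_def)
  show "dir_deriv v (\<lambda>y. \<phi> (t, y)) = (\<lambda>x. dir_deriv (0, v) \<phi> (t, x))"
  proof
    fix x
    have "((\<lambda>y. \<phi> (t, y)) has_derivative (\<lambda>h. frechet_derivative \<phi> (at (t, x)) (0, h))) (at x)"
      by (rule has_derivative_compose[where f = "\<lambda>y. (t, y)", OF _ der]) (auto intro!: derivative_eq_intros)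
    from dir_deriv_eq[OF this] show "dir_deriv v (\<lambda>y. \<phi> (t, y)) x = dir_deriv (0, v) \<phi> (t, x)"
      by (simp add: dir_deriv_def)
  qed
qed

text \<open>Slice derivatives are directional derivatives of \<open>\<phi>\<close> on the product
  space, hence jointly continuous.\<close>

lemma space_time_derivatives_measurable:
  fixes \<phi> :: "real \<times> 'a::euclidean_space \<Rightarrow> real"
  assumes \<phi>: "smooth \<phi>"
  shows "(\<lambda>p. deriv (\<lambda>s. \<phi> (s, snd p)) (fst p)) \<in> borel_measurable borel"
    and "(\<lambda>p. laplacian (\<lambda>y. \<phi> (fst p, y)) (snd p)) \<in> borel_measurable borel"
    and "(\<lambda>p. grad (\<lambda>y. \<phi> (fst p, y)) (snd p)) \<in> borel_measurable borel"
proof -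
  have B: "(0, i) \<in> Basis" if "i \<in> Basis" for i :: 'a using that by (auto simp: Basis_prod_def)
  have sm1: "smooth (dir_deriv (0, i) \<phi>)"
    and sm2: "smooth (dir_deriv (0, i) (dir_deriv (0, i) \<phi>))" if "i \<in> Basis" for i :: 'a
    by (rule smooth_dir_deriv[OF \<phi> B[OF that]], rule smooth_dir_deriv[OF smooth_dir_deriv[OF \<phi> B[OF that]] B[OF that]])
  have "(1, 0) \<in> (Basis :: (real \<times> 'a) set)" by (auto simp: Basis_prod_def)
  from smooth_continuous_on[OF smooth_dir_deriv[OF \<phi> this], of UNIV]
  show "(\<lambda>p. deriv (\<lambda>s. \<phi> (s, snd p)) (fst p)) \<in> borel_measurable borel"
    unfolding deriv_time_slice[OF \<phi>] by (simp add: borel_measurable_continuous_onI)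
  have dd: "dir_deriv i (dir_deriv i (\<lambda>y. \<phi> (t, y))) x
    = dir_deriv (0, i) (dir_deriv (0, i) \<phi>) (t, x)" if "i \<in> Basis" for i x t
    by (simp add: dir_deriv_space_slice[OF \<phi>] dir_deriv_space_slice[OF sm1[OF that]])
  have "continuous_on UNIV (\<lambda>p. \<Sum>i\<in>Basis. dir_deriv (0, i) (dir_deriv (0, i) \<phi>) p)"
    by (intro continuous_intros smooth_continuous_on[OF sm2])
  moreover have "laplacian (\<lambda>y. \<phi> (fst p, y)) (snd p) = (\<Sum>i\<in>Basis. dir_deriv (0, i) (dir_deriv (0, i) \<phi>) p)" for p
    by (simp add: laplacian_def dd)
  ultimately show "(\<lambda>p. laplacian (\<lambda>y. \<phi> (fst p, y)) (snd p)) \<in> borel_measurable borel"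
    by (simp add: borel_measurable_continuous_onI)
  have "continuous_on UNIV (\<lambda>p. \<Sum>i\<in>Basis. dir_deriv (0, i) \<phi> p *\<^sub>R i)"
    by (intro continuous_intros smooth_continuous_on[OF sm1])
  moreover have "grad (\<lambda>y. \<phi> (fst p, y)) (snd p) = (\<Sum>i\<in>Basis. dir_deriv (0, i) \<phi> p *\<^sub>R i)" for p
    by (simp add: grad_def dir_deriv_space_slice[OF \<phi>])
  ultimately show "(\<lambda>p. grad (\<lambda>y. \<phi> (fst p, y)) (snd p)) \<in> borel_measurable borel"
    by (simp add: borel_measurable_continuous_onI)
qed

lemma C1_differentiable_on_UNIV_deriv:
  fixes f :: "real \<Rightarrow> real"
  assumes "f C1_differentiable_on UNIV"
  shows "(f has_real_derivative deriv f x) (at x)" "continuous_on UNIV (deriv f)"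
proof -
  obtain D where D: "\<And>x. (f has_vector_derivative D x) (at x)" "continuous_on UNIV D"
    using assms by (auto simp: C1_differentiable_on_def)
  have "deriv f = D" using D(1)
    by (auto intro!: DERIV_imp_deriv simp: has_real_derivative_iff_has_vector_derivative)
  with D show "(f has_real_derivative deriv f x) (at x)" "continuous_on UNIV (deriv f)"
    by (auto simp: has_real_derivative_iff_has_vector_derivative)
qed

text \<open>The mean value theorem gives \<open>\<beta> r - \<beta> s = c * (r - s)\<close> with a
  slope \<open>c\<close> between 0 and \<open>L\<close>, and then
  \<open>c^2 <= L * c\<close>.\<close>

lemma sq_diff_le_of_deriv_bounds:
  fixes \<beta> :: "real \<Rightarrow> real"
  assumes \<beta>: "\<And>x. (\<beta> has_real_derivative \<beta>' x) (at x)" and b: "\<And>x. x \<in> {-M..M} \<Longrightarrow> 0 \<le> \<beta>' x \<and> \<beta>' x \<le> L"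
    and rs: "\<bar>r\<bar> \<le> M" "\<bar>s\<bar> \<le> M"
  shows "(\<beta> r - \<beta> s)\<^sup>2 \<le> L * ((\<beta> r - \<beta> s) * (r - s))" "0 \<le> (\<beta> r - \<beta> s) * (r - s)"
proof -
  have *: "\<exists>c. 0 \<le> c \<and> c \<le> L \<and> \<beta> r - \<beta> s = c * (r - s)" if sr: "s < r" "\<bar>r\<bar> \<le> M" "\<bar>s\<bar> \<le> M" for r s
  proof -
    obtain x where x: "s < x" "x < r" "\<beta> r - \<beta> s = (r - s) * \<beta>' x"
      using MVT2[OF sr(1), of \<beta> \<beta>'] \<beta> by blast
    moreover have "0 \<le> \<beta>' x \<and> \<beta>' x \<le> L" using x(1,2) sr by (intro b) (auto simp: abs_le_iff)
    ultimately show ?thesis by (intro exI[of _ "\<beta>' x"]) (auto simp: mult.commute)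
  qed
  obtain c where c: "0 \<le> c" "c \<le> L" "\<beta> r - \<beta> s = c * (r - s)"
  proof (cases r s rule: linorder_cases)
    case less
    then obtain c where "0 \<le> c" "c \<le> L" "\<beta> s - \<beta> r = c * (s - r)" using *[of r s] rs by blast
    then show thesis by (intro that[of c]) (auto simp: algebra_simps)
  next
    case equal
    moreover have "0 \<le> \<beta>' r \<and> \<beta>' r \<le> L" using rs by (intro b) (auto simp: abs_le_iff)
    ultimately show thesis by (intro that[of "\<beta>' r"]) auto
  next
    case greater
    then show thesis using *[of s r] rs that by blast
  qed
  have "c * (r - s)\<^sup>2 * c \<le> c * (r - s)\<^sup>2 * L" using c by (intro mult_left_mono) auto
  then show "(\<beta> r - \<beta> s)\<^sup>2 \<le> L * ((\<beta> r - \<beta> s) * (r - s))" unfolding c(3) by (simp add: power2_eq_square mult_ac)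
  show "0 \<le> (\<beta> r - \<beta> s) * (r - s)" unfolding c(3) using c(1) by (simp add: mult.assoc)
qed

text \<open>The derivative bound makes both \<open>\<alpha> * \<beta> - f\<close> and
  \<open>\<alpha> * \<beta> + f\<close> nondecreasing. Applied to \<open>f r = b r * r\<close>, this
  yields the difference form of (jv).\<close>

lemma abs_diff_le_of_abs_deriv_le:
  fixes f \<beta> :: "real \<Rightarrow> real"
  assumes f: "\<And>x. (f has_real_derivative f' x) (at x)" and \<beta>: "\<And>x. (\<beta> has_real_derivative \<beta>' x) (at x)"
    and le: "\<And>x. x \<in> {-M..M} \<Longrightarrow> \<bar>f' x\<bar> \<le> \<alpha> * \<beta>' x" and "\<alpha> \<ge> 0" and rs: "\<bar>r\<bar> \<le> M" "\<bar>s\<bar> \<le> M"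
  shows "\<bar>f r - f s\<bar> \<le> \<alpha> * \<bar>\<beta> r - \<beta> s\<bar>"
proof -
  have *: "\<bar>f r - f s\<bar> \<le> \<alpha> * (\<beta> r - \<beta> s)" if "s \<le> r" "\<bar>r\<bar> \<le> M" "\<bar>s\<bar> \<le> M" for r s
  proof -
    have "\<alpha> * \<beta> s - f s \<le> \<alpha> * \<beta> r - f r"
    proof (rule DERIV_nonneg_imp_nondecreasing[OF that(1)])
      fix x assume "s \<le> x" "x \<le> r"
      then show "\<exists>y. ((\<lambda>x. \<alpha> * \<beta> x - f x) has_real_derivative y) (at x) \<and> 0 \<le> y"
        using DERIV_diff[OF DERIV_cmult[OF \<beta>] f] le[of x] that by (intro exI conjI) (auto simp: abs_le_iff)
    qed
    moreover have "\<alpha> * \<beta> s + f s \<le> \<alpha> * \<beta> r + f r"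
    proof (rule DERIV_nonneg_imp_nondecreasing[OF that(1)])
      fix x assume "s \<le> x" "x \<le> r"
      then show "\<exists>y. ((\<lambda>x. \<alpha> * \<beta> x + f x) has_real_derivative y) (at x) \<and> 0 \<le> y"
        using DERIV_add[OF DERIV_cmult[OF \<beta>] f] le[of x] that by (intro exI conjI) (auto simp: abs_le_iff)
    qed
    ultimately show ?thesis by (simp add: abs_le_iff algebra_simps)
  qed
  have "\<alpha> * (\<beta> r - \<beta> s) \<le> \<alpha> * \<bar>\<beta> r - \<beta> s\<bar>" "\<alpha> * (\<beta> s - \<beta> r) \<le> \<alpha> * \<bar>\<beta> r - \<beta> s\<bar>"
    using \<open>\<alpha> \<ge> 0\<close> by (intro mult_left_mono; simp)+
  then show ?thesis
    using *[of s r] *[of r s] rs by (cases "s \<le> r") (auto simp: abs_minus_commute)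
qed

section \<open>Uniqueness\<close>

lemma distributional_solution_unique:
  fixes T :: real and \<beta> b :: "real \<Rightarrow> real" and D :: "'a::euclidean_space \<Rightarrow> 'a" and y1 y2 :: "real \<times> 'a \<Rightarrow> real"
  assumes T: "T > 0"
    and j: "\<beta> C1_differentiable_on UNIV" "\<And>r. deriv \<beta> r \<ge> 0"
    and jj: "D \<in> Linfty_on UNIV"
    and jjj: "b C1_differentiable_on UNIV"
    and jv: "\<And>K. compact K \<Longrightarrow> \<exists>\<alpha>>0. \<forall>r\<in>K. \<bar>deriv b r * r + b r\<bar> \<le> \<alpha> * \<bar>deriv \<beta> r\<bar>"
    and bounded: "y1 \<in> Linfty_on ({0<..<T} \<times> UNIV)" "y2 \<in> Linfty_on ({0<..<T} \<times> UNIV)"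
    and solutions: "distributional_solution T \<beta> b D \<rho>0 y1" "distributional_solution T \<beta> b D \<rho>0 y2"
  shows "AE p in lebesgue_on ({0<..<T} \<times> UNIV). y1 p = y2 p"
proof -
  let ?S = "{0<..<T} \<times> (UNIV :: 'a set)"
  have S [measurable]: "?S \<in> sets borel" by (intro borel_open open_Times) auto
  obtain u1 M1 where [measurable]: "u1 \<in> borel_measurable borel" and M1: "M1 \<ge> 0" "\<And>p. \<bar>u1 p\<bar> \<le> M1"
    and u1: "AE p in lborel. p \<in> ?S \<longrightarrow> y1 p = u1 p"
    using Linfty_on_borel_representative[OF bounded(1) S] by blast
  obtain u2 M2 where [measurable]: "u2 \<in> borel_measurable borel" and M2: "M2 \<ge> 0" "\<And>p. \<bar>u2 p\<bar> \<le> M2"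
    and u2: "AE p in lborel. p \<in> ?S \<longrightarrow> y2 p = u2 p"
    using Linfty_on_borel_representative[OF bounded(2) S] by blast
  obtain D' MD where [measurable]: "D' \<in> borel_measurable borel" and MD: "MD \<ge> 0" "\<And>x. norm (D' x) \<le> MD"
    and D': "AE x in lborel. D x = D' x"
    using Linfty_UNIV_vector_borel_representative[OF jj] by blast
  define K where "K = max M1 M2"
  have K: "K \<ge> 0" "\<And>p. \<bar>u1 p\<bar> \<le> K" "\<And>p. \<bar>u2 p\<bar> \<le> K"
    using M1 M2 by (auto simp: K_def le_max_iff_disj)
  note \<beta>_der = C1_differentiable_on_UNIV_deriv[OF j(1)] and b_der = C1_differentiable_on_UNIV_deriv[OF jjj]
  have [measurable]: "\<beta> \<in> borel_measurable borel" "b \<in> borel_measurable borel"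
    by (intro borel_measurable_continuous_onI continuous_at_imp_continuous_on ballI DERIV_isCont[OF \<beta>_der(1)] DERIV_isCont[OF b_der(1)])+
  obtain L where L: "\<And>r. r \<in> {-K..K} \<Longrightarrow> deriv \<beta> r \<le> L"
  proof -
    have "compact (deriv \<beta> ` {-K..K})"
      by (intro compact_continuous_image continuous_on_subset[OF \<beta>_der(2)]) auto
    then have "bounded (deriv \<beta> ` {-K..K})" by (rule compact_imp_bounded)
    then obtain L where "\<forall>y\<in>deriv \<beta> ` {-K..K}. norm y \<le> L" unfolding bounded_iff by blast
    then show thesis by (intro that[of L]) (auto simp: abs_le_iff)
  qed
  have L0: "L \<ge> 0" using L[of 0] j(2)[of 0] K(1) by simp
  obtain \<alpha> where \<alpha>: "\<alpha> > 0" "\<And>r. r \<in> {-K..K} \<Longrightarrow> \<bar>deriv b r * r + b r\<bar> \<le> \<alpha> * deriv \<beta> r"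
    using jv[of "{-K..K}"] j(2) by auto
  have sq_le: "(\<beta> r - \<beta> s)\<^sup>2 \<le> L * ((\<beta> r - \<beta> s) * (r - s))" and mono: "0 \<le> (\<beta> r - \<beta> s) * (r - s)"
    if "\<bar>r\<bar> \<le> K" "\<bar>s\<bar> \<le> K" for r s
    by (rule sq_diff_le_of_deriv_bounds[OF \<beta>_der(1) _ that], use j(2) L in auto)+
  have b_le: "\<bar>b r * r - b s * s\<bar> \<le> \<alpha> * \<bar>\<beta> r - \<beta> s\<bar>" if "\<bar>r\<bar> \<le> K" "\<bar>s\<bar> \<le> K" for r s
  proof (rule abs_diff_le_of_abs_deriv_le[OF _ \<beta>_der(1) _ _ that])
    show "((\<lambda>r. b r * r) has_real_derivative deriv b x * x + b x) (at x)" for x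
      using DERIV_mult[OF b_der(1) DERIV_ident] by (simp add: mult.commute)
  qed (use \<alpha> in auto)
  \<comment> \<open>The differences are extended by zero outside the strip, as
    \<open>linear_problem\<close> requires, and \<open>D\<close> is replaced by its Borel
    version.\<close>
  define z where "z p = indicator ?S p * (u1 p - u2 p)" for p
  define w where "w p = indicator ?S p * (\<beta> (u1 p) - \<beta> (u2 p))" for p
  define V where "V p = (indicator ?S p * (b (u1 p) * u1 p - b (u2 p) * u2 p)) *\<^sub>R D' (snd p)" for p
  have [measurable]: "(\<lambda>p :: real \<times> 'a. D' (snd p)) \<in> borel_measurable borel"
    by (rule measurable_compose[OF borel_measurable_continuous_onI[OF continuous_on_snd[OF continuous_on_id]]]) measurable
  have zwV [measurable]: "z \<in> borel_measurable borel" "w \<in> borel_measurable borel" "V \<in> borel_measurable borel"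
    unfolding z_def[abs_def] w_def[abs_def] V_def[abs_def] by measurable
  have z_le: "\<bar>z p\<bar> \<le> 2 * K" for p
  proof -
    have "\<bar>u1 p - u2 p\<bar> \<le> 2 * K" using K(2)[of p] K(3)[of p] by linarith
    then show ?thesis using K(1) by (simp add: z_def indicator_def)
  qed
  have w_sq: "(w p)\<^sup>2 \<le> L * (w p * z p)" "0 \<le> w p * z p" for p
    using sq_le[OF K(2,3), of p p] mono[OF K(2,3), of p p] by (simp_all add: w_def z_def indicator_def)
  \<comment> \<open>Dividing the bound on the square by the absolute value of \<open>w p\<close>
    gives the Lipschitz bound.\<close>
  have w_le: "\<bar>w p\<bar> \<le> L * (2 * K)" for p
  proof (cases "w p = 0")
    case False
    have "\<bar>w p\<bar> * \<bar>w p\<bar> \<le> \<bar>w p\<bar> * (L * (2 * K))"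
    proof -
      have "\<bar>w p\<bar> * \<bar>w p\<bar> \<le> L * (w p * z p)" using w_sq(1)[of p] by (simp add: power2_eq_square)
      also have "\<dots> = L * (\<bar>w p\<bar> * \<bar>z p\<bar>)" using w_sq(2)[of p] by (simp flip: abs_mult)
      also have "\<dots> \<le> L * (\<bar>w p\<bar> * (2 * K))" using L0 z_le by (intro mult_left_mono) auto
      finally show ?thesis by (simp add: mult_ac)
    qed
    then show ?thesis by (rule mult_left_le_imp_le) (use False in simp)
  qed (use L0 K in simp)
  have V_le: "norm (V p) \<le> (\<alpha> * MD) * \<bar>w p\<bar>" for p
  proof -
    have "norm (V p) = \<bar>indicator ?S p * (b (u1 p) * u1 p - b (u2 p) * u2 p)\<bar> * norm (D' (snd p))"
      by (simp add: V_def)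
    also have "\<dots> \<le> (\<alpha> * \<bar>w p\<bar>) * MD"
      using b_le[OF K(2,3), of p p] MD \<alpha>(1) by (intro mult_mono) (auto simp: w_def indicator_def)
    finally show ?thesis by (simp add: mult_ac)
  qed
  \<comment> \<open>\<open>linear_problem\<close> has one constant for both structural inequalities;
    the \<open>+ 1\<close> makes it positive.\<close>
  define C where "C = L + \<alpha> * MD + 1"
  have C: "C > 0" "L \<le> C" "\<alpha> * MD \<le> C" using L0 \<alpha>(1) MD(1) by (auto simp: C_def add_nonneg_pos)
  define M where "M = 2 * K + L * (2 * K) + (\<alpha> * MD) * (L * (2 * K))"
  have M: "2 * K \<le> M" "L * (2 * K) \<le> M" "(\<alpha> * MD) * (L * (2 * K)) \<le> M"
    using L0 K(1) \<alpha>(1) MD(1) by (auto simp: M_def)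
  have V_le_M: "norm (V p) \<le> M" for p
  proof -
    have "(\<alpha> * MD) * \<bar>w p\<bar> \<le> (\<alpha> * MD) * (L * (2 * K))"
      using \<alpha>(1) MD(1) by (intro mult_left_mono[OF w_le]) auto
    then show ?thesis using V_le[of p] M(3) by linarith
  qed
  have weak: "(LBINT p. z p * deriv (\<lambda>s. \<phi> (s, snd p)) (fst p) + w p * laplacian (\<lambda>y. \<phi> (fst p, y)) (snd p)
        + V p \<bullet> grad (\<lambda>y. \<phi> (fst p, y)) (snd p)) = 0" (is "(LBINT p. ?H p) = 0")
    if \<phi>: "\<phi> \<in> test_functions_on ({..<T} \<times> UNIV)" for \<phi>
  proof -
    have sm: "smooth \<phi>" using \<phi> by (auto simp: test_functions_on_def)
    note [measurable] = space_time_derivatives_measurable[OF sm]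
    define F where "F y = (\<lambda>(t, x). y (t, x) * deriv (\<lambda>s. \<phi> (s, x)) t + \<beta> (y (t, x)) * laplacian (\<lambda>y. \<phi> (t, y)) x
                  + b (y (t, x)) * y (t, x) * (D x \<bullet> grad (\<lambda>y. \<phi> (t, y)) x))" for y :: "real \<times> 'a \<Rightarrow> real"
    have F: "set_integrable lebesgue ?S (F y)" "(LINT p:?S|lebesgue. F y p)
      + signed_integral \<rho>0 (\<lambda>x. \<phi> (0, x)) = 0"
      if "distributional_solution T \<beta> b D \<rho>0 y" for y
      using that \<phi> unfolding distributional_solution_def F_def Let_def by auto
    note F1 = F[OF solutions(1)] and F2 = F[OF solutions(2)]
    \<comment> \<open>Subtraction removes the initial term for every \<open>\<phi>\<close>,
      including those nonzero at time 0, on which the absence of a constant of integration in the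
      modes relies.\<close>
    have "(LINT p:?S|lebesgue. F y1 p - F y2 p) = 0"
      using F1 F2 by (simp add: set_integral_diff)
    \<comment> \<open>Solutions are formulated with the completed measure, the linear problem with
      \<open>lborel\<close>; for the Borel integrand the two integrals agree.\<close>
    moreover have "(LBINT p. ?H p) = (\<integral>p. ?H p \<partial>lebesgue)"
      by (rule integral_completion[symmetric]) measurable
    moreover have "(\<integral>p. ?H p \<partial>lebesgue) = (LINT p:?S|lebesgue. F y1 p - F y2 p)"
      unfolding set_lebesgue_integral_def
    proof (rule integral_cong_AE)
      have "?H \<in> borel_measurable lborel" by measurable
      then show "?H \<in> borel_measurable lebesgue" by (rule measurable_completion)
      show "(\<lambda>p. indicator ?S p *\<^sub>R (F y1 p - F y2 p)) \<in> borel_measurable lebesgue"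
        using borel_measurable_integrable[OF Bochner_Integration.integrable_diff[OF F1(1)[unfolded set_integrable_def] F2(1)[unfolded set_integrable_def]]]
        by (simp add: right_diff_distrib)
      have "AE p in lborel. ?H p = indicator ?S p *\<^sub>R (F y1 p - F y2 p)"
        using u1 u2 AE_lborel_snd[OF D', where 'a = real]
      proof eventually_elim
        case (elim p)
        obtain t x where p: "p = (t, x)" by (cases p)
        show ?case
        proof (cases "p \<in> ?S")
          case True
          then show ?thesis using elim unfolding p F_def z_def w_def V_def by (simp add: algebra_simps)
        qed (simp add: z_def w_def V_def)
      qed
      then show "AE p in lebesgue. ?H p = indicator ?S p *\<^sub>R (F y1 p - F y2 p)"
        by (simp add: AE_completion_iff)
    qed
    ultimately show ?thesis by simp
  qed
  show ?thesis
  proof (rule decaying_weight)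
    fix \<rho> :: "'a \<Rightarrow> real" and \<sigma> :: "nat \<Rightarrow> 'a \<Rightarrow> real" and g :: "'a \<Rightarrow> 'a" and l :: "'a \<Rightarrow> real" and R
    assume \<rho>: "integrable lborel \<rho>" "\<And>x. \<rho> x > 0" "\<And>x. \<rho> x \<le> 1"
      and gl: "g \<in> borel_measurable borel" "l \<in> borel_measurable borel" "\<And>n. \<sigma> n \<in> test_functions"
    "\<And>x. (\<lambda>n. \<sigma> n x) \<longlonglongrightarrow> \<rho> x" "\<And>x. (\<lambda>n. grad (\<sigma> n) x) \<longlonglongrightarrow> g x" "\<And>x. (\<lambda>n. laplacian (\<sigma> n) x) \<longlonglongrightarrow> l x"
    "\<And>n x. \<bar>\<sigma> n x\<bar> \<le> R * \<rho> x" "\<And>n x. norm (grad (\<sigma> n) x) \<le> R * \<rho> x" "\<And>n x. \<bar>laplacian (\<sigma> n) x\<bar> \<le> R * \<rho> x"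
    interpret linear_problem T \<rho> z w V M C R \<sigma> g l
    proof
      show "norm (V p) \<le> C * \<bar>w p\<bar>" for p
        using order_trans[OF V_le mult_right_mono[OF C(3)]] by simp
      show "(w p)\<^sup>2 \<le> C * (w p * z p)" for p
        using order_trans[OF w_sq(1) mult_right_mono[OF C(2) w_sq(2)]] .
      show "\<bar>z p\<bar> \<le> M" "\<bar>w p\<bar> \<le> M" "norm (V p) \<le> M" for p
        using z_le[of p] w_le[of p] M V_le_M by (auto intro: order_trans)
    qed ((rule T \<rho> gl zwV C(1) weak; assumption?) | simp add: z_def w_def V_def)+
    have "AE p in lborel. p \<in> ?S \<longrightarrow> y1 p = y2 p"
      using z_eq_0 u1 u2 by eventually_elim (auto simp: z_def)
    then show ?thesis unfolding AE_lebesgue_on_iff[OF S] .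
  qed
qed

theorem theorem3p2:
  fixes T :: real and \<beta> b :: "real \<Rightarrow> real" and D :: "real^'d \<Rightarrow> real^'d"
    and \<rho>0 :: "(real^'d) set \<Rightarrow> real" and y1 y2 :: "real \<times> (real^'d) \<Rightarrow> real"
  assumes T: "T > 0"
    and j: "\<beta> C1_differentiable_on UNIV" "\<And>r. deriv \<beta> r \<ge> 0" "\<beta> 0 = 0"
    and jj: "D \<in> Linfty_on UNIV"
    and jjj: "b C1_differentiable_on UNIV"
    and jv: "\<And>K. compact K \<Longrightarrow> \<exists>\<alpha>>0. \<forall>r\<in>K. \<bar>deriv b r * r + b r\<bar> \<le> \<alpha> * \<bar>deriv \<beta> r\<bar>"
    and rho0: "signed_radon_measure \<rho>0"
    and bounded: "y1 \<in> Linfty_on ({0<..<T} \<times> UNIV)" "y2 \<in> Linfty_on ({0<..<T} \<times> UNIV)"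
    and solutions: "distributional_solution T \<beta> b D \<rho>0 y1" "distributional_solution T \<beta> b D \<rho>0 y2"
    and diff_Hm1: "in_Linfty_Hm1_on {0<..<T} (\<lambda>p. y1 p - y2 p)"
    and initial: "\<And>\<phi>. \<phi> \<in> test_functions \<Longrightarrow>
      ((\<lambda>t. esssup (lebesgue_on {0<..<t})
          (\<lambda>s. ereal \<bar>\<integral>x. (y1 (s, x) - y2 (s, x)) * \<phi> x \<partial>lebesgue\<bar>)) \<longlongrightarrow> 0) (at_right 0)"
  shows "AE p in lebesgue_on ({0<..<T} \<times> UNIV). y1 p = y2 p"
  by (rule distributional_solution_unique[OF T j(1,2) jj jjj jv bounded solutions])

end
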